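(* Let $a,c$ be real numbers with $0<a\le\min(1,2c)$, let $H_c=-\chi_{[-c,0)}+\chi_{[0,c)}$, and let $\mathcal{G}(H_c;a)=\{e^{-2\pi i m x}H_c(x-na):m,n\in\mathbb Z\}$. Then the following statements hold. (i) If $a\notin\mathbb Q$, then $\mathcal{G}(H_c;a)$ is not a frame for $L^2(\mathbb R)$ if and only if $c\in\mathbb N$. (ii) If $a=p/q$ is a simple fraction, then $\mathcal{G}(H_c;a)$ is not a frame for $L^2(\mathbb R)$ if and only if either $$|c-n|<\frac{\gcd(n,p)}{2q}\quad\text{for some } n\in\mathbb N$$ or $$\Big|c-\frac{np}{q}\Big|<\frac{\gcd(n,q)}{2q}-\frac{q-p}{2q}\quad\text{for some } n\in\mathbb N\setminus q\mathbb N.$$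
   Context: $\mathbb N=\{1,2,\dots\}$, $q\mathbb N=\{qn:n\in\mathbb N\}$. A non-negative rational $x$ is written as a simple fraction $p/q$ when $p,q$ are co-prime positive integers with $x=p/q$ if $x\notin\mathbb Z$, and $p=x$, $q=1$ if $x\in\mathbb Z$. A countable system $\{g_k\}$ is a frame for $L^2(\mathbb R)$ if there are constants $A,B>0$ with $A\|f\|_2^2\le\sum_k|\langle f,g_k\rangle|^2\le B\|f\|_2^2$ for all $f\in L^2(\mathbb R)$. *)

theory Defs
  imports "HOL-Analysis.Analysis"
begin

text \<open>
  Elements of \<open>L\<^sup>2(\<real>)\<close> are represented by Borel measurable, square-integrable functions. Every
  class of Lebesgue measurable functions modulo null sets has a Borel representative, and all
  quantities below depend only on the class.
\<close>

definition L2 :: "(real \<Rightarrow> complex) set" where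
  "L2 = {f \<in> borel_measurable lborel. integrable lborel (\<lambda>x. (cmod (f x))\<^sup>2)}"

definition L2_norm :: "(real \<Rightarrow> complex) \<Rightarrow> real" where
  "L2_norm f = sqrt (LINT x|lborel. (cmod (f x))\<^sup>2)"

definition L2_inner :: "(real \<Rightarrow> complex) \<Rightarrow> (real \<Rightarrow> complex) \<Rightarrow> complex" where
  "L2_inner f g = (LINT x|lborel. f x * cnj (g x))"

text \<open>Summability is required explicitly because \<^const>\<open>infsum\<close> is 0 for divergent sums.\<close>

definition is_frame :: "'i set \<Rightarrow> ('i \<Rightarrow> real \<Rightarrow> complex) \<Rightarrow> bool" where
  "is_frame I g \<longleftrightarrow> countable I \<and> (\<forall>k\<in>I. g k \<in> L2) \<and>
     (\<exists>A B. 0 < A \<and> 0 < B \<and>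
       (\<forall>f\<in>L2. (\<lambda>k. (cmod (L2_inner f (g k)))\<^sup>2) summable_on I \<and>
          A * (L2_norm f)\<^sup>2 \<le> (\<Sum>\<^sub>\<infinity>k\<in>I. (cmod (L2_inner f (g k)))\<^sup>2) \<and>
          (\<Sum>\<^sub>\<infinity>k\<in>I. (cmod (L2_inner f (g k)))\<^sup>2) \<le> B * (L2_norm f)\<^sup>2))"

definition gabor :: "(real \<Rightarrow> complex) \<Rightarrow> real \<Rightarrow> int \<times> int \<Rightarrow> real \<Rightarrow> complex" where
  "gabor g a = (\<lambda>(m, n) x.
     exp (- 2 * complex_of_real pi * \<i> * of_int m * complex_of_real x) * g (x - of_int n * a))"

definition H :: "real \<Rightarrow> real \<Rightarrow> complex" where
  "H c x = - indicator {-c..<0} x + indicator {0..<c} x"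

definition simple_fraction :: "real \<Rightarrow> nat \<Rightarrow> nat \<Rightarrow> bool" where
  "simple_fraction x p q \<longleftrightarrow>
     (if x \<in> \<int> then real p = x \<and> q = 1
      else 0 < p \<and> 0 < q \<and> coprime p q \<and> x = real p / real q)"

end

theory Submission
  imports Defs "HOL-Complex_Analysis.Great_Picard"
begin

text \<open>
  By Parseval on \<open>[0,1)\<close>, the system is a frame iff the operators \<open>v \<mapsto> (E\<^sub>v(y))\<^sub>y\<close> with \<open>y \<in> t + a\<int>\<close>,
  where \<open>E\<^sub>v(y)\<close> is the sum of \<open>v\<close> over the integers in \<open>[y, y+c)\<close> minus the sum over those in
  \<open>[y-c, y)\<close>, are bounded below on \<open>\<ell>\<^sup>2(\<int>)\<close> uniformly in \<open>t\<close>. By compactness and translation invariance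
  this fails only if some \<open>E\<^sub>v\<close> vanishes for a bounded \<open>v\<close> that attains its maximum. Comparing
  neighbouring windows, a maximum of \<open>v\<close> at \<open>j\<close> forces maxima at \<open>f(j) = \<lceil>y+c\<rceil>\<close> and \<open>g(j) = \<lceil>y-c\<rceil>\<close>,
  where \<open>y \<le> j < y + a\<close>; boundedness of \<open>v\<close> forces \<open>g \<circ> f = id\<close>. Along an \<open>f\<close>-orbit either the integer steps
  or the steps of \<open>y\<close> are then constant, so the offsets \<open>j - y \<in> [0,a)\<close> form an orbit of a rotation of
  \<open>\<real>/a\<int>\<close> or of \<open>\<real>/\<int>\<close> that avoids a neighbourhood of the endpoints, which bounds the distance of \<open>c\<close> from
  a multiple of 1 or of \<open>a\<close>. Conversely, indicators of suitable periodic sets of integers, cut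
  off slowly, violate the lower frame bound.
\<close>

section \<open>Bounded solutions of the window equation\<close>

text \<open>Both inequalities are the same statement about a rotation. With constant integer step
  \<open>n\<close> the offsets move by \<open>n\<close> on the circle of length
  \<open>L = a\<close>; with constant lattice step \<open>n\<close> they move by
  \<open>- n * a\<close> on the circle of length \<open>L = 1\<close>. Let \<open>e\<close> be the
  distance from \<open>c\<close> to \<open>n\<close>, respectively to \<open>n * a\<close>. The
  offsets stay in \<open>[e, a - e)\<close>, so the orbit misses an arc of length
  \<open>L - a + 2 * e\<close>, and the finest step of the rotation, \<open>gcd n p / q\<close> or
  \<open>gcd n q / q\<close>, must exceed it. The term \<open>(q - p) / (2 * q)\<close> is half of
  \<open>1 - a\<close>, the length of the circle outside \<open>[0, a)\<close>. An irrational
  rotation has arbitrarily small steps: this forces \<open>e = 0\<close> in the first case and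
  excludes the second. The bound \<open>a \<le> 1\<close> lets a window endpoint pass at most one
  integer per lattice step; \<open>a \<le> 2 * c\<close> makes the orbit of \<open>f\<close> move
  strictly upwards. Uniqueness of bounded solutions concerns the sup norm, a frame bound the l2
  norm. Exponential weights bridge the two: each entry is charged to windows at a cost that decays
  with their distance.\<close>

text \<open>Each step sequence takes at most two adjacent values. If both vary, \<open>k\<close> is
  large exactly for offsets below a threshold and \<open>l\<close> exactly for offsets above one.
  Because \<open>a \<le> 1\<close>, the index sets where \<open>k\<close> is large and where
  \<open>l\<close> is large are nested, which is impossible for a set of small offsets and a set of
  large offsets that are both nonempty and proper.\<close>

lemma constant_steps_dichotomy:
  fixes r :: "nat \<Rightarrow> real" and k l :: "nat \<Rightarrow> int" and a c :: real
  assumes a: "0 < a" "a \<le> 1"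
    and r: "\<And>n. 0 \<le> r n" "\<And>n. r n < a"
    and rel: "\<And>n. of_int (k n) - of_int (l n) * a = r (Suc n) - r n"
    and F1: "\<And>n. - r n \<le> of_int (k n) - c" "\<And>n. of_int (k n) - c < a - r n"
    and F2: "\<And>n. of_int (k n) - c \<le> r (Suc n)" "\<And>n. r (Suc n) - a < of_int (k n) - c"
  shows "(\<forall>n. k n = k 0) \<or> (\<forall>n. l n = l 0)"
proof (rule ccontr)
  assume "\<not> ?thesis"
  then obtain n1 n2 where n: "k n1 \<noteq> k 0" "l n2 \<noteq> l 0" by blast
  obtain u0 u1 where u: "k u1 > k u0"
    using n(1) by (metis linorder_neqE)
  obtain w0 w1 where w: "l w1 > l w0"
    using n(2) by (metis linorder_neqE)
  have kb: "\<bar>of_int (k n) - c\<bar> < 1" for n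
    using F1[of n] F2[of n] r[of n] r[of "Suc n"] a by linarith
  \<comment> \<open>By \<open>rel\<close>, the lattice step \<open>l n * a\<close> obeys the bounds
    \<open>F1\<close> and \<open>F2\<close> with \<open>r n\<close> and \<open>r (Suc n)\<close>
    exchanged.\<close>
  have Z1: "of_int (l n) * a - c < a - r (Suc n)" "- r (Suc n) \<le> of_int (l n) * a - c"
       "of_int (l n) * a - c \<le> r n" "r n - a < of_int (l n) * a - c" for n
    using F1[of n] F2[of n] rel[of n] by linarith+
  have K: "k n = k u1 \<or> k n = k u1 - 1" and K0: "k u0 = k u1 - 1" for n
    using kb[of n] kb[of u0] kb[of u1] u by linarith+
  have lb: "of_int (l n - l m) * a < 2 * a" for n m
    using Z1[of n] Z1[of m] r[of n] r[of m] r[of "Suc n"] r[of "Suc m"] by (simp add: algebra_simps)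
  have lb': "l n - l m < 2" for n m
    using lb[of n m] a by (simp add: mult_less_cancel_right_pos)
  have L: "l n = l w1 \<or> l n = l w1 - 1" and L0: "l w0 = l w1 - 1" for n
    using lb'[of n w0] lb'[of w1 n] lb'[of n w1] lb'[of w0 n] lb'[of w1 w0] w by linarith+
  define \<theta> where "\<theta> = of_int (k u1) - c"
  define \<eta> where "\<eta> = of_int (l w1) * a - c"
  have U1: "r n < a - \<theta>" if "k n = k u1" for n using that F1[of n] by (simp add: \<theta>_def)
  have U0: "a - \<theta> \<le> r n" if "k n \<noteq> k u1" for n
  proof -
    have "k n = k u1 - 1" using K that by blast
    then have "of_int (k n) - c = \<theta> - 1" by (simp add: \<theta>_def)
    then show ?thesis using F1[of n] a by linarith
  qed
  have W1: "\<eta> \<le> r n" "\<eta> \<le> r n + (of_int (k n) - c)" if "l n = l w1" for n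
    using that Z1[of n] rel[of n] r[of "Suc n"] by (simp_all add: \<eta>_def)
  have W0: "r n < \<eta>" "r n + (of_int (k n) - c) < \<eta>" if "l n \<noteq> l w1" for n
  proof -
    have "l n = l w1 - 1" using L that by blast
    then have "of_int (l w1) = 1 + (of_int (l n) :: real)" by simp
    then have "of_int (l n) * a - c = \<eta> - a" by (simp add: \<eta>_def algebra_simps)
    then show "r n < \<eta>" "r n + (of_int (k n) - c) < \<eta>" using Z1[of n] rel[of n] r[of "Suc n"] by linarith+
  qed
  \<comment> \<open>Two such indices would have offsets more than 1 apart, whereas all offsets lie
    in \<open>[0, a)\<close>.\<close>
  have not_both: False if "k n = k u1" "l n \<noteq> l w1" "k m \<noteq> k u1" "l m = l w1" for n m
  proof -
    have "k m = k u1 - 1" using K that by blast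
    then show False using W0(2)[OF that(2)] W1(2)[OF that(4)] that(1) r[of n] r[of m] a by simp
  qed
  show False
  proof (cases "\<exists>n. k n = k u1 \<and> l n \<noteq> l w1")
    case True
    then have imp: "l m = l w1 \<Longrightarrow> k m = k u1" for m using not_both by blast
    have "l u0 \<noteq> l w1" using imp K0 by force
    then show False using W0(1)[of u0] W1(1)[of w1] U1[of w1] U0[of u0] imp[of w1] K0 by force
  next
    case False
    then have imp: "k m = k u1 \<Longrightarrow> l m = l w1" for m by blast
    have "k w0 \<noteq> k u1" using imp L0 by force
    then show False using W0(1)[of w0] W1(1)[of u1] U1[of u1] U0[of w0] imp[of u1] L0 by force
  qed
qed

text \<open>
  The orbit of a rotation of \<open>\<real>/L\<int>\<close> that is invariant under a step \<open>d\<close> cannot jump over the arc from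
  \<open>a - e\<close> to \<open>L + e\<close> unless \<open>d\<close> exceeds its length.
\<close>

lemma rotation_gap:
  fixes r :: "nat \<Rightarrow> real"
  assumes "a \<le> L" "0 < d" 
    and r: "\<And>n. e \<le> r n" "\<And>n. r n < a - e"
    and step: "\<And>n. \<exists>z::int. r (Suc n) - r n - \<delta> = of_int z * L"
    and N: "of_nat N * \<delta> - d = of_int w * L"
  shows "2 * e < d - L + a"
proof (rule ccontr)
  assume "\<not> ?thesis"
  then have neg: "d \<le> L - a + 2 * e" by simp
  have L: "0 < L"
    using r(1)[of 0] r(2)[of 0] neg assms(1,2) by linarith
  have multi: "\<exists>z::int. r (m + n) - r m - of_nat n * \<delta> = of_int z * L" for m n
  proof (induction n)
    case (Suc n)
    obtain z1 z2 :: int where "r (m + n) - r m - of_nat n * \<delta> = of_int z1 * L"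
        "r (Suc (m + n)) - r (m + n) - \<delta> = of_int z2 * L"
      using Suc step by blast
    then have "r (m + Suc n) - r m - of_nat (Suc n) * \<delta> = of_int (z1 + z2) * L"
      by (simp add: algebra_simps)
    then show ?case by blast
  qed (auto intro: exI[of _ 0])
  \<comment> \<open>Over \<open>N\<close> steps the offset changes by \<open>d\<close> modulo
    \<open>L\<close>. A change of \<open>d - L\<close> or less would be a fall by at least
    \<open>a - 2 * e\<close>, too long for \<open>[e, a - e)\<close>. So the offset gains at least
    \<open>d\<close> every \<open>N\<close> steps and cannot stay bounded.\<close>
  have inc: "r (m + N) \<ge> r m + d" for m
  proof -
    obtain z :: int where z: "r (m + N) - r m - of_nat N * \<delta> = of_int z * L"
      using multi by blast
    define z' where "z' = z + w"
    have z': "r (m + N) - r m - d = of_int z' * L"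
      using z N by (simp add: algebra_simps z'_def)
    have "of_int z' * L > - 1 * L"
      using z' r(1)[of "m + N"] r(2)[of m] neg by simp
    then have "of_int z' > (-1::real)" using L mult_less_cancel_right_pos by blast
    then have "z' \<ge> 0" by simp
    then have "of_int z' * L \<ge> 0" using L by simp
    then show ?thesis using z' by linarith
  qed
  have lin: "r (n * N) \<ge> r 0 + of_nat n * d" for n
  proof (induction n)
    case (Suc n)
    then show ?case using inc[of "n * N"] by (simp add: algebra_simps)
  qed simp
  obtain n :: nat where "of_nat n * d > a - e - r 0"
    using reals_Archimedean3[OF assms(2)] by blast
  then show False using lin[of n] r(2)[of "n * N"] by simp
qed


lemma lipschitz_int:
  fixes V :: "int \<Rightarrow> real"
  assumes "\<And>k. \<bar>V (k + 1) - V k\<bar> \<le> 1"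
  shows "\<bar>V i - V j\<bar> \<le> of_int \<bar>i - j\<bar>"
proof -
  have *: "\<bar>V (j + int n) - V j\<bar> \<le> of_nat n" for n j
  proof (induction n)
    case (Suc n)
    then show ?case using assms[of "j + int n"] by (simp add: algebra_simps)
  qed simp
  show ?thesis
    using *[of j "nat (i - j)"] *[of i "nat (j - i)"] by (cases "i \<le> j") auto
qed

text \<open>\<open>J\<close> collects the places where \<open>V\<close> grows by the maximal amount
  1. Subtracting \<open>eq\<close> at \<open>y j\<close> from \<open>eq\<close> at
  \<open>y j + a\<close> yields two increments of \<open>V\<close> with sum 2. As
  \<open>a \<le> 1\<close>, each of them spans at most one integer, so each equals 1, which is
  \<open>hit\<close>. The result is the \<open>f\<close>-orbit of 0 together with its lattice
  indices.\<close>

lemma bounded_solution_orbit: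
  fixes V :: "int \<Rightarrow> real" and a c t :: real
  assumes a: "0 < a" "a \<le> 1" and c: "a \<le> 2 * c"
    and lip: "\<And>k. \<bar>V (k + 1) - V k\<bar> \<le> 1" and V0: "V 1 - V 0 = 1"
    and eq: "\<And>n::int. V \<lceil>t + of_int n * a + c\<rceil> + V \<lceil>t + of_int n * a - c\<rceil> = 2 * V \<lceil>t + of_int n * a\<rceil>"
  obtains x N :: "nat \<Rightarrow> int" where
    "\<And>n. x n < x (Suc n)"
    "\<And>n. t + of_int (N n) * a \<le> of_int (x n)" "\<And>n. of_int (x n) < t + of_int (N n) * a + a"
    "\<And>n. t + of_int (N n) * a + c \<le> of_int (x (Suc n))" 
    "\<And>n. of_int (x (Suc n)) < t + of_int (N n) * a + c + a"
    "\<And>n. t + of_int (N (Suc n)) * a - c \<le> of_int (x n)" 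
    "\<And>n. of_int (x n) < t + of_int (N (Suc n)) * a - c + a"
proof -
  define M where "M j = \<lfloor>(of_int j - t) / a\<rfloor>" for j :: int
  define y where "y j = t + of_int (M j) * a" for j
  have y: "y j \<le> of_int j" "of_int j < y j + a" for j
    using floor_divide_lower[OF a(1), of "of_int j - t"] floor_divide_upper[OF a(1), of "of_int j - t"] 
    by (simp_all add: y_def M_def algebra_simps)
  define f where "f j = \<lceil>y j + c\<rceil>" for j
  define g where "g j = \<lceil>y j - c\<rceil>" for j
  define J where "J = {j. V (j + 1) - V j = 1}"
  have J0: "0 \<in> J" using V0 by (simp add: J_def)
  have ymono: "y i \<le> y j" if "i \<le> j" for i j
    using that a by (auto simp: y_def M_def intro!: mult_right_mono floor_mono divide_right_mono)
  have ceil: "\<lceil>y j\<rceil> = j" "\<lceil>y j + a\<rceil> = j + 1" for j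
    using y[of j] a by (auto intro!: ceiling_unique)
  have bal: "V (f j) + V (g j) = 2 * V j" for j
    using eq[of "M j"] ceil[of j] by (simp add: f_def g_def y_def)
  have bal': "V \<lceil>y j + c + a\<rceil> + V \<lceil>y j - c + a\<rceil> = 2 * V (j + 1)" for j
    using eq[of "M j + 1"] ceil(2)[of j] by (simp add: y_def algebra_simps)
  have step1: "\<lceil>z + a\<rceil> = \<lceil>z\<rceil> \<or> \<lceil>z + a\<rceil> = \<lceil>z\<rceil> + 1" for z :: real
    using a by linarith
  have hit: "f j \<in> J" "of_int (f j) < y j + c + a" "g j \<in> J" "of_int (g j) < y j - c + a"
    if "j \<in> J" for j
  proof -
    have *: "V \<lceil>y j + c + a\<rceil> - V (f j) + (V \<lceil>y j - c + a\<rceil> - V (g j)) = 2"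
      using bal[of j] bal'[of j] that by (simp add: J_def)
    have b: "\<bar>V \<lceil>z + a\<rceil> - V \<lceil>z\<rceil>\<bar> \<le> 1" for z
      using step1[of z] lip[of "\<lceil>z\<rceil>"] by auto
    have 1: "V \<lceil>y j + c + a\<rceil> - V (f j) = 1" "V \<lceil>y j - c + a\<rceil> - V (g j) = 1"
      using * b[of "y j + c"] b[of "y j - c"] unfolding f_def g_def by linarith+
    then have 2: "\<lceil>y j + c + a\<rceil> = f j + 1" "\<lceil>y j - c + a\<rceil> = g j + 1"
      using step1[of "y j + c"] step1[of "y j - c"] unfolding f_def g_def by auto
    then show "f j \<in> J" "g j \<in> J" using 1 by (simp_all add: J_def)
    show "of_int (f j) < y j + c + a" "of_int (g j) < y j - c + a"
      using 2 by linarith+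
  qed
  have hit': "y j + c \<le> of_int (f j)" "y j - c \<le> of_int (g j)" for j
    by (simp_all add: f_def g_def)
  have c0: "0 < c" using a c by linarith
  have fge: "j \<le> f j" for j
    using hit'(1)[of j] y(2)[of j] c0 ceil(1)[of j] unfolding f_def by (smt (verit) ceiling_mono)
  \<comment> \<open>If \<open>f j = j\<close>, then \<open>a \<le> 2 * c\<close> gives
    \<open>g j = j - 1\<close>, and the balance makes \<open>V\<close> equal at \<open>j - 1\<close>
    and \<open>j\<close>, although \<open>g j \<in> J\<close> demands growth by 1 there.\<close>
  have fgt: "j < f j" if "j \<in> J" for j
  proof (rule ccontr)
    assume "\<not> ?thesis"
    then have fj: "f j = j" using fge[of j] by simp
    then have "g j = j - 1"
      using hit'[of j] hit[OF that] y[of j] a c by linarith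
    moreover have "V (g j) = V j" using bal[of j] fj by simp
    ultimately show False using hit(3)[OF that] by (simp add: J_def)
  qed
  have gf: "g (f j) = j - 1 \<or> g (f j) = j \<or> g (f j) = j + 1" if "j \<in> J" for j
    using hit'(1)[of j] hit(2)[OF that] hit'(2)[of "f j"] hit(4)[OF hit(1)[OF that]] y[of j] y[of "f j"] a
    by linarith
  have fmono: "f i < f j" if "i < j" "i \<in> J" for i j
  proof -
    have "y i < y j" using y[of i] y[of j] ymono[of i j] that(1) a by linarith
    then have "M i < M j" using a by (simp add: y_def)
    then have "(of_int (M i) + 1) * a \<le> of_int (M j) * a" using a by (intro mult_right_mono) auto
    then have "y i + a \<le> y j" by (simp add: y_def algebra_simps)
    then show ?thesis using hit(2)[OF that(2)] hit'(1)[of j] by linarith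
  qed
  have gmono: "g i < g j" if "i < j" "i \<in> J" for i j
  proof -
    have "y i < y j" using y[of i] y[of j] ymono[of i j] that(1) a by linarith
    then have "M i < M j" using a by (simp add: y_def)
    then have "(of_int (M i) + 1) * a \<le> of_int (M j) * a" using a by (intro mult_right_mono) auto
    then have "y i + a \<le> y j" by (simp add: y_def algebra_simps)
    then show ?thesis using hit(4)[OF that(2)] hit'(2)[of j] by linarith
  qed
  define \<sigma> where "\<sigma> j = V (f j) - V j" for j
  have fbound: "of_int (f j - j) < c + a" if "j \<in> J" for j
    using hit(2)[OF that] y(1)[of j] by simp
  have \<sigma>_bound: "\<bar>\<sigma> j\<bar> < c + a" if "j \<in> J" for j
    using lipschitz_int[of V "f j" j, OF lip] fbound[OF that] fge[of j] by (simp add: \<sigma>_def)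
  \<comment> \<open>By the balance, the forward increment at \<open>f j\<close> equals the backward
    one. Hence \<open>\<sigma>\<close> is constant along an orbit as long as
    \<open>g (f j) = j\<close>, and any other value makes this bounded quantity drift.\<close>
  have \<sigma>_f: "\<sigma> (f j) = \<sigma> j + V j - V (g (f j))" for j
    using bal[of "f j"] by (simp add: \<sigma>_def)
  have iterJ: "(f ^^ n) j \<in> J" if "j \<in> J" for n j
    using that hit(1) by (induction n) auto
  have iterge: "j \<le> (f ^^ n) j" for n j
    by (induction n) (auto intro: order_trans fge)
  \<comment> \<open>A shift \<open>g (f j) = j + 1\<close> propagates to all larger integers and lowers \<open>\<sigma>\<close> by 1 at each step of \<open>f\<close>.\<close>
  have not_up: "g (f j) \<noteq> j + 1" if "j \<in> J" for j
  proof
    assume up: "g (f j) = j + 1"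
    have all: "j + int n \<in> J \<and> g (f (j + int n)) = j + int n + 1" for n
    proof (induction n)
      case (Suc n)
      define i where "i = j + int n"
      have i: "i \<in> J" "g (f i) = i + 1" using Suc by (auto simp: i_def)
      have i1: "i + 1 \<in> J" using hit(3)[OF hit(1)[OF i(1)]] i(2) by simp
      have "g (f i) < g (f (i + 1))" using fmono gmono hit(1) i(1) by simp
      then have "g (f (i + 1)) = i + 2" using gf[OF i1] i(2) by linarith
      then show ?case using i1 by (simp add: i_def algebra_simps)
    qed (use that up in auto)
    have all': "i \<in> J" "g (f i) = i + 1" if "j \<le> i" for i
      using all[of "nat (i - j)"] that by auto
    have dec: "\<sigma> ((f ^^ n) j) = \<sigma> j - of_nat n" for n
    proof (induction n)
      case (Suc n)
      have "V ((f ^^ n) j + 1) - V ((f ^^ n) j) = 1" using iterJ[OF that, of n] by (simp add: J_def)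
      then show ?case
        using Suc \<sigma>_f[of "(f ^^ n) j"] all'(2)[OF iterge[of j n]] by simp
    qed simp
    obtain n :: nat where "2 * (c + a) < of_nat n" using reals_Archimedean2 by blast
    then show False using dec[of n] \<sigma>_bound[OF that] \<sigma>_bound[OF iterJ[OF that, of n]] by (smt (verit))
  qed
  have not_down: "g (f j) \<noteq> j - 1" if "j \<in> J" for j
  proof
    assume down: "g (f j) = j - 1"
    have all: "j - int n \<in> J \<and> g (f (j - int n)) = j - int n - 1" for n
    proof (induction n)
      case (Suc n)
      define i where "i = j - int n"
      have i: "i \<in> J" "g (f i) = i - 1" using Suc by (auto simp: i_def)
      have i1: "i - 1 \<in> J" using hit(3)[OF hit(1)[OF i(1)]] i(2) by simp
      have "g (f (i - 1)) < g (f i)" using fmono[OF _ i1, of i] gmono[OF _ hit(1)[OF i1]] by simp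
      then have "g (f (i - 1)) = i - 2" using gf[OF i1] i(2) by linarith
      then show ?case using i1 by (simp add: i_def algebra_simps)
    qed (use that down in auto)
    have all': "i \<in> J" "g (f i) = i - 1" if "i \<le> j" for i
      using all[of "nat (j - i)"] that by auto
    obtain n :: nat where n: "2 * (c + a) < of_nat n" using reals_Archimedean2 by blast
    define B where "B = \<lceil>c + a\<rceil>"
    \<comment> \<open>A downward shift propagates only to smaller integers, while \<open>f\<close>
      moves upwards by at most \<open>B\<close>. Starting \<open>n * B\<close> below
      \<open>j\<close> keeps the first \<open>n\<close> iterates at or below \<open>j\<close>, and
      \<open>\<sigma>\<close> rises by \<open>n\<close> along them.\<close>
    define i where "i = j - int n * B"
    have "B \<ge> 0" using a c0 by (simp add: B_def)
    then have ij: "i \<le> j" by (simp add: i_def)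
    have iJ: "i \<in> J" using all'(1)[OF ij] .
    have le: "(f ^^ m) i \<le> i + int m * B" for m
    proof (induction m)
      case (Suc m)
      have "f ((f ^^ m) i) - (f ^^ m) i \<le> B"
        using fbound[OF iterJ[OF iJ, of m]] unfolding B_def by linarith
      then show ?case using Suc by (simp add: algebra_simps)
    qed simp
    have inc: "m \<le> n \<Longrightarrow> \<sigma> ((f ^^ m) i) = \<sigma> i + of_nat m" for m
    proof (induction m)
      case (Suc m)
      have "int m * B \<le> int n * B" using Suc \<open>B \<ge> 0\<close> by (intro mult_right_mono) auto
      then have m: "(f ^^ m) i \<le> j" using le[of m] by (simp add: i_def)
      have "V ((f ^^ m) i - 1 + 1) - V ((f ^^ m) i - 1) = 1" 
        using all'(1)[of "(f ^^ m) i - 1"] m unfolding J_def by simp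
      then show ?case
        using Suc \<sigma>_f[of "(f ^^ m) i"] all'(2)[OF m] by simp
    qed simp
    show False using inc[OF order_refl] n \<sigma>_bound[OF iJ] \<sigma>_bound[OF iterJ[OF iJ, of n]] by (smt (verit))
  qed
  define x where "x n = (f ^^ n) 0" for n
  have xJ: "x n \<in> J" for n using iterJ[OF J0] by (simp add: x_def)
  have xS: "x (Suc n) = f (x n)" for n by (simp add: x_def)
  have gx: "g (x (Suc n)) = x n" for n
    using gf[OF xJ] not_up[OF xJ] not_down[OF xJ] xS by metis
  show ?thesis
  proof (rule that[of x "\<lambda>n. M (x n)"])
    fix n
    show "x n < x (Suc n)" using fgt[OF xJ] xS by simp
    show "t + of_int (M (x n)) * a \<le> of_int (x n)" "of_int (x n) < t + of_int (M (x n)) * a + a"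
      using y[of "x n"] by (simp_all add: y_def)
    show "t + of_int (M (x n)) * a + c \<le> of_int (x (Suc n))" 
      "of_int (x (Suc n)) < t + of_int (M (x n)) * a + c + a"
      using hit'(1)[of "x n"] hit(2)[OF xJ, of n] by (simp_all add: y_def xS)
    show "t + of_int (M (x (Suc n))) * a - c \<le> of_int (x n)" 
      "of_int (x n) < t + of_int (M (x (Suc n))) * a - c + a"
      using hit'(2)[of "x (Suc n)"] hit(4)[OF xJ, of "Suc n"] by (simp_all add: y_def gx)
  qed
qed

section \<open>Small rotation steps and the resulting conditions on \<open>c\<close>\<close>

lemma small_multiple_irrational:
  fixes \<theta> \<epsilon> :: real
  assumes "\<theta> \<notin> \<rat>" "0 < \<epsilon>"
  obtains N :: nat and w :: int and d where "0 < d" "d < \<epsilon>" "of_nat N * \<theta> - d = of_int w"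
proof -
  obtain h k where hk: "k > 0" "\<bar>of_int k * \<theta> - of_int h - \<epsilon> / 2\<bar> < \<epsilon> / 2"
    using sequence_of_fractional_parts_is_dense[OF assms(1), of "\<epsilon> / 2" "\<epsilon> / 2"] assms(2) by (metis half_gt_zero)
  show ?thesis
    by (rule that[of "of_int k * \<theta> - of_int h" "nat k" h]) (use hk in \<open>auto simp: abs_if split: if_splits\<close>)
qed

text \<open>Since \<open>q\<close> is invertible modulo \<open>p\<close>, the multiples of
  \<open>K * q\<close> reach \<open>gcd K p\<close> modulo \<open>p\<close>. Divided by the
  denominator of \<open>a\<close>, this is the step \<open>d\<close> fed into
  \<open>rotation_gap\<close>.\<close>

lemma small_multiple_gcd:
  fixes K p q :: int
  assumes "coprime p q" "0 < p"
  obtains N :: nat and w :: int where "int N * K * q - gcd K p = w * p"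
proof -
  have "gcd (K * q) p = gcd K p"
    using assms(1) by (metis gcd_mult_right_right_cancel gcd.commute)
  then obtain u v where uv: "u * (K * q) + v * p = gcd K p"
    by (metis bezout_int)
  \<comment> \<open>A multiple of \<open>p\<close> makes the Bezout coefficient nonnegative without
    changing its residue.\<close>
  define N where "N = u + p * \<bar>u\<bar>"
  have "1 * \<bar>u\<bar> \<le> p * \<bar>u\<bar>" using assms(2) by (intro mult_right_mono) auto
  then have "N \<ge> 0" unfolding N_def by linarith
  moreover have "N * K * q - gcd K p = (\<bar>u\<bar> * K * q - v) * p"
    unfolding uv[symmetric] by (simp add: N_def algebra_simps)
  ultimately show ?thesis using that[of "nat N" "\<bar>u\<bar> * K * q - v"] by simp
qed

text \<open>The two-sided bound on an offset combines the window leading from an orbit point to the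
  next one with the window leading back to the previous one. The initial point has no predecessor,
  so the offsets used are \<open>r (Suc i)\<close>.\<close>

lemma null_dichotomy:
  fixes V :: "int \<Rightarrow> real" and a c t :: real
  assumes a: "0 < a" "a \<le> 1" and c: "a \<le> 2 * c"
    and lip: "\<And>k. \<bar>V (k + 1) - V k\<bar> \<le> 1" and V0: "V 1 - V 0 = 1"
    and eq: "\<And>n::int. V \<lceil>t + of_int n * a + c\<rceil> + V \<lceil>t + of_int n * a - c\<rceil> = 2 * V \<lceil>t + of_int n * a\<rceil>"
  obtains n :: nat and r :: "nat \<Rightarrow> real" where "n \<ge> 1"
    "\<And>i. \<bar>c - real n\<bar> \<le> r i" "\<And>i. r i < a - \<bar>c - real n\<bar>"
    "\<And>i. \<exists>z::int. r (Suc i) - r i - real n = of_int z * a"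
  | n :: nat and r :: "nat \<Rightarrow> real" where "n \<ge> 1"
    "\<And>i. \<bar>c - real n * a\<bar> \<le> r i" "\<And>i. r i < a - \<bar>c - real n * a\<bar>"
    "\<And>i. \<exists>z::int. r (Suc i) - r i - (- (real n * a)) = of_int z * 1"
proof -
  obtain x N :: "nat \<Rightarrow> int" where xinc: "\<And>n. x n < x (Suc n)"
    and x: "\<And>n. t + of_int (N n) * a \<le> of_int (x n)" "\<And>n. of_int (x n) < t + of_int (N n) * a + a"
    "\<And>n. t + of_int (N n) * a + c \<le> of_int (x (Suc n))" 
    "\<And>n. of_int (x (Suc n)) < t + of_int (N n) * a + c + a"
    "\<And>n. t + of_int (N (Suc n)) * a - c \<le> of_int (x n)" 
    "\<And>n. of_int (x n) < t + of_int (N (Suc n)) * a - c + a"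
    using bounded_solution_orbit[OF a c lip V0 eq] by blast
  define r where "r n = of_int (x n) - (t + of_int (N n) * a)" for n
  define k where "k n = x (Suc n) - x n" for n
  define l where "l n = N (Suc n) - N n" for n
  have r: "0 \<le> r n" "r n < a" for n using x(1,2)[of n] by (simp_all add: r_def)
  have rel: "of_int (k n) - of_int (l n) * a = r (Suc n) - r n" for n
    by (simp add: k_def l_def r_def algebra_simps)
  have F1: "- r n \<le> of_int (k n) - c" "of_int (k n) - c < a - r n" for n
    using x(3,4)[of n] by (simp_all add: k_def r_def)
  have F2: "of_int (k n) - c \<le> r (Suc n)" "r (Suc n) - a < of_int (k n) - c" for n
    using x(5,6)[of n] by (simp_all add: k_def r_def)
  have kpos: "k n > 0" for n using xinc[of n] by (simp add: k_def)
  have lpos: "l n > 0" for n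
  proof -
    have "of_int (k n) \<ge> (1::real)" using kpos[of n] by simp
    then have "of_int (l n) * a > 0" using rel[of n] r[of n] r[of "Suc n"] a(2) by linarith
    then show ?thesis using a(1) by (simp add: zero_less_mult_iff)
  qed
  consider "\<forall>n. k n = k 0" | "\<forall>n. l n = l 0"
    using constant_steps_dichotomy[where r = r and k = k and l = l and c = c, OF a r rel F1 F2] by blast
  then show ?thesis
  proof cases
    case 1
    have k: "real_of_int (k i) = real (nat (k 0))" for i using 1 kpos[of 0] by (metis int_nat_eq less_imp_le of_int_of_nat_eq)
    show ?thesis
    proof (rule that(1)[of "nat (k 0)" "\<lambda>i. r (Suc i)"])
      show "1 \<le> nat (k 0)" using kpos[of 0] by simp
      fix i
      show "\<bar>c - real (nat (k 0))\<bar> \<le> r (Suc i)" "r (Suc i) < a - \<bar>c - real (nat (k 0))\<bar>"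
        using F1[of "Suc i"] F2[of i] k[of i] k[of "Suc i"] by linarith+
      show "\<exists>z::int. r (Suc (Suc i)) - r (Suc i) - real (nat (k 0)) = of_int z * a"
        using rel[of "Suc i"] k[of "Suc i"] by (intro exI[of _ "- l (Suc i)"]) simp
    qed
  next
    case 2
    have l: "real_of_int (l i) * a = real (nat (l 0)) * a" for i using 2 lpos[of 0] by (metis int_nat_eq less_imp_le of_int_of_nat_eq)
    show ?thesis
    proof (rule that(2)[of "nat (l 0)" "\<lambda>i. r (Suc i)"])
      show "1 \<le> nat (l 0)" using lpos[of 0] by simp
      fix i
      show "\<bar>c - real (nat (l 0)) * a\<bar> \<le> r (Suc i)" "r (Suc i) < a - \<bar>c - real (nat (l 0)) * a\<bar>"
        using F1[of i] F2[of i] F1[of "Suc i"] F2[of "Suc i"] l[of i] l[of "Suc i"] rel[of i] rel[of "Suc i"]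
        by linarith+
      show "\<exists>z::int. r (Suc (Suc i)) - r (Suc i) - - (real (nat (l 0)) * a) = of_int z * 1"
        using rel[of "Suc i"] l[of "Suc i"] by (intro exI[of _ "k (Suc i)"]) simp
    qed
  qed
qed

lemma null_irrational:
  fixes V :: "int \<Rightarrow> real" and a c t :: real
  assumes a: "0 < a" "a \<le> 1" and c: "a \<le> 2 * c"
    and lip: "\<And>k. \<bar>V (k + 1) - V k\<bar> \<le> 1" and V0: "V 1 - V 0 = 1"
    and eq: "\<And>n::int. V \<lceil>t + of_int n * a + c\<rceil> + V \<lceil>t + of_int n * a - c\<rceil> = 2 * V \<lceil>t + of_int n * a\<rceil>"
    and irr: "a \<notin> \<rat>"
  shows "\<exists>n::nat. n \<ge> 1 \<and> c = real n"
  using a c lip V0 eq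
proof (cases rule: null_dichotomy)
  case (1 n r)
  have irr': "real n / a \<notin> \<rat>"
  proof
    assume "real n / a \<in> \<rat>"
    then have "real n / (real n / a) \<in> \<rat>" by (rule Rats_divide[OF Rats_of_nat])
    then show False using irr 1(1) a by simp
  qed
  have "c = real n"
  proof (rule ccontr)
    assume "c \<noteq> real n"
    then have "2 * \<bar>c - real n\<bar> / a > 0" using a by simp
    from small_multiple_irrational[OF irr' this] obtain N :: nat and w :: int and d where
      d: "0 < d" "d < 2 * \<bar>c - real n\<bar> / a" "of_nat N * (real n / a) - d = of_int w" by blast
    have "2 * \<bar>c - real n\<bar> < d * a - a + a"
    proof (rule rotation_gap[where r = r and e = "\<bar>c - real n\<bar>" and \<delta> = "real n" and N = N and w = w])
      show "real N * real n - d * a = of_int w * a" using d(3) a by (simp add: field_simps)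
    qed (use 1 d a in auto)
    then show False using d(2) a by (simp add: field_simps)
  qed
  then show ?thesis using 1(1) by blast
next
  case (2 n r)
  have irr': "- (real n * a) \<notin> \<rat>"
  proof
    assume "- (real n * a) \<in> \<rat>"
    then have "- (real n * a) / (- real n) \<in> \<rat>" by (intro Rats_divide) auto
    then show False using irr 2(1) a by simp
  qed
  \<comment> \<open>On the circle of length 1 the orbit misses all of \<open>[a, 1)\<close>, which
    has positive length, so a step \<open>d < 1 - a\<close> already gives a contradiction, whatever
    \<open>c\<close> is.\<close>
  have "a \<noteq> 1" using irr by auto
  then have "1 - a > 0" using a by simp
  from small_multiple_irrational[OF irr' this] obtain N :: nat and w :: int and d where
      d: "0 < d" "d < 1 - a" "of_nat N * - (real n * a) - d = of_int w" by blast
  have "2 * \<bar>c - real n * a\<bar> < d - 1 + a"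
    by (rule rotation_gap[where r = r and e = "\<bar>c - real n * a\<bar>" and \<delta> = "- (real n * a)" and N = N and w = w])
      (use 2 d a in auto)
  then have "2 * \<bar>c - real n * a\<bar> < 0" using d(2) by linarith
  then have False by simp
  then show ?thesis ..
qed

lemma null_rational:
  fixes V :: "int \<Rightarrow> real" and a c t :: real
  assumes a: "0 < a" "a \<le> 1" and c: "a \<le> 2 * c"
    and lip: "\<And>k. \<bar>V (k + 1) - V k\<bar> \<le> 1" and V0: "V 1 - V 0 = 1"
    and eq: "\<And>n::int. V \<lceil>t + of_int n * a + c\<rceil> + V \<lceil>t + of_int n * a - c\<rceil> = 2 * V \<lceil>t + of_int n * a\<rceil>"
    and pq: "a = real p / real q" "coprime p q" "0 < p" "0 < q"
  shows "(\<exists>n::nat. n \<ge> 1 \<and> \<bar>c - real n\<bar> < real (gcd n p) / (2 * real q)) \<or>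
         (\<exists>n::nat. n \<ge> 1 \<and> \<bar>c - real n * real p / real q\<bar>
               < real (gcd n q) / (2 * real q) - (real q - real p) / (2 * real q))"
  using a c lip V0 eq
proof (cases rule: null_dichotomy)
  case (1 n r)
  obtain N :: nat and w :: int where "int N * int n * int q - gcd (int n) (int p) = w * int p"
    using small_multiple_gcd[of "int p" "int q" "int n"] pq by auto
  then have "of_int (int N * int n * int q - gcd (int n) (int p)) = (of_int (w * int p) :: real)"
    by presburger
  then have Nw: "real N * real n * real q - real (gcd n p) = of_int w * real p" by simp
  have "2 * \<bar>c - real n\<bar> < real (gcd n p) / real q - a + a"
  proof (rule rotation_gap[where r = r and e = "\<bar>c - real n\<bar>" and \<delta> = "real n" and N = N and w = w])
    show "real N * real n - real (gcd n p) / real q = of_int w * a" 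
      using Nw pq by (simp add: field_simps)
  qed (use 1 pq in auto)
  then have "\<bar>c - real n\<bar> < real (gcd n p) / (2 * real q)" using pq by (simp add: field_simps)
  then show ?thesis using 1(1) by blast
next
  case (2 n r)
  obtain N :: nat and w :: int where "int N * (- int n) * int p - gcd (- int n) (int q) = w * int q"
    using small_multiple_gcd[of "int q" "int p" "- int n"] pq by (auto simp: coprime_commute)
  then have "of_int (int N * (- int n) * int p - gcd (- int n) (int q)) = (of_int (w * int q) :: real)"
    by presburger
  then have Nw: "- (real N * real n * real p) - real (gcd n q) = of_int w * real q" by simp
  have "2 * \<bar>c - real n * a\<bar> < real (gcd n q) / real q - 1 + a"
  proof (rule rotation_gap[where r = r and e = "\<bar>c - real n * a\<bar>" and \<delta> = "- (real n * a)" and N = N and w = w])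
    show "real N * - (real n * a) - real (gcd n q) / real q = of_int w * 1" 
      using Nw pq(4) unfolding pq(1) by (simp add: field_simps)
  qed (use 2 a pq in auto)
  then have "\<bar>c - real n * real p / real q\<bar> < real (gcd n q) / (2 * real q) - (real q - real p) / (2 * real q)" 
    using pq by (simp add: field_simps)
  then show ?thesis using 2(1) by blast
qed

section \<open>Stability from uniqueness of bounded solutions\<close>

text \<open>The integers of \<open>[y, y + c)\<close> run from \<open>\<lceil>y\<rceil>\<close> to
  just below \<open>\<lceil>y + c\<rceil>\<close>; the half-open windows are those of the two steps
  of \<open>H c\<close>.\<close>

definition wdiff :: "real \<Rightarrow> (int \<Rightarrow> complex) \<Rightarrow> real \<Rightarrow> complex" where
  "wdiff c v y = sum v {\<lceil>y\<rceil>..<\<lceil>y + c\<rceil>} - sum v {\<lceil>y - c\<rceil>..<\<lceil>y\<rceil>}"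

text \<open>A discrete integral starting at 0. For either sign of \<open>k\<close> at least one of
  the two intervals is empty.\<close>

definition antidiff :: "(int \<Rightarrow> real) \<Rightarrow> int \<Rightarrow> real" where
  "antidiff u k = sum u {0..<k} - sum u {k..<0}"

lemma sum_int_Suc:
  fixes u :: "int \<Rightarrow> 'a::comm_monoid_add"
  assumes "i \<le> j" shows "sum u {i..<j + 1} = sum u {i..<j} + u j"
proof -
  have "{i..<j + 1} = insert j {i..<j}" using assms by auto
  then show ?thesis by (simp add: add.commute)
qed

lemma sum_int_head:
  fixes u :: "int \<Rightarrow> 'a::comm_monoid_add"
  assumes "i < j" shows "sum u {i..<j} = u i + sum u {i + 1..<j}"
proof -
  have "{i..<j} = insert i {i + 1..<j}" using assms by auto
  then show ?thesis by simp
qed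

lemma antidiff_step: "antidiff u (k + 1) - antidiff u k = u k"
proof (cases "0 \<le> k")
  case True
  then show ?thesis using sum_int_Suc[OF True, of u] by (simp add: antidiff_def)
next
  case False
  then show ?thesis using sum_int_head[of k 0 u] by (simp add: antidiff_def)
qed

lemma antidiff_diff:
  assumes "i \<le> j" shows "antidiff u j - antidiff u i = sum u {i..<j}"
  using assms
proof (induction j rule: int_ge_induct)
  case (step j)
  then show ?case using antidiff_step[of u j] sum_int_Suc[of i j u] by simp
qed simp

lemma ceiling_left_seq:
  fixes s :: "nat \<Rightarrow> real"
  assumes "s \<longlonglongrightarrow> \<tau>" "\<And>i. s i \<le> \<tau>"
  shows "\<forall>\<^sub>F i in sequentially. \<lceil>s i + b\<rceil> = \<lceil>\<tau> + b\<rceil>"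
proof -
  have "\<forall>\<^sub>F i in sequentially. s i > of_int \<lceil>\<tau> + b\<rceil> - 1 - b"
    by (rule order_tendstoD(1)[OF assms(1)]) linarith
  then show ?thesis
    by eventually_elim (use assms(2) in \<open>smt (verit) ceiling_unique le_of_int_ceiling\<close>)
qed

text \<open>The ceiling is continuous from the left only. Its limit from the right is
  \<open>floor + 1\<close>, which differs from the ceiling exactly at the integers.\<close>

lemma ceiling_right_seq:
  fixes s :: "nat \<Rightarrow> real"
  assumes "s \<longlonglongrightarrow> \<tau>" "\<And>i. s i > \<tau>"
  shows "\<forall>\<^sub>F i in sequentially. \<lceil>s i + b\<rceil> = \<lfloor>\<tau> + b\<rfloor> + 1"
proof -
  have "\<forall>\<^sub>F i in sequentially. s i < of_int \<lfloor>\<tau> + b\<rfloor> + 1 - b"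
    by (rule order_tendstoD(2)[OF assms(1)]) linarith
  then show ?thesis
  proof eventually_elim
    case (elim i)
    then show ?case using assms(2)[of i] by (intro ceiling_unique) (simp_all, linarith)
  qed
qed

text \<open>
  \<open>V\<close> is an antidifference of the bounded sequence \<open>v\<close>, so that both window sums are differences of
  values of \<open>V\<close> at ceilings; \<open>v\<close> attains its maximal modulus 1 at 0.
\<close>

definition null_free :: "real \<Rightarrow> real \<Rightarrow> bool" where
  "null_free a c \<longleftrightarrow> \<not> (\<exists>V t. (\<forall>k::int. \<bar>V (k + 1) - V k\<bar> \<le> (1::real)) \<and> V 1 - V 0 = 1 \<and>
     (\<forall>n::int. V \<lceil>t + of_int n * a + c\<rceil> + V \<lceil>t + of_int n * a - c\<rceil> = 2 * V \<lceil>t + of_int n * a\<rceil>))"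

lemma wdiff_shift: "wdiff c (\<lambda>j. v (j + k)) y = wdiff c v (y + of_int k)"
proof -
  have *: "sum (\<lambda>j. v (j + k)) {i..<j} = sum v {i + k..<j + k}" for i j
    by (rule sum.reindex_bij_witness[of _ "\<lambda>j. j - k" "\<lambda>j. j + k"]) auto
  have 1: "y + of_int k + c = y + c + of_int k" "y + of_int k - c = y - c + of_int k" by auto
  show ?thesis unfolding wdiff_def * 1 ceiling_add_of_int ..
qed

text \<open>
  The second case arises from offsets decreasing to \<open>\<tau>\<close>, for which the limiting windows are open on the
  left and closed on the right; the reflection \<open>j \<mapsto> -j\<close> turns them into the windows of
  \<open>null_free\<close>.
\<close>

lemma limit_not_null_free:
  fixes u :: "int \<Rightarrow> complex" and ce :: "real \<Rightarrow> int"
  assumes c: "0 < c" and u: "\<And>l. cmod (u l) \<le> 1" "u 0 = 1"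
    and ce: "ce = ceiling \<or> ce = (\<lambda>z. \<lfloor>z\<rfloor> + 1)"
    and eq: "\<And>n::int. sum u {ce (\<tau> + of_int n * a)..<ce (\<tau> + of_int n * a + c)} 
                   = sum u {ce (\<tau> + of_int n * a - c)..<ce (\<tau> + of_int n * a)}"
  shows "\<not> null_free a c"
proof -
  \<comment> \<open>Real parts suffice: they are still bounded by 1 and equal 1 at 0, and the window
    equation is linear over the reals.\<close>
  define V where "V = antidiff (\<lambda>j. Re (u j))"
  have lip: "\<bar>V (k + 1) - V k\<bar> \<le> 1" for k
    unfolding V_def antidiff_step using abs_Re_le_cmod[of "u k"] u(1)[of k] by linarith
  have V01: "V 1 - V 0 = 1" using antidiff_step[of "\<lambda>j. Re (u j)" 0] u(2) by (simp add: V_def)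
  have mono: "mono ce" using ce by (auto simp: mono_def intro: ceiling_mono floor_mono)
  have bal: "V (ce (\<tau> + of_int n * a + c)) + V (ce (\<tau> + of_int n * a - c)) = 2 * V (ce (\<tau> + of_int n * a))" for n :: int
  proof -
    let ?y = "\<tau> + of_int n * a"
    have "ce ?y \<le> ce (?y + c)" "ce (?y - c) \<le> ce ?y" using c by (auto intro!: monoD[OF mono])
    then have "V (ce (?y + c)) - V (ce ?y) = Re (sum u {ce ?y..<ce (?y + c)})"
      "V (ce ?y) - V (ce (?y - c)) = Re (sum u {ce (?y - c)..<ce ?y})"
      by (simp_all add: V_def antidiff_diff)
    then show ?thesis using eq[of n] by simp
  qed
  show ?thesis
  proof (cases "ce = ceiling")
    case True
    then show ?thesis using lip V01 bal unfolding null_free_def by blast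
  next
    case False
    then have ce': "ce z = \<lfloor>z\<rfloor> + 1" for z using ce by auto
    \<comment> \<open>The increment of \<open>W\<close> at \<open>k\<close> is that of
      \<open>V\<close> at \<open>- k\<close>. The offset 1 turns
      \<open>\<lfloor>z\<rfloor> + 1\<close> at \<open>- z\<close> into the ceiling at
      \<open>z\<close>.\<close>
    define W where "W k = - V (1 - k)" for k
    have "\<bar>W (k + 1) - W k\<bar> \<le> 1" for k using lip[of "- k"] by (simp add: W_def add.commute)
    moreover have "W 1 - W 0 = 1" using V01 by (simp add: W_def)
    moreover have "W \<lceil>- \<tau> + of_int n * a + c\<rceil> + W \<lceil>- \<tau> + of_int n * a - c\<rceil> = 2 * W \<lceil>- \<tau> + of_int n * a\<rceil>" for n :: int
    proof -
      have *: "W \<lceil>z\<rceil> = - V (ce (- z))" for z by (simp add: W_def ce' ceiling_def add.commute)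
      have e: "- (- \<tau> + of_int n * a + c) = \<tau> + of_int (- n) * a - c" 
        "- (- \<tau> + of_int n * a - c) = \<tau> + of_int (- n) * a + c" 
        "- (- \<tau> + of_int n * a) = \<tau> + of_int (- n) * a" by simp_all
      show ?thesis unfolding * e using bal[of "- n"] by linarith
    qed
    ultimately show ?thesis unfolding null_free_def by blast
  qed
qed

text \<open>Compactness: otherwise there are counterexamples with
  \<open>\<epsilon> = \<delta> = 1 / (i + 1)\<close> and \<open>R = i + 1\<close>. Normalised to
  value 1 at 0, they converge pointwise along a subsequence; the permitted growth disappears in the
  limit, leaving a sequence bounded by 1 with vanishing window differences. Some growth has to be
  permitted because \<open>l2_lower_bound\<close> applies this at maxima of exponentially weighted
  sequences.\<close>

lemma local_lower_bound:
  assumes a: "0 < a" and c: "0 < c" and nf: "null_free a c"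
  shows "\<exists>\<epsilon>>0. \<exists>\<delta>>0. \<exists>R>0. \<forall>t v. v 0 \<noteq> 0 \<longrightarrow> (\<forall>l. cmod (v l) \<le> cmod (v 0) * exp (\<epsilon> * \<bar>of_int l\<bar>)) \<longrightarrow>
     (\<exists>n::int. \<bar>t + of_int n * a\<bar> \<le> R \<and> \<delta> * cmod (v 0) \<le> cmod (wdiff c v (t + of_int n * a)))"
proof (rule ccontr)
  assume neg: "\<not> ?thesis"
  have "\<exists>t v. v 0 \<noteq> 0 \<and> (\<forall>l. cmod (v l) \<le> cmod (v 0) * exp (1 / real (Suc i) * \<bar>of_int l\<bar>)) \<and>
     (\<forall>n::int. \<bar>t + of_int n * a\<bar> \<le> real (Suc i) \<longrightarrow> 
        cmod (wdiff c v (t + of_int n * a)) < 1 / real (Suc i) * cmod (v 0))" for i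
  proof -
    have "1 / real (Suc i) > 0" "real (Suc i) > 0" by auto
    then show ?thesis using neg by (meson not_le)
  qed
  then obtain t0 v where v0: "\<And>i. v i 0 \<noteq> 0"
    and v: "\<And>i l. cmod (v i l) \<le> cmod (v i 0) * exp (1 / real (Suc i) * \<bar>of_int l\<bar>)"
    and small: "\<And>i (n::int). \<bar>t0 i + of_int n * a\<bar> \<le> real (Suc i) \<Longrightarrow> 
        cmod (wdiff c (v i) (t0 i + of_int n * a)) < 1 / real (Suc i) * cmod (v i 0)"
    by metis
  define w where "w i l = v i l / v i 0" for i l
  \<comment> \<open>Shifting the offset by a multiple of \<open>a\<close> only renumbers the
    windows, so offsets may be taken in the bounded interval \<open>[0, a)\<close>.\<close>
  define t where "t i = t0 i + of_int (- \<lfloor>t0 i / a\<rfloor>) * a" for i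
  have t: "0 \<le> t i" "t i < a" for i
    using floor_divide_lower[OF a, of "t0 i"] floor_divide_upper[OF a, of "t0 i"] 
    by (simp_all add: t_def algebra_simps)
  have w0: "w i 0 = 1" for i using v0 by (simp add: w_def)
  have w: "cmod (w i l) \<le> exp (1 / real (Suc i) * \<bar>of_int l\<bar>)" for i l
    using v[of i l] v0[of i] by (simp add: w_def norm_divide pos_divide_le_eq mult.commute)
  have wd: "wdiff c (w i) y = wdiff c (v i) y / v i 0" for i y
    by (simp add: wdiff_def w_def sum_divide_distrib diff_divide_distrib)
  have wsmall: "cmod (wdiff c (w i) (t i + of_int n * a)) < 1 / real (Suc i)" 
    if "\<bar>t i + of_int n * a\<bar> \<le> real (Suc i)" for i and n :: int
  proof -
    have "t i + of_int n * a = t0 i + of_int (n - \<lfloor>t0 i / a\<rfloor>) * a"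
      by (simp add: t_def algebra_simps)
    then show ?thesis
      using small[of i "n - \<lfloor>t0 i / a\<rfloor>"] that v0[of i] 
      by (simp add: wd norm_divide pos_divide_less_eq del: of_int_diff)
  qed
  \<comment> \<open>One countable family carries both the offset (at \<open>None\<close>) and all
    the entries, so a single diagonal subsequence serves them all. The factor
    \<open>exp (- \<bar>l\<bar>)\<close> makes the family uniformly bounded, as the entries grow at
    most like \<open>exp \<bar>l\<bar>\<close>.\<close>
  define F where "F i z = (case z of None \<Rightarrow> of_real (t i) | Some l \<Rightarrow> w i l * of_real (exp (- \<bar>of_int l\<bar>)))" 
    for i and z :: "int option"
  have "cmod (F i z) \<le> max 1 a" for i z
  proof (cases z)
    case None
    then show ?thesis using t[of i] by (simp add: F_def)
  next
    case (Some l)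
    have "exp (1 / real (Suc i) * \<bar>of_int l\<bar>) \<le> exp (1 * \<bar>of_int l :: real\<bar>)"
      unfolding exp_le_cancel_iff by (intro mult_right_mono) auto
    then have "cmod (w i l) \<le> exp \<bar>of_int l\<bar>" using w[of i l] by (metis mult_1 order_trans)
    then have "cmod (w i l) * exp (- \<bar>of_int l\<bar>) \<le> 1" by (simp add: exp_minus field_simps)
    then show ?thesis using Some by (simp add: F_def norm_mult max.coboundedI1)
  qed
  then obtain k where k: "strict_mono (k::nat\<Rightarrow>nat)" "\<And>z. \<exists>l. (\<lambda>i. F (k i) z) \<longlonglongrightarrow> l"
    using function_convergent_subsequence[of "UNIV :: int option set" F "max 1 a"] 
    by (metis uncountable_def countableI_type UNIV_I)
  have "\<exists>L. (\<lambda>i. w (k i) l) \<longlonglongrightarrow> L" for l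
  proof -
    obtain L where "(\<lambda>i. F (k i) (Some l)) \<longlonglongrightarrow> L" using k(2) by blast
    then have "(\<lambda>i. F (k i) (Some l) * of_real (exp \<bar>of_int l\<bar>)) \<longlonglongrightarrow> L * of_real (exp \<bar>of_int l\<bar>)"
      by (intro tendsto_intros)
    moreover have "F i (Some l) * of_real (exp \<bar>of_int l\<bar>) = w i l" for i
      by (simp add: F_def exp_minus flip: of_real_mult exp_of_real)
    ultimately show ?thesis by auto
  qed
  then obtain u where u: "\<And>l. (\<lambda>i. w (k i) l) \<longlonglongrightarrow> u l" by metis
  obtain T where "(\<lambda>i. F (k i) None) \<longlonglongrightarrow> T" using k(2) by blast
  then have "(\<lambda>i. Re (F (k i) None)) \<longlonglongrightarrow> Re T" by (rule tendsto_Re)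
  then obtain \<tau> where \<tau>: "(\<lambda>i. t (k i)) \<longlonglongrightarrow> \<tau>" by (auto simp: F_def)
  \<comment> \<open>The window endpoints jump at \<open>\<tau>\<close>, so a further subsequence is
    chosen on which the offsets stay on one side of it. The endpoints are then eventually constant,
    given by the left or the right limit of the ceiling.\<close>
  obtain s ce where s: "strict_mono (s::nat\<Rightarrow>nat)" and ce: "ce = ceiling \<or> ce = (\<lambda>z::real. \<lfloor>z\<rfloor> + 1)"
    and ev: "\<And>b. \<forall>\<^sub>F i in sequentially. \<lceil>t (k (s i)) + b\<rceil> = ce (\<tau> + b)"
  proof (cases "infinite {i. t (k i) \<le> \<tau>}")
    case True
    then obtain s where s: "strict_mono (s::nat\<Rightarrow>nat)" "\<And>i. t (k (s i)) \<le> \<tau>"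
      using infinite_enumerate[OF True] by auto
    have lim: "(\<lambda>i. t (k (s i))) \<longlonglongrightarrow> \<tau>" using LIMSEQ_subseq_LIMSEQ[OF \<tau> s(1)] by (simp add: o_def)
    show ?thesis by (rule that[OF s(1) _ ceiling_left_seq[OF lim s(2)]]) simp
  next
    case False
    have "{i. t (k i) > \<tau>} = UNIV - {i. t (k i) \<le> \<tau>}" by auto
    then have "infinite {i. t (k i) > \<tau>}" using False by (simp add: Diff_infinite_finite)
    then obtain s where s: "strict_mono (s::nat\<Rightarrow>nat)" "\<And>i. t (k (s i)) > \<tau>"
      using infinite_enumerate[of "{i. t (k i) > \<tau>}"] by auto
    have lim: "(\<lambda>i. t (k (s i))) \<longlonglongrightarrow> \<tau>" using LIMSEQ_subseq_LIMSEQ[OF \<tau> s(1)] by (simp add: o_def)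
    show ?thesis by (rule that[OF s(1) _ ceiling_right_seq[OF lim s(2)]]) simp
  qed
  define m where "m i = k (s i)" for i
  have m: "strict_mono m" using k(1) s by (simp add: m_def strict_mono_def)
  have um: "(\<lambda>i. w (m i) l) \<longlonglongrightarrow> u l" for l
    using LIMSEQ_subseq_LIMSEQ[OF u s] by (simp add: o_def m_def)
  have inv0: "(\<lambda>i. 1 / real (Suc (m i))) \<longlonglongrightarrow> 0"
    using LIMSEQ_subseq_LIMSEQ[OF LIMSEQ_inverse_real_of_nat m] by (simp add: o_def inverse_eq_divide)
  have "cmod (u l) \<le> 1" for l
  proof (rule LIMSEQ_le)
    show "(\<lambda>i. cmod (w (m i) l)) \<longlonglongrightarrow> cmod (u l)" by (intro tendsto_intros um)
    have "(\<lambda>i. exp (1 / real (Suc (m i)) * \<bar>of_int l\<bar>)) \<longlonglongrightarrow> exp (0 * \<bar>of_int l\<bar>)"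
      by (intro tendsto_intros inv0)
    then show "(\<lambda>i. exp (1 / real (Suc (m i)) * \<bar>of_int l\<bar>)) \<longlonglongrightarrow> 1" by simp
  qed (use w in blast)
  moreover have "u 0 = 1" using um[of 0] w0 LIMSEQ_unique[OF _ tendsto_const] by simp
  moreover have "sum u {ce (\<tau> + of_int n * a)..<ce (\<tau> + of_int n * a + c)} 
                   = sum u {ce (\<tau> + of_int n * a - c)..<ce (\<tau> + of_int n * a)}" for n :: int
  proof -
    let ?y = "\<tau> + of_int n * a"
    let ?D = "\<lambda>x. sum x {ce ?y..<ce (?y + c)} - sum x {ce (?y - c)..<ce ?y}"
    have 1: "(\<lambda>i. ?D (w (m i))) \<longlonglongrightarrow> ?D u" by (intro tendsto_intros um)
    have ev': "\<forall>\<^sub>F i in sequentially. wdiff c (w (m i)) (t (m i) + of_int n * a) = ?D (w (m i))"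
      using ev[of "of_int n * a"] ev[of "of_int n * a + c"] ev[of "of_int n * a - c"] 
      by eventually_elim (simp add: wdiff_def m_def add.assoc add_diff_eq)
    have big: "\<forall>\<^sub>F i in sequentially. \<bar>t (m i) + of_int n * a\<bar> \<le> real (Suc (m i))"
    proof -
      obtain K :: nat where K: "a + \<bar>of_int n * a\<bar> \<le> real K" using real_arch_simple by blast
      have "\<forall>\<^sub>F i in sequentially. K \<le> i" by (rule eventually_ge_at_top)
      then show ?thesis
      proof eventually_elim
        case (elim i)
        then have "K \<le> m i" using seq_suble[OF m, of i] by linarith
        then have "real K \<le> real (Suc (m i))" by simp
        then show ?case using K t[of "m i"] by linarith
      qed
    qed
    have "(\<lambda>i. ?D (w (m i))) \<longlonglongrightarrow> 0"
    proof (rule Lim_null_comparison[OF _ inv0])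
      show "\<forall>\<^sub>F i in sequentially. norm (?D (w (m i))) \<le> 1 / real (Suc (m i))"
        using ev' big by eventually_elim (use wsmall in \<open>metis less_imp_le\<close>)
    qed
    then have "?D u = 0" using LIMSEQ_unique[OF 1] by blast
    then show ?thesis by simp
  qed
  ultimately show False using limit_not_null_free[OF c _ _ ce] nf by blast
qed

section \<open>From local bounds to two-sided bounds on square sums\<close>

abbreviation l2sum :: "(int \<Rightarrow> complex) \<Rightarrow> ennreal" where
  "l2sum v \<equiv> \<integral>\<^sup>+j. ennreal ((cmod (v j))\<^sup>2) \<partial>count_space UNIV"

lemma finite_exp_sum:
  assumes "0 < (\<epsilon>::real)"
  shows "(\<integral>\<^sup>+j. ennreal (exp (- (\<epsilon> * \<bar>of_int j\<bar>))) \<partial>count_space (UNIV :: int set)) < \<infinity>"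
proof -
  let ?f = "\<lambda>j::int. exp (- (\<epsilon> * \<bar>of_int j\<bar>))"
  have s: "summable (\<lambda>n::nat. exp (- \<epsilon>) ^ n)" using assms by (intro summable_geometric) simp
  have p: "exp (- \<epsilon>) ^ n = exp (- (\<epsilon> * real n))" for n by (simp add: exp_of_nat_mult[symmetric] mult.commute)
  have "integrable (count_space UNIV) (\<lambda>n::nat. exp (- \<epsilon>) ^ n)"
    using s by (simp add: integrable_count_space_nat_iff)
  then have fin: "(\<integral>\<^sup>+n. ennreal (exp (- (\<epsilon> * real n))) \<partial>count_space (UNIV :: nat set)) < \<infinity>"
    unfolding p by (simp add: integrable_iff_bounded)
  have 1: "(\<integral>\<^sup>+j. ennreal (?f j) \<partial>count_space (int ` UNIV)) = (\<integral>\<^sup>+n. ennreal (exp (- (\<epsilon> * real n))) \<partial>count_space (UNIV :: nat set))"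
    by (subst nn_integral_bij_count_space[symmetric, of int UNIV]) (auto simp: bij_betw_def)
  have 2: "(\<integral>\<^sup>+j. ennreal (?f j) \<partial>count_space ((\<lambda>n. - int n) ` UNIV)) = (\<integral>\<^sup>+n. ennreal (exp (- (\<epsilon> * real n))) \<partial>count_space (UNIV :: nat set))"
    by (subst nn_integral_bij_count_space[symmetric, of "\<lambda>n. - int n" UNIV]) (auto simp: bij_betw_def inj_def)
  have U: "(UNIV :: int set) = int ` UNIV \<union> (\<lambda>n. - int n) ` UNIV" by (auto intro: int_cases2)
  have "(\<integral>\<^sup>+j. ennreal (?f j) \<partial>count_space UNIV) \<le> 
     (\<integral>\<^sup>+j. ennreal (?f j) * indicator (int ` UNIV) j + ennreal (?f j) * indicator ((\<lambda>n. - int n) ` UNIV) j \<partial>count_space UNIV)"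
    using U by (intro nn_integral_mono) (auto split: split_indicator)
  also have "\<dots> = (\<integral>\<^sup>+j. ennreal (?f j) \<partial>count_space (int ` UNIV)) + (\<integral>\<^sup>+j. ennreal (?f j) \<partial>count_space ((\<lambda>n. - int n) ` UNIV))"
    by (subst nn_integral_add) (auto simp: nn_integral_count_space_indicator)
  also have "\<dots> < \<infinity>" using fin unfolding 1 2 by simp
  finally show ?thesis .
qed

text \<open>Replacing \<open>y\<close> by its floor changes distances by at most 1, whence the
  factor \<open>exp \<epsilon>\<close>. The point is that the bound does not depend on
  \<open>y\<close>.\<close>

lemma exp_sum_translate_le:
  assumes "0 < (\<epsilon>::real)"
  shows "(\<integral>\<^sup>+j. ennreal (exp (- (\<epsilon> * \<bar>y - of_int j\<bar>))) \<partial>count_space (UNIV :: int set)) 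
     \<le> ennreal (exp \<epsilon>) * (\<integral>\<^sup>+j. ennreal (exp (- (\<epsilon> * \<bar>of_int j\<bar>))) \<partial>count_space (UNIV :: int set))"
proof -
  have "(\<integral>\<^sup>+j. ennreal (exp (- (\<epsilon> * \<bar>y - of_int j\<bar>))) \<partial>count_space (UNIV :: int set)) 
    \<le> (\<integral>\<^sup>+j. ennreal (exp \<epsilon>) * ennreal (exp (- (\<epsilon> * \<bar>of_int (\<lfloor>y\<rfloor> - j)\<bar>))) \<partial>count_space (UNIV :: int set))"
  proof (intro nn_integral_mono)
    fix j :: int
    have "\<bar>of_int (\<lfloor>y\<rfloor> - j)\<bar> - 1 \<le> \<bar>y - of_int j\<bar>" by linarith
    then have "\<epsilon> * (\<bar>of_int (\<lfloor>y\<rfloor> - j)\<bar> - 1) \<le> \<epsilon> * \<bar>y - of_int j\<bar>" using assms by (intro mult_left_mono) auto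
    then have "exp (- (\<epsilon> * \<bar>y - of_int j\<bar>)) \<le> exp (\<epsilon> + - (\<epsilon> * \<bar>of_int (\<lfloor>y\<rfloor> - j)\<bar>))"
      unfolding exp_le_cancel_iff by (simp add: algebra_simps)
    then show "ennreal (exp (- (\<epsilon> * \<bar>y - of_int j\<bar>))) \<le> ennreal (exp \<epsilon>) * ennreal (exp (- (\<epsilon> * \<bar>of_int (\<lfloor>y\<rfloor> - j)\<bar>)))"
      unfolding exp_add by (subst ennreal_mult[symmetric]) (auto intro: ennreal_leI)
  qed
  also have "\<dots> = ennreal (exp \<epsilon>) * (\<integral>\<^sup>+j. ennreal (exp (- (\<epsilon> * \<bar>of_int (\<lfloor>y\<rfloor> - j)\<bar>))) \<partial>count_space (UNIV :: int set))"
    by (subst nn_integral_cmult) auto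
  also have "(\<integral>\<^sup>+j. ennreal (exp (- (\<epsilon> * \<bar>of_int (\<lfloor>y\<rfloor> - j)\<bar>))) \<partial>count_space (UNIV :: int set)) = 
     (\<integral>\<^sup>+j. ennreal (exp (- (\<epsilon> * \<bar>of_int j\<bar>))) \<partial>count_space (UNIV :: int set))"
    by (rule nn_integral_bij_count_space[where g = "\<lambda>j. \<lfloor>y\<rfloor> - j" and 
          f = "\<lambda>j. ennreal (exp (- (\<epsilon> * \<bar>real_of_int j\<bar>)))"]) 
      (rule bij_betw_byWitness[where f' = "\<lambda>j. \<lfloor>y\<rfloor> - j"], auto)
  finally show ?thesis .
qed

lemma l2sum_finite_level:
  assumes "l2sum v < \<infinity>" "0 < \<eta>"
  shows "finite {j. \<eta> \<le> cmod (v j)}"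
proof (rule ccontr)
  assume inf: "\<not> ?thesis"
  have "(\<integral>\<^sup>+j. ennreal (\<eta>\<^sup>2) * indicator {j. \<eta> \<le> cmod (v j)} j \<partial>count_space UNIV) \<le> l2sum v"
    using assms(2) by (intro nn_integral_mono) (auto split: split_indicator intro!: ennreal_leI power_mono)
  moreover have "(\<integral>\<^sup>+j. ennreal (\<eta>\<^sup>2) * indicator {j. \<eta> \<le> cmod (v j)} j \<partial>count_space UNIV) = \<infinity>"
    using inf assms(2) by (subst nn_integral_cmult_indicator) (auto simp: ennreal_mult_top)
  ultimately show False using assms(1) by (simp add: top_unique)
qed

text \<open>For each \<open>j\<close>, the local bound is applied at a maximum \<open>k\<close> of
  \<open>cmod (v k) * exp (- (\<epsilon> * \<bar>k - j\<bar>))\<close>; square summability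
  guarantees that it exists. This bounds \<open>v j\<close> by one window difference, damped
  exponentially in the distance from the window to \<open>j\<close>. Summing over \<open>j\<close>
  and interchanging the sums leaves a geometric factor.\<close>

lemma l2_lower_bound:
  assumes a: "0 < a" and c: "0 < c" and nf: "null_free a c"
  shows "\<exists>C>0. \<forall>t v. l2sum v < \<infinity> \<longrightarrow> l2sum v \<le> ennreal C * l2sum (\<lambda>n. wdiff c v (t + of_int n * a))"
proof -
  obtain \<epsilon> \<delta> R where pos: "0 < \<epsilon>" "0 < \<delta>" "0 < R" and 
    loc: "\<And>t v. v 0 \<noteq> 0 \<Longrightarrow> (\<And>l. cmod (v l) \<le> cmod (v 0) * exp (\<epsilon> * \<bar>of_int l\<bar>)) \<Longrightarrow>
     (\<exists>n::int. \<bar>t + of_int n * a\<bar> \<le> R \<and> \<delta> * cmod (v 0) \<le> cmod (wdiff c v (t + of_int n * a)))"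
    using local_lower_bound[OF a c nf] by blast
  \<comment> \<open>The window found near \<open>k\<close> lies within \<open>R\<close> of it, so
    measuring the damping from the window centre costs \<open>exp (\<epsilon> * R)\<close>; this and
    \<open>1 / \<delta>\<close> are squared.\<close>
  define C1 where "C1 = exp (2 * \<epsilon> * R) / \<delta>\<^sup>2"
  define S where "S = (\<integral>\<^sup>+j. ennreal (exp (- (2 * \<epsilon> * \<bar>of_int j\<bar>))) \<partial>count_space (UNIV :: int set))"
  have S: "S < \<infinity>" unfolding S_def using finite_exp_sum[of "2 * \<epsilon>"] pos by simp
  \<comment> \<open>The summand 1 only secures positivity.\<close>
  define C where "C = C1 * (exp (2 * \<epsilon>) * enn2real S) + 1"
  have C1: "C1 \<ge> 0" by (simp add: C1_def)
  show ?thesis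
  proof (intro exI[of _ C] conjI allI impI)
    show "C > 0" unfolding C_def using C1 by (intro add_nonneg_pos mult_nonneg_nonneg) auto
    fix t v assume fin: "l2sum v < \<infinity>"
    define y where "y n = t + of_int n * a" for n :: int
    define E where "E n = (cmod (wdiff c v (y n)))\<^sup>2" for n
    have point: "ennreal ((cmod (v j))\<^sup>2) \<le> 
        (\<integral>\<^sup>+n. ennreal C1 * ennreal (E n) * ennreal (exp (- (2 * \<epsilon> * \<bar>y n - of_int j\<bar>))) \<partial>count_space UNIV)" for j
    proof (cases "v j = 0")
      case False
      \<comment> \<open>The weighted maximum \<open>k\<close> dominates its surroundings as the local lower bound requires.\<close>
    define h where "h k = cmod (v k) * exp (- (\<epsilon> * \<bar>of_int (k - j)\<bar>))" for k
      let ?F = "{k. cmod (v j) \<le> cmod (v k)}"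
      have F: "finite ?F" "?F \<noteq> {}" using l2sum_finite_level[OF fin, of "cmod (v j)"] False by auto
      obtain k where k: "k \<in> ?F" "h k = Max (h ` ?F)" using obtains_MAX[OF F] by metis
      have hj: "h j = cmod (v j)" by (simp add: h_def)
      have h1: "h l \<le> cmod (v l)" for l
        using pos by (simp add: h_def mult_left_le)
      have hk: "h l \<le> h k" for l
      proof (cases "l \<in> ?F")
        case True then show ?thesis using k(2) F by simp
      next
        case False
        then have "h l \<le> h j" using h1[of l] hj by simp
        also have "\<dots> \<le> h k" using k(2) F by simp
        finally show ?thesis .
      qed
      have "cmod (v (l + k)) \<le> cmod (v (0 + k)) * exp (\<epsilon> * \<bar>of_int l\<bar>)" for l
      proof -
        have "cmod (v (l + k)) = h (l + k) * exp (\<epsilon> * \<bar>of_int (l + k - j)\<bar>)"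
          by (simp add: h_def exp_minus)
        also have "\<dots> \<le> h k * exp (\<epsilon> * \<bar>of_int (l + k - j)\<bar>)" using hk by (intro mult_right_mono) auto
        also have "\<dots> = cmod (v k) * exp (\<epsilon> * (\<bar>of_int (l + k - j)\<bar> - \<bar>of_int (k - j)\<bar>))"
          by (simp add: h_def exp_diff exp_minus right_diff_distrib field_simps)
        also have "\<dots> \<le> cmod (v k) * exp (\<epsilon> * \<bar>of_int l\<bar>)"
          using pos by (intro mult_left_mono iffD2[OF exp_le_cancel_iff]) auto
        finally show ?thesis by simp
      qed
      moreover have "v (0 + k) \<noteq> 0" using k(1) False by auto
      ultimately obtain n where n: "\<bar>t - of_int k + of_int n * a\<bar> \<le> R" 
         "\<delta> * cmod (v k) \<le> cmod (wdiff c (\<lambda>j. v (j + k)) (t - of_int k + of_int n * a))"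
        using loc[of "\<lambda>j. v (j + k)" "t - of_int k"] by auto
      have n2: "\<delta> * cmod (v k) \<le> cmod (wdiff c v (y n))"
        using n(2) unfolding wdiff_shift by (simp add: y_def algebra_simps)
      have "cmod (v j) \<le> h k" using hk[of j] hj by simp
      also have "h k \<le> (cmod (wdiff c v (y n)) / \<delta>) * exp (- (\<epsilon> * \<bar>of_int (k - j)\<bar>))"
        unfolding h_def using n2 pos by (intro mult_right_mono) (auto simp: field_simps)
      also have "\<dots> \<le> (cmod (wdiff c v (y n)) / \<delta>) * exp (\<epsilon> * R + - (\<epsilon> * \<bar>y n - of_int j\<bar>))"
      proof (intro mult_left_mono iffD2[OF exp_le_cancel_iff])
        have "\<bar>y n - of_int j\<bar> - R \<le> \<bar>of_int (k - j)\<bar>" using n(1) by (simp add: y_def)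
        then have "\<epsilon> * (\<bar>y n - of_int j\<bar> - R) \<le> \<epsilon> * \<bar>of_int (k - j)\<bar>" using pos by (intro mult_left_mono) auto
        then show "- (\<epsilon> * \<bar>of_int (k - j)\<bar>) \<le> \<epsilon> * R + - (\<epsilon> * \<bar>y n - of_int j\<bar>)" by (simp add: algebra_simps)
      qed (use pos in auto)
      finally have "(cmod (v j))\<^sup>2 \<le> ((cmod (wdiff c v (y n)) / \<delta>) * exp (\<epsilon> * R + - (\<epsilon> * \<bar>y n - of_int j\<bar>)))\<^sup>2"
        by (intro power_mono) auto
      also have "\<dots> = C1 * E n * exp (- (2 * \<epsilon> * \<bar>y n - of_int j\<bar>))"
        by (simp add: C1_def E_def power_mult_distrib power_divide exp_add exp_double[symmetric] mult.assoc)
           (simp add: power2_eq_square exp_add[symmetric] algebra_simps)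
      finally have "ennreal ((cmod (v j))\<^sup>2) \<le> ennreal C1 * ennreal (E n) * ennreal (exp (- (2 * \<epsilon> * \<bar>y n - of_int j\<bar>)))"
        using C1 by (simp add: ennreal_mult[symmetric] E_def ennreal_leI)
      also have "\<dots> \<le> (\<integral>\<^sup>+n. ennreal C1 * ennreal (E n) * ennreal (exp (- (2 * \<epsilon> * \<bar>y n - of_int j\<bar>))) \<partial>count_space UNIV)"
        by (rule nn_integral_ge_point[where p = "\<lambda>n. ennreal C1 * ennreal (E n) * ennreal (exp (- (2 * \<epsilon> * \<bar>y n - of_int j\<bar>)))"]) simp
      finally show ?thesis .
    qed simp
    have "l2sum v \<le> (\<integral>\<^sup>+j. (\<integral>\<^sup>+n. ennreal C1 * ennreal (E n) * ennreal (exp (- (2 * \<epsilon> * \<bar>y n - of_int j\<bar>))) \<partial>count_space UNIV) \<partial>count_space UNIV)"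
      by (intro nn_integral_mono point)
    also have "\<dots> = (\<integral>\<^sup>+n. (\<integral>\<^sup>+j. ennreal C1 * ennreal (E n) * ennreal (exp (- (2 * \<epsilon> * \<bar>y n - of_int j\<bar>))) \<partial>count_space UNIV) \<partial>count_space UNIV)"
      by (rule nn_integral_count_space_nn_integral) auto
    also have "\<dots> \<le> (\<integral>\<^sup>+n. ennreal C1 * ennreal (E n) * (ennreal (exp (2 * \<epsilon>)) * S) \<partial>count_space UNIV)"
    proof (intro nn_integral_mono)
      fix n :: int
      show "(\<integral>\<^sup>+j. ennreal C1 * ennreal (E n) * ennreal (exp (- (2 * \<epsilon> * \<bar>y n - of_int j\<bar>))) \<partial>count_space (UNIV :: int set))
          \<le> ennreal C1 * ennreal (E n) * (ennreal (exp (2 * \<epsilon>)) * S)"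
        unfolding S_def using exp_sum_translate_le[of "2 * \<epsilon>" "y n"] pos
        by (subst nn_integral_cmult) (auto intro!: mult_left_mono)
    qed
    also have "\<dots> = (\<integral>\<^sup>+n. (ennreal C1 * (ennreal (exp (2 * \<epsilon>)) * S)) * ennreal (E n) \<partial>count_space UNIV)"
      by (simp add: mult_ac)
    also have "\<dots> = (ennreal C1 * (ennreal (exp (2 * \<epsilon>)) * S)) * (\<integral>\<^sup>+n. ennreal (E n) \<partial>count_space UNIV)"
      by (rule nn_integral_cmult) auto
    also have "\<dots> \<le> ennreal C * (\<integral>\<^sup>+n. ennreal (E n) \<partial>count_space UNIV)"
    proof (rule mult_right_mono)
      have "S = ennreal (enn2real S)" using S by (simp add: less_top)
      then have "ennreal C1 * (ennreal (exp (2 * \<epsilon>)) * S) = ennreal (C1 * (exp (2 * \<epsilon>) * enn2real S))"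
        using C1 by (metis ennreal_mult enn2real_nonneg exp_ge_zero mult_nonneg_nonneg)
      then show "ennreal C1 * (ennreal (exp (2 * \<epsilon>)) * S) \<le> ennreal C" by (simp add: C_def ennreal_leI)
    qed simp
    finally show "l2sum v \<le> ennreal C * l2sum (\<lambda>n. wdiff c v (t + of_int n * a))"
      by (simp add: E_def y_def)
  qed
qed

lemma card_int_interval_le: "real (card {i::int. (x::real) \<le> of_int i \<and> of_int i \<le> z}) \<le> max 0 (z - x + 1)"
proof -
  have "{i::int. (x::real) \<le> of_int i \<and> of_int i \<le> z} = {\<lceil>x\<rceil>..\<lfloor>z\<rfloor>}" by (auto simp: ceiling_le_iff le_floor_iff)
  then show ?thesis by simp linarith
qed

lemma finite_int_interval: "finite {i::int. (x::real) \<le> of_int i \<and> of_int i \<le> (z::real)}"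
proof -
  have "{i::int. (x::real) \<le> of_int i \<and> of_int i \<le> z} = {\<lceil>x\<rceil>..\<lfloor>z\<rfloor>}" by (auto simp: ceiling_le_iff le_floor_iff)
  then show ?thesis by simp
qed

lemma cmod_wdiff_le:
  assumes "0 < c"
  shows "cmod (wdiff c v y) \<le> (\<Sum>j | y - c \<le> of_int j \<and> of_int j \<le> y + c. cmod (v j))"
proof -
  have "cmod (wdiff c v y) \<le> (\<Sum>j\<in>{\<lceil>y\<rceil>..<\<lceil>y + c\<rceil>}. cmod (v j)) + (\<Sum>j\<in>{\<lceil>y - c\<rceil>..<\<lceil>y\<rceil>}. cmod (v j))"
    unfolding wdiff_def by (rule order_trans[OF norm_triangle_ineq4]) (intro add_mono norm_sum)
  also have "\<dots> = (\<Sum>j\<in>{\<lceil>y\<rceil>..<\<lceil>y + c\<rceil>} \<union> {\<lceil>y - c\<rceil>..<\<lceil>y\<rceil>}. cmod (v j))"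
    by (subst sum.union_disjoint) auto
  also have "\<dots> \<le> (\<Sum>j | y - c \<le> of_int j \<and> of_int j \<le> y + c. cmod (v j))"
  proof (intro sum_mono2 finite_int_interval subsetI)
    fix j assume "j \<in> {\<lceil>y\<rceil>..<\<lceil>y + c\<rceil>} \<union> {\<lceil>y - c\<rceil>..<\<lceil>y\<rceil>}"
    then have "\<lceil>y - c\<rceil> \<le> j" "j < \<lceil>y + c\<rceil>" using assms ceiling_mono[of "y - c" y] ceiling_mono[of y "y + c"] by auto
    then show "j \<in> {j. y - c \<le> of_int j \<and> of_int j \<le> y + c}" by (simp add: ceiling_le_iff less_ceiling_iff)
  qed auto
  finally show ?thesis .
qed

lemma l2_upper_bound:
  assumes a: "0 < a" and c: "0 < c"
  shows "\<exists>C>0. \<forall>t v. l2sum (\<lambda>n. wdiff c v (t + of_int n * a)) \<le> ennreal C * l2sum v"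
proof -
  \<comment> \<open>The first factor bounds the number of integers in a double window and enters
    through Cauchy-Schwarz; the second bounds the number of double windows that contain a given
    integer.\<close>
  define C where "C = (2 * c + 1) * (2 * c / a + 1)"
  show ?thesis
  proof (intro exI[of _ C] conjI allI)
    show "0 < C" unfolding C_def using a c by (simp add: add_pos_pos)
    fix t v
    define y where "y n = t + of_int n * a" for n :: int
    define I where "I n = {j::int. y n - c \<le> of_int j \<and> of_int j \<le> y n + c}" for n
    have fin: "finite (I n)" for n unfolding I_def by (rule finite_int_interval)
    have point: "ennreal ((cmod (wdiff c v (y n)))\<^sup>2) \<le> 
      (\<integral>\<^sup>+j. ennreal (2 * c + 1) * (ennreal ((cmod (v j))\<^sup>2) * indicator (I n) j) \<partial>count_space UNIV)" for n
    proof -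
      have "(cmod (wdiff c v (y n)))\<^sup>2 \<le> (\<Sum>j\<in>I n. cmod (v j))\<^sup>2"
        unfolding I_def by (intro power_mono cmod_wdiff_le c) auto
      also have "\<dots> \<le> (\<Sum>j\<in>I n. (cmod (v j))\<^sup>2) * real (card (I n))"
        by (rule sum_squared_le_sum_of_squares) 
      also have "\<dots> \<le> (\<Sum>j\<in>I n. (cmod (v j))\<^sup>2) * (2 * c + 1)"
        using card_int_interval_le[of "y n - c" "y n + c"] c by (intro mult_left_mono) (auto simp: I_def intro: sum_nonneg)
      finally have "ennreal ((cmod (wdiff c v (y n)))\<^sup>2) \<le> ennreal ((\<Sum>j\<in>I n. (cmod (v j))\<^sup>2) * (2 * c + 1))"
        by (rule ennreal_leI)
      also have "\<dots> = ennreal (2 * c + 1) * (\<Sum>j\<in>I n. ennreal ((cmod (v j))\<^sup>2))"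
        using c by (subst ennreal_mult) (auto simp: sum_nonneg sum_ennreal mult.commute)
      also have "(\<Sum>j\<in>I n. ennreal ((cmod (v j))\<^sup>2)) = (\<integral>\<^sup>+j. ennreal ((cmod (v j))\<^sup>2) * indicator (I n) j \<partial>count_space UNIV)"
        using fin by (simp add: nn_integral_count_space_finite flip: nn_integral_count_space_indicator)
      finally show ?thesis by (subst nn_integral_cmult) auto
    qed
    have "l2sum (\<lambda>n. wdiff c v (y n)) \<le> (\<integral>\<^sup>+n. (\<integral>\<^sup>+j. ennreal (2 * c + 1) * (ennreal ((cmod (v j))\<^sup>2) * indicator (I n) j) \<partial>count_space UNIV) \<partial>count_space UNIV)"
      by (intro nn_integral_mono point)
    also have "\<dots> = (\<integral>\<^sup>+j. (\<integral>\<^sup>+n. ennreal (2 * c + 1) * (ennreal ((cmod (v j))\<^sup>2) * indicator (I n) j) \<partial>count_space UNIV) \<partial>count_space UNIV)"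
      by (rule nn_integral_count_space_nn_integral) auto
    also have "\<dots> \<le> (\<integral>\<^sup>+j. ennreal C * ennreal ((cmod (v j))\<^sup>2) \<partial>count_space UNIV)"
    proof (intro nn_integral_mono)
      fix j :: int
      let ?x = "(of_int j - t - c) / a" and ?z = "(of_int j - t + c) / a"
      let ?K = "{n::int. ?x \<le> of_int n \<and> of_int n \<le> ?z}"
      have K: "j \<in> I n \<longleftrightarrow> n \<in> ?K" for n
        using a by (auto simp: I_def y_def field_simps)
      have "(\<integral>\<^sup>+n. ennreal (2 * c + 1) * (ennreal ((cmod (v j))\<^sup>2) * indicator (I n) j) \<partial>count_space UNIV) =
        (\<integral>\<^sup>+n. ennreal (2 * c + 1) * ennreal ((cmod (v j))\<^sup>2) * indicator ?K n \<partial>count_space UNIV)"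
        by (intro nn_integral_cong) (auto simp: indicator_def K mult.assoc)
      also have "\<dots> = ennreal (2 * c + 1) * ennreal ((cmod (v j))\<^sup>2) * ennreal (real (card ?K))"
        by (subst nn_integral_cmult_indicator) (auto simp: finite_int_interval ennreal_of_nat_eq_real_of_nat)
      also have "\<dots> \<le> ennreal (2 * c + 1) * ennreal ((cmod (v j))\<^sup>2) * ennreal (2 * c / a + 1)"
      proof (intro mult_left_mono ennreal_leI)
        have "?z - ?x = 2 * c / a" using a by (simp add: field_simps)
        then show "real (card ?K) \<le> 2 * c / a + 1" using card_int_interval_le[of ?x ?z] a c by simp
      qed auto
      also have "\<dots> = ennreal C * ennreal ((cmod (v j))\<^sup>2)"
        using a c by (simp add: C_def ennreal_mult mult_ac)
      finally show "(\<integral>\<^sup>+n. ennreal (2 * c + 1) * (ennreal ((cmod (v j))\<^sup>2) * indicator (I n) j) \<partial>count_space UNIV) 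
        \<le> ennreal C * ennreal ((cmod (v j))\<^sup>2)" .
    qed
    also have "\<dots> = ennreal C * l2sum v" by (rule nn_integral_cmult) auto
    finally show "l2sum (\<lambda>n. wdiff c v (t + of_int n * a)) \<le> ennreal C * l2sum v" by (simp add: y_def)
  qed
qed

section \<open>Explicit null vectors\<close>

text \<open>An open interval of offsets is required so that the failure occurs on fibers of positive
  measure. The condition \<open>0 \<in> J\<close> keeps the truncated indicators equal to 1 at
  0.\<close>

definition null_set :: "real \<Rightarrow> real \<Rightarrow> int set \<Rightarrow> real \<Rightarrow> real \<Rightarrow> bool" where
  "null_set a c J t0 t1 \<longleftrightarrow> t0 < t1 \<and> 0 \<in> J \<and>
     (\<forall>t. t0 < t \<and> t < t1 \<longrightarrow> (\<forall>n::int. wdiff c (indicator J) (t + of_int n * a) = 0))"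

lemma sum_indicator_ceiling:
  fixes y z :: real
  shows "sum (indicator J) {\<lceil>y\<rceil>..<\<lceil>z\<rceil>} = (of_nat (card {j\<in>J. y \<le> of_int j \<and> of_int j < z}) :: complex)"
proof -
  have "{\<lceil>y\<rceil>..<\<lceil>z\<rceil>} \<inter> J = {j\<in>J. y \<le> of_int j \<and> of_int j < z}"
    by (auto simp: ceiling_le_iff less_ceiling_iff)
  moreover have "sum (indicator J) {\<lceil>y\<rceil>..<\<lceil>z\<rceil>} = (\<Sum>j\<in>{\<lceil>y\<rceil>..<\<lceil>z\<rceil>} \<inter> J. 1 :: complex)"
    unfolding sum.inter_restrict[OF finite_atLeastLessThan_int] by (intro sum.cong) (auto simp: indicator_def)
  ultimately show ?thesis by simp
qed

text \<open>Changing the window length from \<open>L\<close> to \<open>c\<close> moves the outer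
  endpoints by \<open>\<bar>c - L\<bar>\<close>. If they meet no point of \<open>J\<close> on the
  way, the two counts are those for \<open>L\<close>.\<close>

lemma wdiff_indicator_zero:
  assumes card: "card {j\<in>J. y \<le> of_int j \<and> of_int j < y + L} = card {j\<in>J. y - L \<le> of_int j \<and> of_int j < y}"
    and away: "\<And>j. j \<in> J \<Longrightarrow> \<bar>of_int j - (y + L)\<bar> > \<bar>c - L\<bar>" "\<And>j. j \<in> J \<Longrightarrow> \<bar>of_int j - (y - L)\<bar> > \<bar>c - L\<bar>"
  shows "wdiff c (indicator J) y = 0"
proof -
  have "{j\<in>J. y \<le> of_int j \<and> of_int j < y + c} = {j\<in>J. y \<le> of_int j \<and> of_int j < y + L}"
    using away(1) by fastforce
  moreover have "{j\<in>J. y - c \<le> of_int j \<and> of_int j < y} = {j\<in>J. y - L \<le> of_int j \<and> of_int j < y}"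
    using away(2) by fastforce
  ultimately show ?thesis unfolding wdiff_def sum_indicator_ceiling using card by simp
qed

text \<open>For integral \<open>c\<close> both windows contain exactly \<open>n\<close> integers,
  whatever the offset.\<close>

lemma null_set_nat: "null_set a (real n) UNIV 0 1"
proof -
  have "\<lceil>y + real n\<rceil> = \<lceil>y\<rceil> + int n" "\<lceil>y - real n\<rceil> = \<lceil>y\<rceil> - int n" for y
    using ceiling_add_of_int[of y "int n"] ceiling_diff_of_int[of y "int n"] by simp_all
  then show ?thesis by (simp add: null_set_def wdiff_def)
qed

text \<open>Take the multiples of \<open>g = gcd n p\<close>. They are invariant under translation
  by \<open>n\<close>, so windows of length \<open>n\<close> balance. Their differences with the
  lattice points \<open>i * p / q\<close> are multiples of \<open>g / q\<close>; hence for offsets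
  between \<open>e\<close> and \<open>g / q - e\<close> all points keep a distance above
  \<open>e\<close> from the lattice. This interval is nonempty exactly because
  \<open>2 * e < g / q\<close>.\<close>

lemma null_set_gcd_p:
  assumes pq: "0 < p" "0 < q" and near: "\<bar>c - real n\<bar> < real (gcd n p) / (2 * real q)"
  shows "\<exists>J t0 t1. null_set (real p / real q) c J t0 t1"
proof -
  define g where "g = gcd n p"
  define e where "e = \<bar>c - real n\<bar>"
  define J where "J = {j::int. int g dvd j}"
  have g: "0 < g" using pq by (simp add: g_def)
  have near': "e < real g / (2 * real q)" using near by (simp add: e_def g_def)
  have "null_set (real p / real q) c J e (real g / real q - e)"
    unfolding null_set_def
  proof (intro conjI allI impI)
    show "e < real g / real q - e" using near' pq by (simp add: field_simps)
    show "0 \<in> J" by (simp add: J_def)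
    fix t :: real and i :: int assume t: "e < t \<and> t < real g / real q - e"
    let ?y = "t + of_int i * (real p / real q)"
    have away: "e < \<bar>of_int j - ?y\<bar>" if "j \<in> J" for j
    proof -
      have "int g dvd j * int q - i * int p"
        using that by (auto simp: J_def g_def)
      then obtain z where z: "j * int q - i * int p = int g * z" by blast
      then have "of_int (j * int q - i * int p) = (of_int (int g * z) :: real)" by presburger
      then have z': "of_int j - ?y = of_int z * (real g / real q) - t" using pq by (simp add: field_simps)
      show ?thesis
      proof (cases "z \<le> 0")
        case True
        then have "of_int z * (real g / real q) \<le> 0" by (intro mult_nonpos_nonneg) auto
        then show ?thesis using z' t by linarith
      next
        case False
        then have "1 * (real g / real q) \<le> of_int z * (real g / real q)" by (intro mult_right_mono) auto
        then show ?thesis using z' t by linarith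
      qed
    qed
    have shift: "j + int n \<in> J \<longleftrightarrow> j \<in> J" for j
      by (simp add: J_def g_def dvd_add_left_iff)
    show "wdiff c (indicator J) ?y = 0"
    proof (rule wdiff_indicator_zero[where L = "real n"])
      show "card {j\<in>J. ?y \<le> of_int j \<and> of_int j < ?y + real n} = card {j\<in>J. ?y - real n \<le> of_int j \<and> of_int j < ?y}"
      proof (rule bij_betw_same_card[of "\<lambda>j. j - int n"], rule bij_betw_byWitness[where f' = "\<lambda>j. j + int n"])
        show "(\<lambda>j. j - int n) ` {j\<in>J. ?y \<le> of_int j \<and> of_int j < ?y + real n} \<subseteq> {j\<in>J. ?y - real n \<le> of_int j \<and> of_int j < ?y}"
          using shift[of "_ - int n"] by auto
      qed (auto simp: shift)
    next
      fix j assume j: "j \<in> J"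
      have "j - int n \<in> J" "j + int n \<in> J" using shift[of "j - int n"] shift j by auto
      from away[OF this(1)] away[OF this(2)] 
      show "\<bar>c - real n\<bar> < \<bar>of_int j - (?y + real n)\<bar>" "\<bar>c - real n\<bar> < \<bar>of_int j - (?y - real n)\<bar>"
        by (simp_all add: e_def algebra_simps)
    qed
  qed
  then show ?thesis by blast
qed

text \<open>Here the balance comes from the lattice: \<open>J\<close> has one integer for every
  \<open>h\<close>-th lattice point, obtained by rounding \<open>i * h * a\<close> up. For the
  chosen offsets, \<open>\<phi> i\<close> lies to the right of the \<open>k\<close>-th lattice point
  iff \<open>k \<le> h * i\<close>, so counting points in windows reduces to counting multiples of
  \<open>h\<close> among lattice indices. As \<open>h\<close> divides \<open>n\<close>, moving a
  window of length \<open>n * a\<close> by its own length preserves that count.\<close>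

lemma null_set_gcd_q:
  assumes pq: "0 < p" "p \<le> q" and n: "1 \<le> n"
    and near: "\<bar>c - real n * real p / real q\<bar> < real (gcd n q) / (2 * real q) - (real q - real p) / (2 * real q)"
  shows "\<exists>J t0 t1. null_set (real p / real q) c J t0 t1"
proof -
  define h where "h = gcd n q"
  define a where "a = real p / real q"
  define \<beta> where "\<beta> = (real h / real q - 1 + a) / 2"
  define e where "e = \<bar>c - real n * a\<bar>"
  define \<phi> where "\<phi> i = \<lceil>of_int i * real h * a\<rceil>" for i :: int
  define J where "J = range \<phi>"
  have q: "0 < q" using pq by simp
  have a: "0 < a" "a \<le> 1" using pq by (simp_all add: a_def)
  have h: "0 < h" using q by (simp add: h_def)
  obtain q' where q': "q = h * q'" unfolding h_def by (metis dvdE gcd_dvd2)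
  obtain n' where n': "n = h * n'" unfolding h_def by (metis dvdE gcd_dvd1)
  have q'0: "0 < q'" using q q' by (cases q') auto
  have near': "e < \<beta>" using near q by (simp add: e_def a_def \<beta>_def h_def field_simps)
  have ha: "real h * a = real p / real q'" using q' h q'0 by (simp add: a_def)
  \<comment> \<open>The rounding error is a multiple of \<open>1 / q' = h / q\<close> below 1, hence
    at most \<open>1 - h / q\<close>. The margin left within a lattice cell of length
    \<open>a\<close> is therefore \<open>2 * \<beta>\<close>.\<close>
  have pos: "0 \<le> of_int (\<phi> i) - of_int (int h * i) * a" "of_int (\<phi> i) - of_int (int h * i) * a \<le> 1 - real h / real q" for i
  proof -
    have eq: "of_int (int h * i) * a = of_int i * real h * a" by simp
    show "0 \<le> of_int (\<phi> i) - of_int (int h * i) * a" unfolding eq \<phi>_def by simp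
    have "of_int (\<phi> i) - of_int i * real h * a < 1" unfolding \<phi>_def by linarith
    then have "of_int (\<phi> i) - of_int i * (real p / real q') < 1" using ha by (simp add: mult.assoc)
    then have "of_int (\<phi> i * int q' - i * int p) < (of_int (int q') :: real)" using q'0 by (simp add: field_simps)
    then have "\<phi> i * int q' - i * int p \<le> int q' - 1" by linarith
    then have "of_int (\<phi> i * int q' - i * int p) \<le> (of_int (int q' - 1) :: real)" by (simp only: of_int_le_iff)
    then have "of_int (\<phi> i) * real q' / real q' \<le> (real q' - 1 + of_int i * real p) / real q'"
      by (intro divide_right_mono) simp_all
    then have "of_int (\<phi> i) - of_int i * (real p / real q') \<le> 1 - 1 / real q'"
      using q'0 by (simp add: add_divide_distrib diff_divide_distrib)
    then show "of_int (\<phi> i) - of_int (int h * i) * a \<le> 1 - real h / real q"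
      unfolding eq using ha q' h by (simp add: mult.assoc)
  qed
  have gap: "1 - real h / real q = a - 2 * \<beta>"
  proof -
    have "1 - x = a - 2 * ((x - 1 + a) / 2)" for x
      by (simp add: field_simps)
    then show ?thesis unfolding \<beta>_def .
  qed
  have e0: "0 \<le> e" by (simp add: e_def)
  \<comment> \<open>This is the interval from \<open>- 2 * \<beta> + e\<close> to
    \<open>- e\<close>: the margin \<open>2 * \<beta>\<close> with \<open>e\<close> taken off at
    each end.\<close>
  have "null_set a c J (- \<beta> - (\<beta> - e)) (- \<beta> + (\<beta> - e))"
    unfolding null_set_def
  proof (intro conjI allI impI)
    show "- \<beta> - (\<beta> - e) < - \<beta> + (\<beta> - e)" using near' by simp
    have "\<phi> 0 = 0" by (simp add: \<phi>_def)
    then show "0 \<in> J" unfolding J_def by (metis rangeI)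
    fix t :: real and k :: int assume t: "- \<beta> - (\<beta> - e) < t \<and> t < - \<beta> + (\<beta> - e)"
    have ge: "of_int (\<phi> i) - (t + of_int k * a) > e" if "k \<le> int h * i" for i k
    proof -
      have "of_int k * a \<le> of_int (int h * i) * a" using a that by (intro mult_right_mono) (simp_all only: of_int_le_iff less_imp_le)
      then show ?thesis using pos(1)[of i] t by linarith
    qed
    have lt: "of_int (\<phi> i) - (t + of_int k * a) < - e" if "int h * i < k" for i k
    proof -
      have "of_int (int h * i + 1) * a \<le> of_int k * a" using a that by (intro mult_right_mono) (simp_all only: of_int_le_iff less_imp_le)
      then have "of_int (int h * i) * a + a \<le> of_int k * a" by (simp add: algebra_simps)
      then show ?thesis using pos(2)[of i] t gap by linarith
    qed
    have away: "e < \<bar>of_int j - (t + of_int k * a)\<bar>" if "j \<in> J" for j k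
    proof -
      obtain i where "j = \<phi> i" using \<open>j \<in> J\<close> by (auto simp: J_def)
      then show ?thesis using ge[of k i] lt[of i k] e0 by (cases "k \<le> int h * i") auto
    qed
    have side: "t + of_int k * a \<le> of_int (\<phi> i) \<longleftrightarrow> k \<le> int h * i" for i k
      using ge[of k i] lt[of i k] e0 by (cases "k \<le> int h * i") auto
    have side': "of_int (\<phi> i) < t + of_int k * a \<longleftrightarrow> int h * i < k" for i k
      using side[of k i] by linarith
    have inj: "inj \<phi>"
    proof (rule linorder_injI)
      fix i j :: int assume "i < j"
      then have "int h * i < int h * j" using h by simp
      then show "\<phi> i \<noteq> \<phi> j" using side[of "int h * j" j] side'[of i "int h * j"] by auto
    qed
    have img: "{j\<in>J. t + of_int k * a \<le> of_int j \<and> of_int j < t + of_int m * a} = \<phi> ` {i. k \<le> int h * i \<and> int h * i < m}" for k m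
      by (auto simp: J_def side side')
    let ?y = "t + of_int k * a"
    have yp: "?y + real n * a = t + of_int (k + int n) * a" and ym: "?y - real n * a = t + of_int (k - int n) * a"
      by (simp_all add: algebra_simps)
    show "wdiff c (indicator J) ?y = 0"
    proof (rule wdiff_indicator_zero[where L = "real n * a"])
      show "card {j\<in>J. ?y \<le> of_int j \<and> of_int j < ?y + real n * a} = card {j\<in>J. ?y - real n * a \<le> of_int j \<and> of_int j < ?y}"
        unfolding yp ym img card_image[OF inj_on_subset[OF inj subset_UNIV]]
        by (rule bij_betw_same_card[of "\<lambda>i. i - int n'"], rule bij_betw_byWitness[where f' = "\<lambda>i. i + int n'"])
          (auto simp: n' algebra_simps)
      fix j assume "j \<in> J"
      then show "\<bar>c - real n * a\<bar> < \<bar>of_int j - (?y + real n * a)\<bar>" "\<bar>c - real n * a\<bar> < \<bar>of_int j - (?y - real n * a)\<bar>"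
        using away[of j "k + int n"] away[of j "k - int n"] unfolding yp ym e_def by simp_all
    qed
  qed
  then show ?thesis unfolding a_def by blast
qed

text \<open>The indicator is multiplied by a tent of height 1 and slope \<open>1 / R\<close>. Each
  window difference is then at most \<open>K / R\<close>, and at most a constant times
  \<open>R\<close> windows meet the support, so the square sum is of order
  \<open>1 / R\<close>.\<close>

lemma null_set_test_vector:
  assumes a: "0 < a" and c: "0 < c" and ns: "null_set a c J t0 t1" and \<eta>: "0 < \<eta>"
  obtains v R where "v 0 = 1" "\<And>j. cmod (v j) \<le> 1" "\<And>j. R < \<bar>j\<bar> \<Longrightarrow> v j = 0"
    "\<And>t. t0 < t \<Longrightarrow> t < t1 \<Longrightarrow> l2sum (\<lambda>n. wdiff c v (t + of_int n * a)) \<le> ennreal \<eta>"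
proof -
  define K where "K = (2 * c + 1) * c"
  define C where "C = (2 * (1 + c) / a + 1) * K\<^sup>2"
  obtain N :: nat where N: "C / \<eta> \<le> real N" using real_arch_simple by blast
  define R where "R = real (Suc N)"
  have R: "1 \<le> R" "C / \<eta> \<le> R" using N by (simp_all add: R_def)
  define \<phi> where "\<phi> x = max 0 (1 - \<bar>x\<bar> / R)" for x :: real
  define v :: "int \<Rightarrow> complex" where "v j = of_real (\<phi> (of_int j)) * indicator J j" for j
  have \<phi>01: "0 \<le> \<phi> x" "\<phi> x \<le> 1" for x using R by (auto simp: \<phi>_def)
  have \<phi>_lip: "\<bar>\<phi> x - \<phi> y\<bar> \<le> \<bar>x - y\<bar> / R" for x y
  proof -
    have "\<bar>max 0 (1 - s) - max 0 (1 - r)\<bar> \<le> \<bar>s - r\<bar>" for s r :: real by linarith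
    then have "\<bar>\<phi> x - \<phi> y\<bar> \<le> \<bar>\<bar>x\<bar> / R - \<bar>y\<bar> / R\<bar>" unfolding \<phi>_def .
    also have "\<dots> = \<bar>\<bar>x\<bar> - \<bar>y\<bar>\<bar> / R" using R by (simp add: diff_divide_distrib[symmetric])
    also have "\<dots> \<le> \<bar>x - y\<bar> / R" using R by (intro divide_right_mono) auto
    finally show ?thesis .
  qed
  have \<phi>0: "\<phi> x = 0" if "R \<le> \<bar>x\<bar>" for x using that R by (simp add: \<phi>_def field_simps)
  have w: "cmod (wdiff c v y) \<le> K / R" if "wdiff c (indicator J) y = 0" for y
  proof -
    \<comment> \<open>Subtracting the constant \<open>\<phi> y\<close> is free because the indicator
      has difference zero at \<open>y\<close>; what remains is the variation of the tent across a
      window, at most \<open>c / R\<close> per point.\<close>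
    let ?w = "\<lambda>j. of_real (\<phi> (of_int j) - \<phi> y) * indicator J j :: complex"
    have "wdiff c v y = wdiff c ?w y + of_real (\<phi> y) * wdiff c (indicator J) y"
      by (simp add: wdiff_def v_def left_diff_distrib sum_subtractf sum_distrib_left right_diff_distrib)
    then have "cmod (wdiff c v y) = cmod (wdiff c ?w y)" using that by simp
    also have "\<dots> \<le> (\<Sum>j | y - c \<le> of_int j \<and> of_int j \<le> y + c. cmod (?w j))" by (rule cmod_wdiff_le[OF c])
    also have "\<dots> \<le> (\<Sum>j | y - c \<le> of_int j \<and> of_int j \<le> y + c. c / R)"
    proof (rule sum_mono)
      fix j assume "j \<in> {j. y - c \<le> of_int j \<and> of_int j \<le> y + c}"
      then have "\<bar>of_int j - y\<bar> / R \<le> c / R" using R by (intro divide_right_mono) auto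
      then have "\<bar>\<phi> (of_int j) - \<phi> y\<bar> \<le> c / R" using \<phi>_lip[of "of_int j" y] by linarith
      moreover have "cmod (?w j) \<le> \<bar>\<phi> (of_int j) - \<phi> y\<bar>" 
        by (simp add: norm_mult indicator_def del: of_real_diff)
      ultimately show "cmod (?w j) \<le> c / R" by linarith
    qed
    also have "\<dots> = real (card {j. y - c \<le> of_int j \<and> of_int j \<le> y + c}) * (c / R)" by simp
    also have "\<dots> \<le> (2 * c + 1) * (c / R)"
      using card_int_interval_le[of "y - c" "y + c"] c R by (intro mult_right_mono) auto
    finally show ?thesis by (simp add: K_def)
  qed
  have w0: "wdiff c v y = 0" if "R + c < \<bar>y\<bar>" for y
  proof -
    have "cmod (wdiff c v y) \<le> (\<Sum>j | y - c \<le> of_int j \<and> of_int j \<le> y + c. cmod (v j))" by (rule cmod_wdiff_le[OF c])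
    also have "\<dots> = 0"
    proof (rule sum.neutral, rule ballI)
      fix j assume "j \<in> {j. y - c \<le> of_int j \<and> of_int j \<le> y + c}"
      then have "R \<le> \<bar>of_int j\<bar>" using that by auto
      then show "cmod (v j) = 0" by (simp add: v_def \<phi>0)
    qed
    finally show ?thesis by simp
  qed
  show ?thesis
  proof (rule that[of v "\<lceil>R\<rceil>"])
    show "v 0 = 1" using ns by (simp add: v_def null_set_def \<phi>_def)
    show "cmod (v j) \<le> 1" for j using \<phi>01[of "of_int j"] by (simp add: v_def norm_mult indicator_def)
    show "v j = 0" if "\<lceil>R\<rceil> < \<bar>j\<bar>" for j
    proof -
      have "R \<le> \<bar>of_int j\<bar>" using that by linarith
      then show ?thesis by (simp add: v_def \<phi>0)
    qed
    fix t assume t: "t0 < t" "t < t1"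
    let ?I = "{n::int. (- R - c - t) / a \<le> of_int n \<and> of_int n \<le> (R + c - t) / a}"
    have I: "n \<in> ?I \<longleftrightarrow> \<bar>t + of_int n * a\<bar> \<le> R + c" for n :: int
      using a by (auto simp: field_simps abs_le_iff)
    have "l2sum (\<lambda>n. wdiff c v (t + of_int n * a)) \<le> (\<integral>\<^sup>+n. ennreal ((K / R)\<^sup>2) * indicator ?I n \<partial>count_space UNIV)"
    proof (rule nn_integral_mono)
      fix n :: int
      show "ennreal ((cmod (wdiff c v (t + of_int n * a)))\<^sup>2) \<le> ennreal ((K / R)\<^sup>2) * indicator ?I n"
      proof (cases "n \<in> ?I")
        case True
        have "wdiff c (indicator J) (t + of_int n * a) = 0" using ns t by (simp add: null_set_def)
        from w[OF this] have "(cmod (wdiff c v (t + of_int n * a)))\<^sup>2 \<le> (K / R)\<^sup>2" by (intro power_mono) auto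
        then show ?thesis using True by (simp add: ennreal_leI)
      next
        case False
        then have "\<not> \<bar>t + of_int n * a\<bar> \<le> R + c" using I by blast
        then have "wdiff c v (t + of_int n * a) = 0" using w0 by simp
        then show ?thesis by simp
      qed
    qed
    also have "\<dots> = ennreal ((K / R)\<^sup>2) * ennreal (real (card ?I))"
      by (subst nn_integral_cmult_indicator) (auto simp: finite_int_interval ennreal_of_nat_eq_real_of_nat)
    also have "\<dots> = ennreal ((K / R)\<^sup>2 * real (card ?I))" by (simp add: ennreal_mult)
    also have "\<dots> \<le> ennreal \<eta>"
    proof (rule ennreal_leI)
      have "(R + c - t) / a - (- R - c - t) / a = 2 * (R + c) / a" using a by (simp add: field_simps)
      then have "real (card ?I) \<le> 2 * (R + c) / a + 1" 
        using card_int_interval_le[of "(- R - c - t) / a" "(R + c - t) / a"] a c R by simp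
      also have "\<dots> \<le> (2 * (1 + c) / a + 1) * R"
      proof -
        have "R + c \<le> (1 + c) * R" using R c by (simp add: algebra_simps mult_left_mono)
        then have "2 * (R + c) / a \<le> 2 * ((1 + c) * R) / a" using a by (intro divide_right_mono mult_left_mono) auto
        then show ?thesis using R by (simp add: algebra_simps)
      qed
      finally have "(K / R)\<^sup>2 * real (card ?I) \<le> (K / R)\<^sup>2 * ((2 * (1 + c) / a + 1) * R)" by (intro mult_left_mono) auto
      also have "\<dots> = C / R" using R by (simp add: C_def power_divide power2_eq_square)
      also have "\<dots> \<le> \<eta>" using R \<eta> by (simp add: field_simps)
      finally show "(K / R)\<^sup>2 * real (card ?I) \<le> \<eta>" .
    qed
    finally show "l2sum (\<lambda>n. wdiff c v (t + of_int n * a)) \<le> ennreal \<eta>" .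
  qed
qed

section \<open>Parseval on the unit interval\<close>

abbreviation unit_interval :: "real measure" where
  "unit_interval \<equiv> restrict_space lborel {0..<1}"

section \<open>Density of trigonometric polynomials in L2 of the unit interval\<close>

inductive trig :: "(real \<Rightarrow> complex) \<Rightarrow> bool" where
  monom: "trig (\<lambda>x. \<alpha> * cis (2 * pi * of_int m * x))"
| add: "trig P \<Longrightarrow> trig Q \<Longrightarrow> trig (\<lambda>x. P x + Q x)"

lemma trig_mult_monom:
  assumes "trig P" shows "trig (\<lambda>x. P x * (\<beta> * cis (2 * pi * of_int k * x)))"
  using assms
proof induction
  case (monom \<alpha> m)
  have "(\<lambda>x. \<alpha> * cis (2 * pi * of_int m * x) * (\<beta> * cis (2 * pi * of_int k * x))) =
     (\<lambda>x. (\<alpha> * \<beta>) * cis (2 * pi * of_int (m + k) * x))"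
  proof
    fix x
    have "cis (2 * pi * of_int (m + k) * x) = cis (2 * pi * of_int m * x) * cis (2 * pi * of_int k * x)"
      unfolding cis_mult by (simp add: algebra_simps)
    then show "\<alpha> * cis (2 * pi * of_int m * x) * (\<beta> * cis (2 * pi * of_int k * x)) = 
       (\<alpha> * \<beta>) * cis (2 * pi * of_int (m + k) * x)" by (simp only: mult_ac)
  qed
  then show ?case using trig.monom[of "\<alpha> * \<beta>" "m + k"] by metis
next
  case (add P Q)
  then show ?case using trig.add by (simp add: distrib_right)
qed

lemma trig_mult:
  assumes "trig Q" "trig P" shows "trig (\<lambda>x. P x * Q x)"
  using assms
proof induction
  case (monom \<alpha> m)
  then show ?case by (rule trig_mult_monom)
next
  case (add Q1 Q2)
  then show ?case using trig.add by (simp add: distrib_left)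
qed

lemma trig_const: "trig (\<lambda>x. \<alpha>)"
  using trig.monom[of \<alpha> 0] by simp

text \<open>On the unit circle a real-linear functional is a combination of cosine and sine, that
  is, of \<open>cis (2 * pi * x)\<close> and its conjugate. Sums and products follow from closure of
  \<open>trig\<close>.\<close>

lemma trig_real_polynomial:
  assumes "real_polynomial_function g"
  shows "trig (\<lambda>x. of_real (g (cis (2 * pi * x))))"
  using assms
proof induction
  case (linear f)
  interpret bounded_linear f by fact
  have "of_real (f (cis (2 * pi * x))) = 
     (of_real (f 1) / 2 + of_real (f \<i>) / (2 * \<i>)) * cis (2 * pi * of_int 1 * x) +
     (of_real (f 1) / 2 - of_real (f \<i>) / (2 * \<i>)) * cis (2 * pi * of_int (-1) * x)" for x
  proof -
    have "cis (2 * pi * x) = cos (2 * pi * x) *\<^sub>R 1 + sin (2 * pi * x) *\<^sub>R \<i>"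
      by (simp add: complex_eq_iff)
    then have "f (cis (2 * pi * x)) = cos (2 * pi * x) * f 1 + sin (2 * pi * x) * f \<i>"
      by (simp only: add scale) simp
    then have "of_real (f (cis (2 * pi * x))) = 
       of_real (cos (2 * pi * x)) * of_real (f 1) + of_real (sin (2 * pi * x)) * (of_real (f \<i>) :: complex)"
      by (simp only: of_real_add of_real_mult)
    moreover have "cis (2 * pi * of_int 1 * x) = of_real (cos (2 * pi * x)) + \<i> * of_real (sin (2 * pi * x))"
       "cis (2 * pi * of_int (-1) * x) = of_real (cos (2 * pi * x)) - \<i> * of_real (sin (2 * pi * x))"
      by (simp_all add: complex_eq_iff)
    moreover have "C * p + S * r = (p / 2 + r / (2 * \<i>)) * (C + \<i> * S) + (p / 2 - r / (2 * \<i>)) * (C - \<i> * S)" 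
      for p r C S :: complex
      by (simp add: field_simps)
    ultimately show ?thesis by (simp only:)
  qed
  then show ?case by (simp only:) (intro trig.intros)
next
  case (const c)
  then show ?case by (rule trig_const)
next
  case (add f g)
  then show ?case using trig.add by simp
next
  case (mult f g)
  then show ?case using trig_mult by simp
qed

text \<open>Coefficients vanish outside \<open>M\<close>, so two forms can be added over the union
  of their frequency sets. The negative frequencies match the sign convention of
  \<open>fcoeff\<close>.\<close>

definition trig_form :: "(real \<Rightarrow> complex) \<Rightarrow> int set \<Rightarrow> (int \<Rightarrow> complex) \<Rightarrow> bool" where
  "trig_form P M \<alpha> \<longleftrightarrow> finite M \<and> (\<forall>m. m \<notin> M \<longrightarrow> \<alpha> m = 0) \<and>
     (\<forall>x. P x = (\<Sum>m\<in>M. \<alpha> m * cis (- (2 * pi * of_int m * x))))"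

lemma trig_form_exists:
  assumes "trig P"
  shows "\<exists>M \<alpha>. trig_form P M \<alpha>"
  using assms
proof induction
  case (monom \<alpha> m)
  have "trig_form (\<lambda>x. \<alpha> * cis (2 * pi * of_int m * x)) {-m} (\<lambda>k. if k = - m then \<alpha> else 0)"
    by (simp add: trig_form_def)
  then show ?case by blast
next
  case (add P Q)
  then obtain M \<alpha> N \<beta> where P: "trig_form P M \<alpha>" and Q: "trig_form Q N \<beta>" by blast
  have "P x + Q x = (\<Sum>m\<in>M \<union> N. (\<alpha> m + \<beta> m) * cis (- (2 * pi * of_int m * x)))" for x
  proof -
    have "P x = (\<Sum>m\<in>M. \<alpha> m * cis (- (2 * pi * of_int m * x)))" 
      "Q x = (\<Sum>m\<in>N. \<beta> m * cis (- (2 * pi * of_int m * x)))" 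
      using P Q by (simp_all add: trig_form_def)
    moreover have "(\<Sum>m\<in>M. \<alpha> m * cis (- (2 * pi * of_int m * x))) = (\<Sum>m\<in>M \<union> N. \<alpha> m * cis (- (2 * pi * of_int m * x)))"
      using P Q unfolding trig_form_def by (intro sum.mono_neutral_left) auto
    moreover have "(\<Sum>m\<in>N. \<beta> m * cis (- (2 * pi * of_int m * x))) = (\<Sum>m\<in>M \<union> N. \<beta> m * cis (- (2 * pi * of_int m * x)))"
      using P Q unfolding trig_form_def by (intro sum.mono_neutral_left) auto
    ultimately show ?thesis by (simp only: distrib_right sum.distrib)
  qed
  then have "trig_form (\<lambda>x. P x + Q x) (M \<union> N) (\<lambda>m. \<alpha> m + \<beta> m)"
    using P Q by (simp add: trig_form_def)
  then show ?case by blast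
qed

lemma trig_measurable: "trig P \<Longrightarrow> P \<in> borel_measurable borel"
proof (induction rule: trig.induct)
  case (monom \<alpha> m)
  then show ?case by (intro borel_measurable_continuous_onI continuous_intros)
qed simp

definition dist2 :: "(real \<Rightarrow> complex) \<Rightarrow> (real \<Rightarrow> complex) \<Rightarrow> ennreal" where
  "dist2 F G = (\<integral>\<^sup>+x. ennreal ((cmod (F x - G x))\<^sup>2) \<partial>unit_interval)"

lemma borel_unit: "F \<in> borel_measurable borel \<Longrightarrow> F \<in> borel_measurable unit_interval"
  by (rule measurable_restrict_space1) simp

lemma borel_unit': "w \<in> borel_measurable borel \<Longrightarrow> w \<in> borel_measurable unit_interval"
  for w :: "real \<Rightarrow> ennreal"
  by (rule measurable_restrict_space1) simp

lemma emeasure_unit_interval: "emeasure unit_interval (space unit_interval) = 1"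
  by (simp add: space_restrict_space emeasure_restrict_space)

interpretation unit_interval: finite_measure unit_interval
  by standard (subst emeasure_unit_interval, simp)

text \<open>Squared distances obey the triangle inequality only up to a factor 2; hence the
  tolerances \<open>\<epsilon> / 4\<close> below.\<close>

lemma dist2_triangle:
  assumes [measurable]: "F \<in> borel_measurable borel" "G \<in> borel_measurable borel" "K \<in> borel_measurable borel"
  shows "dist2 F K \<le> 2 * dist2 F G + 2 * dist2 G K"
proof -
  note [measurable] = assms[THEN borel_unit]
  have *: "ennreal ((cmod (F x - K x))\<^sup>2) \<le> 2 * ennreal ((cmod (F x - G x))\<^sup>2) + 2 * ennreal ((cmod (G x - K x))\<^sup>2)" for x
  proof -
    have "cmod (F x - K x) \<le> cmod (F x - G x) + cmod (G x - K x)"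
      using norm_triangle_ineq[of "F x - G x" "G x - K x"] by simp
    then have "(cmod (F x - K x))\<^sup>2 \<le> (cmod (F x - G x) + cmod (G x - K x))\<^sup>2" by (intro power_mono) auto
    also have "\<dots> \<le> 2 * (cmod (F x - G x))\<^sup>2 + 2 * (cmod (G x - K x))\<^sup>2"
      using sum_squares_bound[of "cmod (F x - G x)" "cmod (G x - K x)"] by (simp add: power2_sum)
    finally have "ennreal ((cmod (F x - K x))\<^sup>2) \<le> ennreal (2 * (cmod (F x - G x))\<^sup>2 + 2 * (cmod (G x - K x))\<^sup>2)"
      by (rule ennreal_leI)
    then show ?thesis by (simp add: ennreal_mult)
  qed
  have "dist2 F K \<le> (\<integral>\<^sup>+x. 2 * ennreal ((cmod (F x - G x))\<^sup>2) + 2 * ennreal ((cmod (G x - K x))\<^sup>2) \<partial>unit_interval)"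
    unfolding dist2_def by (rule nn_integral_mono) (rule *)
  also have "\<dots> = 2 * dist2 F G + 2 * dist2 G K"
    unfolding dist2_def
    by (subst nn_integral_add, measurable, subst nn_integral_cmult, measurable, subst nn_integral_cmult, measurable)
  finally show ?thesis .
qed

definition trig_approx :: "(real \<Rightarrow> complex) \<Rightarrow> bool" where
  "trig_approx F \<longleftrightarrow> F \<in> borel_measurable borel \<and> (\<forall>\<epsilon>>0. \<exists>P. trig P \<and> dist2 F P < ennreal \<epsilon>)"

lemma trig_approxD:
  assumes "trig_approx F" "0 < \<epsilon>"
  shows "\<exists>P. trig P \<and> dist2 F P < ennreal \<epsilon>"
  using assms unfolding trig_approx_def by (elim conjE allE[of _ \<epsilon>] impE)

lemma trig_approx_measurable: "trig_approx F \<Longrightarrow> F \<in> borel_measurable borel"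
  unfolding trig_approx_def by (elim conjE)

lemma trig_approxI:
  assumes "F \<in> borel_measurable borel" "\<And>\<epsilon>. 0 < \<epsilon> \<Longrightarrow> \<exists>P. trig P \<and> dist2 F P < ennreal \<epsilon>"
  shows "trig_approx F"
  unfolding trig_approx_def using assms by (intro conjI allI impI)

lemma trig_approx_close:
  assumes F: "F \<in> borel_measurable borel" and ex: "\<And>\<epsilon>. 0 < \<epsilon> \<Longrightarrow> \<exists>G. trig_approx G \<and> dist2 F G < ennreal \<epsilon>"
  shows "trig_approx F"
proof (rule trig_approxI[OF F])
  fix \<epsilon> :: real assume \<epsilon>: "0 < \<epsilon>"
  then obtain G where G: "trig_approx G" "dist2 F G < ennreal (\<epsilon> / 4)" using ex[of "\<epsilon> / 4"] by (meson zero_less_divide_iff zero_less_numeral)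
  have "0 < \<epsilon> / 4" using \<epsilon> by simp
  from trig_approxD[OF G(1) this] obtain P where P: "trig P" "dist2 G P < ennreal (\<epsilon> / 4)" by blast
  have "dist2 F P \<le> 2 * dist2 F G + 2 * dist2 G P"
    by (rule dist2_triangle[OF F trig_approx_measurable[OF G(1)] trig_measurable[OF P(1)]])
  also have "\<dots> < 2 * ennreal (\<epsilon> / 4) + 2 * ennreal (\<epsilon> / 4)"
    using G(2) P(2) by (intro add_strict_mono ennreal_mult_strict_left_mono) auto
  also have "\<dots> = ennreal (2 * (\<epsilon> / 4) + 2 * (\<epsilon> / 4))"
    using \<epsilon> by (subst ennreal_plus) (simp_all flip: ennreal_numeral add: ennreal_mult[symmetric])
  also have "\<dots> = ennreal \<epsilon>" by simp
  finally show "\<exists>P. trig P \<and> dist2 F P < ennreal \<epsilon>" using P(1) by (intro exI[of _ P] conjI)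
qed

lemma trig_approx_lim:
  assumes F: "F \<in> borel_measurable borel" and G: "\<And>n::nat. trig_approx (G n)"
    and lim: "(\<lambda>n. dist2 F (G n)) \<longlonglongrightarrow> 0"
  shows "trig_approx F"
proof (rule trig_approx_close[OF F])
  fix \<epsilon> :: real assume "0 < \<epsilon>"
  then have "\<forall>\<^sub>F n in sequentially. dist2 F (G n) < ennreal \<epsilon>"
    using order_tendstoD(2)[OF lim, of "ennreal \<epsilon>"] by simp
  then show "\<exists>G. trig_approx G \<and> dist2 F G < ennreal \<epsilon>" using G eventually_happens'[OF sequentially_bot] by blast
qed

lemma trig_approx_dominated:
  fixes G :: "nat \<Rightarrow> real \<Rightarrow> complex"
  assumes F[measurable]: "F \<in> borel_measurable borel" and G: "\<And>n. trig_approx (G n)"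
    and w[measurable]: "w \<in> borel_measurable borel" "(\<integral>\<^sup>+x. w x \<partial>unit_interval) < \<infinity>"
    and bound: "\<And>n x. x \<in> {0..<1} \<Longrightarrow> ennreal ((cmod (F x - G n x))\<^sup>2) \<le> w x"
    and lim: "\<And>x. x \<in> {0..<1} \<Longrightarrow> (\<lambda>n. G n x) \<longlonglongrightarrow> F x"
  shows "trig_approx F"
proof (rule trig_approx_lim[OF F G])
  have [measurable]: "G n \<in> borel_measurable borel" for n using G by (rule trig_approx_measurable)
  note [measurable] = this[THEN borel_unit] F[THEN borel_unit] w(1)[THEN borel_unit']
  have "(\<lambda>n. dist2 F (G n)) \<longlonglongrightarrow> (\<integral>\<^sup>+x. 0 \<partial>unit_interval)"
    unfolding dist2_def
  proof (rule nn_integral_dominated_convergence[where w = w])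
    show "AE x in unit_interval. (\<lambda>n. ennreal ((cmod (F x - G n x))\<^sup>2)) \<longlonglongrightarrow> 0"
    proof (rule AE_I2)
      fix x assume "x \<in> space unit_interval"
      then have "(\<lambda>n. ennreal ((cmod (F x - G n x))\<^sup>2)) \<longlonglongrightarrow> ennreal ((cmod (F x - F x))\<^sup>2)"
        using lim by (intro tendsto_intros) (auto simp: space_restrict_space)
      then show "(\<lambda>n. ennreal ((cmod (F x - G n x))\<^sup>2)) \<longlonglongrightarrow> 0" by simp
    qed
  qed (use bound w(2) in \<open>auto simp: space_restrict_space intro!: AE_I2\<close>)
  then show "(\<lambda>n. dist2 F (G n)) \<longlonglongrightarrow> 0" by simp
qed

lemma trig_approx_bounded_lim:
  fixes G :: "nat \<Rightarrow> real \<Rightarrow> complex"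
  assumes F: "F \<in> borel_measurable borel" and G: "\<And>n. trig_approx (G n)"
    and bound: "\<And>n x. x \<in> {0..<1} \<Longrightarrow> cmod (G n x) \<le> K"
    and lim: "\<And>x. x \<in> {0..<1} \<Longrightarrow> (\<lambda>n. G n x) \<longlonglongrightarrow> F x"
  shows "trig_approx F"
proof (rule trig_approx_dominated[where G = G and w = "\<lambda>x. ennreal ((2 * K)\<^sup>2)", OF F G])
  show "(\<integral>\<^sup>+x. ennreal ((2 * K)\<^sup>2) \<partial>unit_interval) < \<infinity>"
    using emeasure_unit_interval by (simp add: ennreal_mult_less_top)
  fix n :: nat and x :: real assume x: "x \<in> {0..<1}"
  have "cmod (F x) \<le> K" 
    by (rule LIMSEQ_le_const2[OF tendsto_norm[OF lim[OF x]]]) (use bound[OF x] in auto)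
  then have "cmod (F x - G n x) \<le> 2 * K" using bound[OF x, of n] norm_triangle_ineq4[of "F x" "G n x"] by linarith
  then show "ennreal ((cmod (F x - G n x))\<^sup>2) \<le> ennreal ((2 * K)\<^sup>2)" by (intro ennreal_leI power_mono) auto
qed (use lim in auto)

lemma trig_approx_trig: "trig P \<Longrightarrow> trig_approx P"
proof (rule trig_approxI)
  fix \<epsilon> :: real assume "trig P" "0 < \<epsilon>"
  moreover have "dist2 P P = 0" by (simp add: dist2_def)
  ultimately show "\<exists>Q. trig Q \<and> dist2 P Q < ennreal \<epsilon>" by (intro exI[of _ P]) simp
qed (rule trig_measurable)

lemma trig_approx_add:
  assumes F: "trig_approx F" and G: "trig_approx G"
  shows "trig_approx (\<lambda>x. F x + G x)"
proof (rule trig_approxI)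
  have [measurable]: "F \<in> borel_measurable borel" "G \<in> borel_measurable borel"
    by (rule trig_approx_measurable, fact)+
  show "(\<lambda>x. F x + G x) \<in> borel_measurable borel" by measurable
  fix \<epsilon> :: real assume \<epsilon>: "0 < \<epsilon>"
  then have e: "0 < \<epsilon> / 4" by simp
  obtain P where P: "trig P" "dist2 F P < ennreal (\<epsilon> / 4)" using trig_approxD[OF F e] by blast
  obtain Q where Q: "trig Q" "dist2 G Q < ennreal (\<epsilon> / 4)" using trig_approxD[OF G e] by blast
  have [measurable]: "P \<in> borel_measurable borel" "Q \<in> borel_measurable borel"
    by (rule trig_measurable, fact)+
  have "dist2 (\<lambda>x. F x + G x) (\<lambda>x. P x + Q x) \<le> 
    2 * dist2 (\<lambda>x. F x + G x) (\<lambda>x. P x + G x) + 2 * dist2 (\<lambda>x. P x + G x) (\<lambda>x. P x + Q x)"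
    by (rule dist2_triangle) measurable
  also have "\<dots> = 2 * dist2 F P + 2 * dist2 G Q" by (simp add: dist2_def)
  also have "\<dots> < 2 * ennreal (\<epsilon> / 4) + 2 * ennreal (\<epsilon> / 4)"
    using P(2) Q(2) by (intro add_strict_mono ennreal_mult_strict_left_mono) auto
  also have "\<dots> = ennreal (2 * (\<epsilon> / 4) + 2 * (\<epsilon> / 4))"
    using \<epsilon> by (subst ennreal_plus) (simp_all flip: ennreal_numeral add: ennreal_mult[symmetric])
  also have "\<dots> = ennreal \<epsilon>" by simp
  finally show "\<exists>P. trig P \<and> dist2 (\<lambda>x. F x + G x) P < ennreal \<epsilon>" 
    using trig.add[OF P(1) Q(1)] by (intro exI[of _ "\<lambda>x. P x + Q x"] conjI)
qed

lemma trig_approx_cmult: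
  assumes F: "trig_approx F"
  shows "trig_approx (\<lambda>x. \<beta> * F x)"
proof (cases "\<beta> = 0")
  case True
  then show ?thesis using trig_approx_trig[OF trig_const[of 0]] by simp
next
  case False
  show ?thesis
  proof (rule trig_approxI)
    have [measurable]: "F \<in> borel_measurable borel" using F by (rule trig_approx_measurable)
    show "(\<lambda>x. \<beta> * F x) \<in> borel_measurable borel" by measurable
    fix \<epsilon> :: real assume \<epsilon>: "0 < \<epsilon>"
    then have "0 < \<epsilon> / (cmod \<beta>)\<^sup>2" using False by simp
    from trig_approxD[OF F this] obtain P where P: "trig P" "dist2 F P < ennreal (\<epsilon> / (cmod \<beta>)\<^sup>2)"
      by blast
    have [measurable]: "P \<in> borel_measurable borel" by (rule trig_measurable, fact)
    note [measurable] = this[THEN borel_unit] \<open>F \<in> borel_measurable borel\<close>[THEN borel_unit]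
    have "dist2 (\<lambda>x. \<beta> * F x) (\<lambda>x. P x * \<beta>) = ennreal ((cmod \<beta>)\<^sup>2) * dist2 F P"
    proof -
      have "(cmod (\<beta> * F x - P x * \<beta>))\<^sup>2 = (cmod \<beta>)\<^sup>2 * (cmod (F x - P x))\<^sup>2" for x
        by (simp add: power_mult_distrib[symmetric] norm_mult[symmetric] algebra_simps)
      then show ?thesis unfolding dist2_def
        by (simp only: ennreal_mult[OF zero_le_power2 zero_le_power2]) (rule nn_integral_cmult, measurable)
    qed
    also have "\<dots> < ennreal ((cmod \<beta>)\<^sup>2) * ennreal (\<epsilon> / (cmod \<beta>)\<^sup>2)"
      using P(2) False by (intro ennreal_mult_strict_left_mono) auto
    also have "\<dots> = ennreal \<epsilon>" using \<epsilon> False by (simp add: ennreal_mult[symmetric])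
    finally show "\<exists>P. trig P \<and> dist2 (\<lambda>x. \<beta> * F x) P < ennreal \<epsilon>" 
      using trig_mult[OF trig_const P(1), of \<beta>] by (intro exI[of _ "\<lambda>x. P x * \<beta>"] conjI)
  qed
qed

lemma trig_approx_sum:
  assumes "finite A" "\<And>i. i \<in> A \<Longrightarrow> trig_approx (F i)"
  shows "trig_approx (\<lambda>x. \<Sum>i\<in>A. F i x)"
  using assms
proof (induction A rule: finite_induct)
  case empty
  then show ?case using trig_approx_trig[OF trig_const[of 0]] by simp
next
  case (insert i A)
  then show ?case using trig_approx_add[of "F i" "\<lambda>x. \<Sum>i\<in>A. F i x"] by simp
qed

text \<open>Stone-Weierstrass on the circle: uniform approximation by real polynomials gives
  approximation in mean square, as the interval has measure 1.\<close>

lemma trig_approx_continuous: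
  fixes h :: "complex \<Rightarrow> real"
  assumes "continuous_on UNIV h"
  shows "trig_approx (\<lambda>x. of_real (h (cis (2 * pi * x))))"
proof -
  have h: "continuous_on (sphere 0 1) h" using assms continuous_on_subset by blast
  have m: "(\<lambda>x. of_real (h (cis (2 * pi * x))) :: complex) \<in> borel_measurable borel"
    by (intro borel_measurable_continuous_onI continuous_intros continuous_on_compose2[OF assms]) auto
  show ?thesis
  proof (rule trig_approx_close[OF m])
    fix \<epsilon> :: real assume \<epsilon>: "0 < \<epsilon>"
    then obtain g where g: "real_polynomial_function g" "\<And>z. z \<in> sphere 0 1 \<Longrightarrow> \<bar>h z - g z\<bar> < sqrt (\<epsilon> / 2)"
      using Stone_Weierstrass_real_polynomial_function[OF compact_sphere h, of "sqrt (\<epsilon> / 2)"] by auto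
    let ?P = "\<lambda>x. complex_of_real (g (cis (2 * pi * x)))"
    have "dist2 (\<lambda>x. of_real (h (cis (2 * pi * x)))) ?P \<le> (\<integral>\<^sup>+x. ennreal (\<epsilon> / 2) \<partial>unit_interval)"
      unfolding dist2_def
    proof (intro nn_integral_mono ennreal_leI)
      fix x :: real
      have "cmod (of_real (h (cis (2 * pi * x))) - ?P x) = \<bar>h (cis (2 * pi * x)) - g (cis (2 * pi * x))\<bar>"
        by (metis norm_of_real of_real_diff)
      also have "\<dots> \<le> sqrt (\<epsilon> / 2)" using g(2)[of "cis (2 * pi * x)"] by simp
      finally show "(cmod (of_real (h (cis (2 * pi * x))) - ?P x))\<^sup>2 \<le> \<epsilon> / 2"
        using \<epsilon> by (metis norm_ge_zero power_mono real_sqrt_pow2 less_imp_le half_gt_zero)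
    qed
    also have "\<dots> = ennreal (\<epsilon> / 2)" using emeasure_unit_interval by simp
    also have "\<dots> < ennreal \<epsilon>" using \<epsilon> by (simp add: ennreal_lessI)
    finally show "\<exists>G. trig_approx G \<and> dist2 (\<lambda>x. of_real (h (cis (2 * pi * x)))) G < ennreal \<epsilon>"
      using trig_approx_trig[OF trig_real_polynomial[OF g(1)]] by blast
  qed
qed

lemma ramp_lim: "(\<lambda>n. min 1 (real n * max 0 s)) \<longlonglongrightarrow> (if s > 0 then 1 else 0)"
proof (cases "s > 0")
  case True
  obtain N :: nat where N: "1 / s \<le> real N" using real_arch_simple by blast
  have "\<forall>\<^sub>F n in sequentially. min 1 (real n * max 0 s) = 1"
  proof (rule eventually_sequentiallyI[of N])
    fix n assume "N \<le> n"
    then have "1 / s \<le> real n" using N by simp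
    then show "min 1 (real n * max 0 s) = 1" using True by (simp add: field_simps min_def)
  qed
  then show ?thesis using True by (simp add: tendsto_eventually)
qed simp

lemma trig_approx_cong:
  assumes "trig_approx F" "G \<in> borel_measurable borel" "\<And>x. x \<in> {0..<1} \<Longrightarrow> G x = F x"
  shows "trig_approx G"
proof -
  have "dist2 G P = dist2 F P" for P
    unfolding dist2_def using assms(3) by (intro nn_integral_cong) (simp add: space_restrict_space)
  then show ?thesis
    using trig_approxD[OF assms(1)] by - (rule trig_approxI[OF assms(2)], simp only:)
qed

text \<open>The ramps \<open>min 1 (n * max 0 s)\<close> are continuous and converge boundedly to
  the indicator of \<open>s > 0\<close>. Two such conditions are enough to cut out an arc of the
  circle.\<close>

lemma trig_approx_ramp:
  fixes s t :: "complex \<Rightarrow> real"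
  assumes s: "continuous_on UNIV s" "continuous_on UNIV t"
  shows "trig_approx (\<lambda>x. if s (cis (2 * pi * x)) > 0 \<and> \<not> t (cis (2 * pi * x)) > 0 then 1 else 0)"
proof -
  let ?G = "\<lambda>n z. min 1 (real n * max 0 (s z)) * (1 - min 1 (real n * max 0 (t z)))"
  have "continuous_on UNIV (?G n)" for n by (intro continuous_intros s)
  then have G: "trig_approx (\<lambda>x. of_real (?G n (cis (2 * pi * x))))" for n by (rule trig_approx_continuous)
  have meas: "(\<lambda>x. s (cis (2 * pi * x))) \<in> borel_measurable borel" "(\<lambda>x. t (cis (2 * pi * x))) \<in> borel_measurable borel"
    by (intro borel_measurable_continuous_onI continuous_on_compose2[OF s(1)] continuous_on_compose2[OF s(2)] continuous_intros; simp)+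
  show ?thesis
  proof (rule trig_approx_bounded_lim[OF _ G, where K = 1])
    show "(\<lambda>x. if s (cis (2 * pi * x)) > 0 \<and> \<not> t (cis (2 * pi * x)) > 0 then 1 else 0 :: complex) \<in> borel_measurable borel"
      using meas by measurable
    fix n :: nat and x :: real
    have "0 \<le> ?G n z" "?G n z \<le> 1" for z
      by (auto intro!: mult_nonneg_nonneg mult_le_one)
    then show "cmod (complex_of_real (?G n (cis (2 * pi * x)))) \<le> 1"
      unfolding norm_of_real by (simp only: abs_of_nonneg)
  next
    fix x :: real
    let ?z = "cis (2 * pi * x)"
    have "(\<lambda>n. complex_of_real (?G n ?z)) \<longlonglongrightarrow> complex_of_real ((if s ?z > 0 then 1 else 0) * (1 - (if t ?z > 0 then 1 else 0)))"
      by (intro tendsto_intros ramp_lim)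
    then show "(\<lambda>n. complex_of_real (?G n ?z)) \<longlonglongrightarrow> (if s ?z > 0 \<and> \<not> t ?z > 0 then 1 else 0)"
      by (auto split: if_splits)
  qed
qed

text \<open>For \<open>b \<le> 1/2\<close> the arc is the part of the closed upper half circle with
  real part above \<open>cos (2 * pi * b)\<close>, where the cosine is decreasing.\<close>

lemma trig_approx_indicator_lessThan:
  "trig_approx (indicator {..<b})"
proof -
  have m: "indicator {..<b} \<in> borel_measurable (borel :: real measure)" by simp
  consider "b \<le> 0" | "0 < b" "b \<le> 1/2" | "1/2 < b" "b \<le> 1" | "1 < b" by linarith
  then show ?thesis
  proof cases
    case 1
    then show ?thesis by (intro trig_approx_cong[OF trig_approx_trig[OF trig_const[of 0]] m]) auto
  next
    case 4
    then show ?thesis by (intro trig_approx_cong[OF trig_approx_trig[OF trig_const[of 1]] m]) auto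
  next
    case 2
    show ?thesis
    proof (rule trig_approx_cong[OF trig_approx_ramp[of "\<lambda>z. Re z - cos (2 * pi * b)" "\<lambda>z. - Im z"] m])
      fix x :: real assume x: "x \<in> {0..<1}"
      show "indicator {..<b} x = (if Re (cis (2 * pi * x)) - cos (2 * pi * b) > 0 \<and> \<not> - Im (cis (2 * pi * x)) > 0 then 1 else 0 :: complex)"
      proof (cases "x \<le> 1/2")
        case True
        then have "2 * pi * x \<le> pi" by (simp add: field_simps)
        then have "sin (2 * pi * x) \<ge> 0" using x by (intro sin_ge_zero) auto
        moreover have "cos (2 * pi * b) < cos (2 * pi * x) \<longleftrightarrow> x < b"
          using True x 2 by (subst cos_mono_less_eq) (auto simp: field_simps)
        ultimately show ?thesis by (auto simp: indicator_def)
      next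
        case False
        then have "sin (2 * pi * x) < 0" using x by (intro sin_lt_zero) (auto simp: field_simps)
        then show ?thesis using False 2 by (auto simp: indicator_def)
      qed
    qed (intro continuous_intros)+
  next
    case 3
    \<comment> \<open>For \<open>b > 1/2\<close> the complementary arc, from \<open>b\<close> to 1,
      lies in the open lower half circle and is the simpler one to describe.\<close>
    let ?F = "\<lambda>x. if - Im (cis (2 * pi * x)) > 0 \<and> \<not> cos (2 * pi * b) - Re (cis (2 * pi * x)) > 0 then 1 else 0 :: complex"
    have "trig_approx ?F" by (rule trig_approx_ramp[of "\<lambda>z. - Im z" "\<lambda>z. cos (2 * pi * b) - Re z"]) (intro continuous_intros)+
    then have "trig_approx (\<lambda>x. 1 + (-1) * ?F x)" 
      by (intro trig_approx_add trig_approx_cmult trig_approx_trig[OF trig_const])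
    then show ?thesis
    proof (rule trig_approx_cong[OF _ m])
      fix x :: real assume x: "x \<in> {0..<1}"
      show "indicator {..<b} x = 1 + (-1) * ?F x"
      proof (cases "x \<le> 1/2")
        case True
        then have "2 * pi * x \<le> pi" by (simp add: field_simps)
        then have "sin (2 * pi * x) \<ge> 0" using x by (intro sin_ge_zero) auto
        then show ?thesis using True 3 by (auto simp: indicator_def)
      next
        case False
        then have "sin (2 * pi * x) < 0" using x by (intro sin_lt_zero) (auto simp: field_simps)
        moreover have "cos (2 * pi - 2 * pi * x) < cos (2 * pi - 2 * pi * b) \<longleftrightarrow> 2 * pi - 2 * pi * b < 2 * pi - 2 * pi * x"
          using False x 3 by (subst cos_mono_less_eq) (auto simp: field_simps)
        moreover have "cos (2 * pi - y) = cos y" for y by (simp add: cos_diff)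
        ultimately show ?thesis by (auto simp: indicator_def)
      qed
    qed
  qed
qed

text \<open>A Dynkin class argument: half-lines are closed under intersection and generate the Borel
  sets, and disjoint unions are bounded pointwise limits of finite sums.\<close>

lemma trig_approx_indicator:
  assumes "A \<in> sets (borel :: real measure)"
  shows "trig_approx (indicator A)"
proof -
  let ?G = "range (\<lambda>b::real. {..<b})"
  have "{..<a} \<inter> {..<b} = {..<min a b}" for a b :: real by auto
  then have st: "Int_stable ?G" by (auto simp: Int_stable_def)
  have S: "sigma_sets UNIV ?G = sets (borel :: real measure)"
    unfolding borel_Iio by simp
  have sub: "?G \<subseteq> Pow UNIV" by simp
  have A: "A \<in> sigma_sets UNIV ?G" using assms S by simp
  from st sub A show ?thesis
  proof (induction rule: sigma_sets_induct_disjoint)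
    case (basic A)
    then show ?case using trig_approx_indicator_lessThan by auto
  next
    case empty
    have "(indicator {} :: real \<Rightarrow> complex) = (\<lambda>x. 0)" by auto
    then show ?case using trig_approx_trig[OF trig_const[of 0]] by simp
  next
    case (compl A)
    have "trig_approx (\<lambda>x. 1 + (-1) * indicator A x)"
      by (intro trig_approx_add trig_approx_cmult trig_approx_trig[OF trig_const] compl)
    moreover have "(\<lambda>x. 1 + (-1) * indicator A x :: complex) = indicator (UNIV - A)"
      by (auto simp: indicator_def)
    ultimately show ?case by simp
  next
    case (union A)
    have Am: "A i \<in> sets borel" for i using union(2) S by auto
    have "trig_approx (\<lambda>x. \<Sum>i<n. indicator (A i) x)" for n
      by (intro trig_approx_sum union) auto
    then show ?case
    proof (rule trig_approx_bounded_lim[rotated, where K = 1])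
      show "indicator (\<Union>i. A i) \<in> borel_measurable borel" using Am by (intro borel_measurable_indicator) auto
      fix n :: nat and x :: real
      have eq: "(\<Sum>i<n. indicator (A i) x :: complex) = indicator (\<Union>i<n. A i) x" for n
        using union(1) by (subst indicator_UN_disjoint) (auto simp: disjoint_family_on_def)
      show "cmod (\<Sum>i<n. indicator (A i) x) \<le> 1" unfolding eq by (simp add: indicator_def)
      show "(\<lambda>n. \<Sum>i<n. indicator (A i) x) \<longlonglongrightarrow> (indicator (\<Union>i. A i) x :: complex)"
        unfolding eq by (rule LIMSEQ_indicator_UN)
    qed
  qed
qed

text \<open>The simple functions are dominated by twice \<open>F\<close>, so the error is at most
  three times \<open>F\<close> and its square is dominated with the factor 9.\<close>

lemma trig_approx_L2:
  assumes F[measurable]: "F \<in> borel_measurable borel"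
    and fin: "(\<integral>\<^sup>+x. ennreal ((cmod (F x))\<^sup>2) \<partial>unit_interval) < \<infinity>"
  shows "trig_approx F"
proof -
  note [measurable] = F[THEN borel_unit]
  obtain s where s: "\<And>i. simple_function borel (s i)" "\<And>x. (\<lambda>i. s i x) \<longlonglongrightarrow> F x"
    "\<And>i x. dist (s i x) 0 \<le> 2 * dist (F x) 0"
    using borel_measurable_implies_sequence_metric[OF F, of 0] by auto
  have "trig_approx (s i)" for i
  proof -
    have fin: "finite (range (s i))" using s(1)[of i] by (simp add: simple_function_def)
    have "s i = (\<lambda>x. \<Sum>y\<in>range (s i). y * indicator (s i -` {y}) x)"
    proof
      fix x
      have "(\<Sum>y\<in>range (s i). y * indicator (s i -` {y}) x) = (\<Sum>y\<in>range (s i). if y = s i x then y else 0)"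
        by (intro sum.cong) (auto simp: indicator_def)
      then show "s i x = (\<Sum>y\<in>range (s i). y * indicator (s i -` {y}) x)" using fin by simp
    qed
    moreover have "trig_approx (\<lambda>x. \<Sum>y\<in>range (s i). y * indicator (s i -` {y}) x)"
      using s(1)[of i] fin
      by (intro trig_approx_sum trig_approx_cmult trig_approx_indicator) (auto simp: simple_function_def)
    ultimately show ?thesis by simp
  qed
  then show ?thesis
  proof (rule trig_approx_dominated[OF F, where w = "\<lambda>x. 9 * ennreal ((cmod (F x))\<^sup>2)"])
    show "(\<integral>\<^sup>+x. 9 * ennreal ((cmod (F x))\<^sup>2) \<partial>unit_interval) < \<infinity>"
      using fin by (subst nn_integral_cmult) (auto simp: ennreal_mult_less_top)
    fix n :: nat and x :: real
    have "cmod (F x - s n x) \<le> 3 * cmod (F x)" using s(3)[of n x] norm_triangle_ineq4[of "F x" "s n x"] by simp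
    then have "(cmod (F x - s n x))\<^sup>2 \<le> (3 * cmod (F x))\<^sup>2" by (intro power_mono) auto
    then have "ennreal ((cmod (F x - s n x))\<^sup>2) \<le> ennreal (9 * (cmod (F x))\<^sup>2)" by (intro ennreal_leI) (simp add: power_mult_distrib)
    then show "ennreal ((cmod (F x - s n x))\<^sup>2) \<le> 9 * ennreal ((cmod (F x))\<^sup>2)" by (simp add: ennreal_mult)
  qed (use s(2) in auto)
qed


section \<open>Fourier coefficients and Parseval's identity\<close>

lemma integral_cis:
  "(LINT x|unit_interval. cis (2 * pi * of_int k * x)) = (if k = 0 then 1 else 0)"
proof (cases "k = 0")
  case True
  have "measure unit_interval (space unit_interval) = 1" 
    using emeasure_unit_interval by (simp add: measure_def)
  then show ?thesis using True by simp
next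
  case False
  let ?G = "\<lambda>x. cis (2 * pi * of_int k * x) / (2 * pi * of_int k * \<i>)"
  have "(LINT x|unit_interval. cis (2 * pi * of_int k * x)) = 
     (LINT x|lborel. indicator {0..<1} x *\<^sub>R cis (2 * pi * of_int k * x))"
    by (subst integral_restrict_space) auto
  also have "\<dots> = (LINT x|lborel. indicator {0..1} x *\<^sub>R cis (2 * pi * of_int k * x))"
  proof (rule integral_cong_AE)
    show "AE x in lborel. indicator {0..<1} x *\<^sub>R cis (2 * pi * real_of_int k * x) =
       indicator {0..1} x *\<^sub>R cis (2 * pi * of_int k * x)"
      using AE_lborel_singleton[of "1::real"] by eventually_elim (auto simp: indicator_def)
    have [measurable]: "(\<lambda>x. cis (2 * pi * of_int k * x)) \<in> borel_measurable borel"
      by (intro borel_measurable_continuous_onI continuous_intros)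
    show "(\<lambda>x. indicator {0..<1} x *\<^sub>R cis (2 * pi * of_int k * x)) \<in> borel_measurable lborel"
     "(\<lambda>x. indicator {0..1} x *\<^sub>R cis (2 * pi * of_int k * x)) \<in> borel_measurable lborel"
      by measurable
  qed
  also have "\<dots> = ?G 1 - ?G 0"
  proof (rule integral_FTC_Icc)
    fix x :: real
    have "((\<lambda>x. exp (\<i> * of_real (2 * pi * of_int k * x)) / (2 * pi * of_int k * \<i>)) has_vector_derivative 
        exp (\<i> * of_real (2 * pi * of_int k * x))) (at x within {0..1})"
      using False by (auto intro!: derivative_eq_intros has_vector_derivative_real_field simp: field_simps)
    then show "(?G has_vector_derivative cis (2 * pi * of_int k * x)) (at x within {0..1})"
      by (simp add: cis_conv_exp)
  next
    show "continuous_on {0..1} (\<lambda>x. cis (2 * pi * of_int k * x))" by (intro continuous_intros)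
  qed simp
  also have "\<dots> = 0" using cis_multiple_2pi[of "of_int k"] by simp
  finally show ?thesis using False by simp
qed

lemma integrable_unit_interval_bounded:
  fixes F :: "real \<Rightarrow> 'a::{banach, second_countable_topology}"
  assumes "F \<in> borel_measurable unit_interval" "\<And>x. norm (F x) \<le> B"
  shows "integrable unit_interval F"
  using assms by (intro unit_interval.integrable_const_bound[where B = B]) auto

text \<open>The coefficient against \<open>cis (- (2 * pi * m * x))\<close>, with the sign of the
  modulations in \<open>gabor\<close>.\<close>

definition fcoeff :: "(real \<Rightarrow> complex) \<Rightarrow> int \<Rightarrow> complex" where
  "fcoeff F m = (LINT x|unit_interval. F x * cis (2 * pi * of_int m * x))"

text \<open>Completing the square. The choice \<open>\<alpha> = fcoeff F\<close> gives Bessel's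
  inequality; for general \<open>\<alpha>\<close> the identity shows that an approximation with
  error below \<open>\<epsilon>\<close> leaves less than \<open>\<epsilon>\<close> of the energy
  outside \<open>M\<close>.\<close>

lemma dist2_trig_sum:
  fixes \<alpha> :: "int \<Rightarrow> complex"
  assumes F: "F \<in> borel_measurable borel" and int: "integrable unit_interval (\<lambda>x. (cmod (F x))\<^sup>2)" and M: "finite M"
  defines "P \<equiv> \<lambda>x. \<Sum>m\<in>M. \<alpha> m * cis (- (2 * pi * of_int m * x))"
  shows "dist2 F P = ennreal ((LINT x|unit_interval. (cmod (F x))\<^sup>2) - (\<Sum>m\<in>M. (cmod (fcoeff F m))\<^sup>2) 
     + (\<Sum>m\<in>M. (cmod (\<alpha> m - fcoeff F m))\<^sup>2))"
    and "0 \<le> (LINT x|unit_interval. (cmod (F x))\<^sup>2) - (\<Sum>m\<in>M. (cmod (fcoeff F m))\<^sup>2) 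
     + (\<Sum>m\<in>M. (cmod (\<alpha> m - fcoeff F m))\<^sup>2)"
proof -
  let ?e = "\<lambda>m x. cis (2 * pi * of_int m * x)"
  note [measurable] = F borel_unit[OF F]
  have [measurable]: "?e m \<in> borel_measurable unit_interval" for m
    by (intro borel_unit borel_measurable_continuous_onI continuous_intros)
  have [measurable]: "(\<lambda>x. cis (- (2 * pi * of_int m * x))) \<in> borel_measurable unit_interval" for m :: int
    by (intro borel_unit borel_measurable_continuous_onI continuous_intros)
  have Pm[measurable]: "P \<in> borel_measurable unit_interval" unfolding P_def by measurable
  \<comment> \<open>Square integrability implies integrability here because
    \<open>cmod z \<le> 1 + (cmod z)^2\<close> and the measure is finite.\<close>
  have intF: "integrable unit_interval F"
  proof (rule Bochner_Integration.integrable_bound)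
    show "integrable unit_interval (\<lambda>x. 1 + (cmod (F x))\<^sup>2)"
      by (intro Bochner_Integration.integrable_add int integrable_unit_interval_bounded[where B = 1]) auto
    show "AE x in unit_interval. norm (F x) \<le> norm (1 + (cmod (F x))\<^sup>2)"
    proof (rule AE_I2)
      fix x
      have "0 \<le> (cmod (F x) - 1)\<^sup>2" by simp
      then have "2 * cmod (F x) \<le> 1 + (cmod (F x))\<^sup>2" by (simp add: power2_eq_square algebra_simps)
      moreover have "0 \<le> cmod (F x)" by simp
      ultimately have "cmod (F x) \<le> 1 + (cmod (F x))\<^sup>2" by linarith
      then show "norm (F x) \<le> norm (1 + (cmod (F x))\<^sup>2)" by simp
    qed
  qed measurable
  have intFe: "integrable unit_interval (\<lambda>x. F x * ?e m x)" for m
    by (rule Bochner_Integration.integrable_bound[OF intF]) (auto simp: norm_mult)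
  have Pb: "cmod (P x) \<le> (\<Sum>m\<in>M. cmod (\<alpha> m))" for x
    unfolding P_def by (rule order_trans[OF norm_sum]) (simp add: norm_mult)
  have FP: "F x * cnj (P x) = (\<Sum>m\<in>M. cnj (\<alpha> m) * (F x * ?e m x))" for x
    by (simp add: P_def cis_cnj sum_distrib_left mult_ac)
  have intFP: "integrable unit_interval (\<lambda>x. F x * cnj (P x))"
    unfolding FP by (intro Bochner_Integration.integrable_sum integrable_mult_right intFe)
  have iFP: "(LINT x|unit_interval. F x * cnj (P x)) = (\<Sum>m\<in>M. cnj (\<alpha> m) * fcoeff F m)"
    unfolding FP fcoeff_def
    by (subst Bochner_Integration.integral_sum) (auto intro!: integrable_mult_right intFe)
  have PP: "P x * cnj (P x) = (\<Sum>m\<in>M. \<Sum>k\<in>M. (\<alpha> m * cnj (\<alpha> k)) * ?e (k - m) x)" for x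
  proof -
    have *: "(\<alpha> m * cis (- (2 * pi * of_int m * x))) * (cnj (\<alpha> k) * ?e k x) = (\<alpha> m * cnj (\<alpha> k)) * ?e (k - m) x" for m k
    proof -
      have "?e (k - m) x = cis (- (2 * pi * of_int m * x)) * ?e k x"
        unfolding cis_mult by (simp add: algebra_simps)
      then show ?thesis by (simp only: mult_ac)
    qed
    have "cnj (P x) = (\<Sum>k\<in>M. cnj (\<alpha> k) * ?e k x)" by (simp add: P_def cis_cnj)
    then show ?thesis unfolding P_def by (simp only: sum_product *)
  qed
  have inte: "integrable unit_interval (?e k)" for k
    by (rule integrable_unit_interval_bounded[where B = 1]) auto
  have iPP: "(LINT x|unit_interval. P x * cnj (P x)) = (\<Sum>m\<in>M. of_real ((cmod (\<alpha> m))\<^sup>2))"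
  proof -
    have "(LINT x|unit_interval. P x * cnj (P x)) = (\<Sum>m\<in>M. \<Sum>k\<in>M. (\<alpha> m * cnj (\<alpha> k)) * (LINT x|unit_interval. ?e (k - m) x))"
      unfolding PP
      using inte by (simp only: Bochner_Integration.integral_sum Bochner_Integration.integrable_sum
          Bochner_Integration.integral_mult_right_zero integrable_mult_right)
    also have "\<dots> = (\<Sum>m\<in>M. \<Sum>k\<in>M. if m = k then \<alpha> m * cnj (\<alpha> k) else 0)"
      unfolding integral_cis by (intro sum.cong) auto
    also have "\<dots> = (\<Sum>m\<in>M. \<alpha> m * cnj (\<alpha> m))" using M by simp
    finally show ?thesis by (simp only: complex_norm_square)
  qed
  have intPP: "integrable unit_interval (\<lambda>x. P x * cnj (P x))"
    unfolding PP by (intro Bochner_Integration.integrable_sum integrable_mult_right inte)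
  have sq: "(cmod (F x - P x))\<^sup>2 = (cmod (F x))\<^sup>2 - 2 * Re (F x * cnj (P x)) + Re (P x * cnj (P x))" for x
    unfolding cmod_power2 by (simp add: power2_eq_square algebra_simps)
  have intsq: "integrable unit_interval (\<lambda>x. (cmod (F x - P x))\<^sup>2)"
    unfolding sq by (intro Bochner_Integration.integrable_add Bochner_Integration.integrable_diff int integrable_mult_right integrable_Re intFP intPP)
  have "(LINT x|unit_interval. (cmod (F x - P x))\<^sup>2) = (LINT x|unit_interval. (cmod (F x))\<^sup>2) - 
      2 * Re (LINT x|unit_interval. F x * cnj (P x)) + Re (LINT x|unit_interval. P x * cnj (P x))"
    unfolding sq
    by (simp only: Bochner_Integration.integral_add Bochner_Integration.integral_diff 
        Bochner_Integration.integral_mult_right_zero integral_Re Bochner_Integration.integrable_diff 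
        integrable_mult_right integrable_Re int intFP intPP)
  also have "\<dots> = (LINT x|unit_interval. (cmod (F x))\<^sup>2) - (\<Sum>m\<in>M. 2 * Re (cnj (\<alpha> m) * fcoeff F m) - (cmod (\<alpha> m))\<^sup>2)"
    unfolding iFP iPP by (simp add: sum_subtractf sum_distrib_left)
  also have "(\<Sum>m\<in>M. 2 * Re (cnj (\<alpha> m) * fcoeff F m) - (cmod (\<alpha> m))\<^sup>2) = 
     (\<Sum>m\<in>M. (cmod (fcoeff F m))\<^sup>2 - (cmod (\<alpha> m - fcoeff F m))\<^sup>2)"
    unfolding cmod_power2 by (intro sum.cong) (auto simp: power2_eq_square algebra_simps)
  finally have eq: "(LINT x|unit_interval. (cmod (F x - P x))\<^sup>2) = (LINT x|unit_interval. (cmod (F x))\<^sup>2) 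
     - (\<Sum>m\<in>M. (cmod (fcoeff F m))\<^sup>2) + (\<Sum>m\<in>M. (cmod (\<alpha> m - fcoeff F m))\<^sup>2)"
    by (simp add: sum_subtractf)
  show "dist2 F P = ennreal ((LINT x|unit_interval. (cmod (F x))\<^sup>2) - (\<Sum>m\<in>M. (cmod (fcoeff F m))\<^sup>2) 
     + (\<Sum>m\<in>M. (cmod (\<alpha> m - fcoeff F m))\<^sup>2))"
    unfolding dist2_def eq[symmetric] by (rule nn_integral_eq_integral[OF intsq]) simp
  show "0 \<le> (LINT x|unit_interval. (cmod (F x))\<^sup>2) - (\<Sum>m\<in>M. (cmod (fcoeff F m))\<^sup>2) 
     + (\<Sum>m\<in>M. (cmod (\<alpha> m - fcoeff F m))\<^sup>2)"
    unfolding eq[symmetric] by (rule integral_nonneg_AE) simp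
qed

theorem parseval:
  assumes F: "F \<in> borel_measurable borel" and int: "integrable unit_interval (\<lambda>x. (cmod (F x))\<^sup>2)"
  shows "((\<lambda>m. (cmod (fcoeff F m))\<^sup>2) has_sum (LINT x|unit_interval. (cmod (F x))\<^sup>2)) UNIV"
  unfolding has_sum_def tendsto_iff eventually_finite_subsets_at_top
proof (intro allI impI)
  fix \<epsilon> :: real assume \<epsilon>: "0 < \<epsilon>"
  let ?N = "LINT x|unit_interval. (cmod (F x))\<^sup>2"
  let ?s = "\<lambda>M. \<Sum>m\<in>M. (cmod (fcoeff F m))\<^sup>2"
  have bessel: "?s M \<le> ?N" if "finite M" for M
    using dist2_trig_sum(2)[OF F int that, of "fcoeff F"] by simp
  have "(\<integral>\<^sup>+x. ennreal ((cmod (F x))\<^sup>2) \<partial>unit_interval) < \<infinity>"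
    using int by (simp add: integrable_iff_bounded)
  then obtain P where P: "trig P" "dist2 F P < ennreal \<epsilon>"
    using trig_approxD[OF trig_approx_L2[OF F] \<epsilon>] by blast
  then obtain M \<alpha> where "trig_form P M \<alpha>" using trig_form_exists by blast
  then have M: "finite M" "P = (\<lambda>x. \<Sum>m\<in>M. \<alpha> m * cis (- (2 * pi * of_int m * x)))"
    by (auto simp: trig_form_def)
  have "ennreal (?N - ?s M + (\<Sum>m\<in>M. (cmod (\<alpha> m - fcoeff F m))\<^sup>2)) < ennreal \<epsilon>"
    using P(2) dist2_trig_sum(1)[OF F int M(1), of \<alpha>] M(2) by simp
  then have "?N - ?s M + (\<Sum>m\<in>M. (cmod (\<alpha> m - fcoeff F m))\<^sup>2) < \<epsilon>"
    using \<epsilon> by (simp add: ennreal_less_iff dist2_trig_sum(2)[OF F int M(1)])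
  moreover have "0 \<le> (\<Sum>m\<in>M. (cmod (\<alpha> m - fcoeff F m))\<^sup>2)" by (intro sum_nonneg) auto
  ultimately have N: "?N < ?s M + \<epsilon>" by linarith
  show "\<exists>X. finite X \<and> X \<subseteq> UNIV \<and> (\<forall>Y. finite Y \<and> X \<subseteq> Y \<and> Y \<subseteq> UNIV \<longrightarrow> dist (?s Y) ?N < \<epsilon>)"
  proof (intro exI[of _ M] conjI allI impI)
    fix Y :: "int set" assume Y: "finite Y \<and> M \<subseteq> Y \<and> Y \<subseteq> UNIV"
    then have "?s M \<le> ?s Y" by (intro sum_mono2) auto
    then show "dist (?s Y) ?N < \<epsilon>" using N bessel[of Y] Y by (simp add: dist_real_def)
  qed (use M in auto)
qed

section \<open>Fibers of the Gabor system\<close>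

text \<open>A bridge from unordered sums to counting-measure integrals, where sums and integrals of
  nonnegative terms can be interchanged without summability checks.\<close>

lemma nn_sum_has_sum:
  fixes f :: "'i \<Rightarrow> real"
  assumes nn: "\<And>i. 0 \<le> f i"
  shows has_sum_imp_nn_sum: "(f has_sum S) UNIV \<Longrightarrow> (\<integral>\<^sup>+i. ennreal (f i) \<partial>count_space UNIV) = ennreal S"
    and nn_sum_finite_summable: "(\<integral>\<^sup>+i. ennreal (f i) \<partial>count_space UNIV) < \<infinity> \<Longrightarrow> f summable_on UNIV"
proof -
  assume hs: "(f has_sum S) UNIV"
  then have "f summable_on UNIV" by (rule has_sum_imp_summable)
  then have "(\<lambda>i. norm (f i)) summable_on UNIV" using nn by simp
  then have abs: "Infinite_Set_Sum.abs_summable_on f UNIV" using abs_summable_equivalent by blast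
  then have "(\<integral>\<^sup>+i. ennreal (f i) \<partial>count_space UNIV) = ennreal (infsetsum f UNIV)"
    using nn by (intro nn_integral_conv_infsetsum) auto
  also have "infsetsum f UNIV = S" using infsetsum_infsum[OF abs] infsumI[OF hs] by simp
  finally show "(\<integral>\<^sup>+i. ennreal (f i) \<partial>count_space UNIV) = ennreal S" .
next
  assume fin: "(\<integral>\<^sup>+i. ennreal (f i) \<partial>count_space UNIV) < \<infinity>"
  then have "integrable (count_space UNIV) f" using nn by (simp add: integrable_iff_bounded)
  then have "Infinite_Set_Sum.abs_summable_on f UNIV" by (simp add: Infinite_Set_Sum.abs_summable_on_def)
  then have "(\<lambda>i. norm (f i)) summable_on UNIV" using abs_summable_equivalent by blast
  then show "f summable_on UNIV" using nn by simp
qed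

lemma H_measurable [measurable]: "H c \<in> borel_measurable borel"
  unfolding H_def by measurable

lemma H_cases: "H c x = 0 \<or> H c x = 1 \<or> H c x = -1"
  by (auto simp: H_def indicator_def)

lemma H_support: "H c x \<noteq> 0 \<Longrightarrow> - c \<le> x \<and> x < c"
  by (cases "0 \<le> x \<and> x < c"; cases "- c \<le> x \<and> x < 0"; auto simp: H_def indicator_def)

lemma cmod_H_le: "cmod (H c x) \<le> 1"
  using H_cases[of c x] by auto

lemma cnj_H [simp]: "cnj (H c x) = H c x"
  using H_cases[of c x] by auto

lemma sum_H_eq_wdiff:
  assumes A: "finite A" and sub: "\<And>j. H c (x + of_int j - of_int n * a) \<noteq> 0 \<Longrightarrow> j \<in> A" and c: "0 < c"
  shows "(\<Sum>j\<in>A. f (x + of_int j) * H c (x + of_int j - of_int n * a)) = wdiff c (\<lambda>j. f (x + of_int j)) (of_int n * a - x)"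
proof -
  let ?y = "of_int n * a - x"
  let ?P = "{\<lceil>?y\<rceil>..<\<lceil>?y + c\<rceil>}" and ?N = "{\<lceil>?y - c\<rceil>..<\<lceil>?y\<rceil>}"
  have P: "j \<in> ?P \<longleftrightarrow> 0 \<le> x + of_int j - of_int n * a \<and> x + of_int j - of_int n * a < c" for j
    by (simp add: ceiling_le_iff less_ceiling_iff) linarith
  have N: "j \<in> ?N \<longleftrightarrow> - c \<le> x + of_int j - of_int n * a \<and> x + of_int j - of_int n * a < 0" for j
    by (simp add: ceiling_le_iff less_ceiling_iff) linarith
  have HP: "H c (x + of_int j - of_int n * a) = 1" if "j \<in> ?P" for j
    using that unfolding P by (simp add: H_def indicator_def)
  have HN: "H c (x + of_int j - of_int n * a) = -1" if "j \<in> ?N" for j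
    using that unfolding N by (simp add: H_def indicator_def)
  have H0: "H c (x + of_int j - of_int n * a) = 0" if "j \<notin> ?P \<union> ?N" for j
    using that unfolding Un_iff P N by (auto simp: H_def indicator_def)
  have "(\<Sum>j\<in>A. f (x + of_int j) * H c (x + of_int j - of_int n * a)) = 
     (\<Sum>j\<in>?P \<union> ?N. f (x + of_int j) * H c (x + of_int j - of_int n * a))"
  proof (rule sum.mono_neutral_right[OF A])
    show "?P \<union> ?N \<subseteq> A" using sub HP HN by force
  qed (use H0 in auto)
  also have "\<dots> = (\<Sum>j\<in>?P. f (x + of_int j) * H c (x + of_int j - of_int n * a)) + (\<Sum>j\<in>?N. f (x + of_int j) * H c (x + of_int j - of_int n * a))"
    by (rule sum.union_disjoint) auto
  also have "(\<Sum>j\<in>?P. f (x + of_int j) * H c (x + of_int j - of_int n * a)) = (\<Sum>j\<in>?P. f (x + of_int j))"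
    using HP by (intro sum.cong) auto
  also have "(\<Sum>j\<in>?N. f (x + of_int j) * H c (x + of_int j - of_int n * a)) = - (\<Sum>j\<in>?N. f (x + of_int j))"
    unfolding sum_negf[symmetric] using HN by (intro sum.cong) auto
  finally show ?thesis by (simp add: wdiff_def)
qed

lemma L2_measurable: "f \<in> L2 \<Longrightarrow> f \<in> borel_measurable borel"
  by (simp add: L2_def)

lemma ennreal_L2_norm: "f \<in> L2 \<Longrightarrow> (\<integral>\<^sup>+x. ennreal ((cmod (f x))\<^sup>2) \<partial>lborel) = ennreal ((L2_norm f)\<^sup>2)"
  unfolding L2_def L2_norm_def by (subst nn_integral_eq_integral) auto

lemma nn_integral_unit: 
  assumes "g \<in> borel_measurable borel"
  shows "(\<integral>\<^sup>+x. g x \<partial>unit_interval) = (\<integral>\<^sup>+x. g x * indicator {0..<1} x \<partial>lborel)"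
  by (rule nn_integral_restrict_space) simp

text \<open>The line is cut into unit intervals, each translated back to
  \<open>[0, 1)\<close>.\<close>

lemma unit_periodization:
  assumes f[measurable]: "f \<in> borel_measurable borel"
  shows "(\<integral>\<^sup>+x. ennreal ((cmod (f x))\<^sup>2) \<partial>lborel) = (\<integral>\<^sup>+x. l2sum (\<lambda>j. f (x + of_int j)) \<partial>unit_interval)"
proof -
  have m: "(\<lambda>x. ennreal ((cmod (f (x + of_int j)))\<^sup>2)) \<in> borel_measurable unit_interval" for j :: int
    by (rule borel_unit') measurable
  have "(\<integral>\<^sup>+x. l2sum (\<lambda>j. f (x + of_int j)) \<partial>unit_interval) = 
     (\<integral>\<^sup>+j. (\<integral>\<^sup>+x. ennreal ((cmod (f (x + of_int j)))\<^sup>2) \<partial>unit_interval) \<partial>count_space (UNIV :: int set))"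
    by (rule nn_integral_count_space_nn_integral) (use m in auto)
  also have "\<dots> = (\<integral>\<^sup>+j. (\<integral>\<^sup>+x. ennreal ((cmod (f x))\<^sup>2) * indicator {of_int j..<of_int j + 1} x \<partial>lborel) \<partial>count_space (UNIV :: int set))"
  proof (rule nn_integral_cong)
    fix j :: int
    have "(\<integral>\<^sup>+x. ennreal ((cmod (f x))\<^sup>2) * indicator {of_int j..<of_int j + 1} x \<partial>lborel) = 
      ennreal \<bar>1\<bar> * (\<integral>\<^sup>+x. ennreal ((cmod (f (of_int j + 1 * x)))\<^sup>2) * indicator {of_int j..<of_int j + 1} (of_int j + 1 * x) \<partial>lborel)"
      by (rule nn_integral_real_affine) auto
    also have "\<dots> = (\<integral>\<^sup>+x. ennreal ((cmod (f (x + of_int j)))\<^sup>2) * indicator {0..<1} x \<partial>lborel)"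
      by (simp add: indicator_def add.commute)
    also have "\<dots> = (\<integral>\<^sup>+x. ennreal ((cmod (f (x + of_int j)))\<^sup>2) \<partial>unit_interval)"
      by (rule nn_integral_unit[symmetric]) measurable
    finally show "(\<integral>\<^sup>+x. ennreal ((cmod (f (x + of_int j)))\<^sup>2) \<partial>unit_interval) = 
       (\<integral>\<^sup>+x. ennreal ((cmod (f x))\<^sup>2) * indicator {of_int j..<of_int j + 1} x \<partial>lborel)" ..
  qed
  also have "\<dots> = (\<integral>\<^sup>+x. (\<integral>\<^sup>+j. ennreal ((cmod (f x))\<^sup>2) * indicator {of_int j..<of_int j + 1} x \<partial>count_space (UNIV :: int set)) \<partial>lborel)"
    by (rule nn_integral_count_space_nn_integral[symmetric]) auto
  also have "\<dots> = (\<integral>\<^sup>+x. ennreal ((cmod (f x))\<^sup>2) \<partial>lborel)"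
  proof (rule nn_integral_cong)
    fix x :: real
    have "of_int j \<le> x \<and> x < of_int j + 1 \<longleftrightarrow> j = \<lfloor>x\<rfloor>" for j by linarith
    then have "(\<integral>\<^sup>+j. ennreal ((cmod (f x))\<^sup>2) * indicator {of_int j..<of_int j + 1} x \<partial>count_space (UNIV :: int set)) = 
       (\<integral>\<^sup>+j. ennreal ((cmod (f x))\<^sup>2) * indicator {\<lfloor>x\<rfloor>} j \<partial>count_space (UNIV :: int set))"
      by (simp add: indicator_def)
    also have "\<dots> = ennreal ((cmod (f x))\<^sup>2)" by (subst nn_integral_cmult_indicator) auto
    finally show "(\<integral>\<^sup>+j. ennreal ((cmod (f x))\<^sup>2) * indicator {of_int j..<of_int j + 1} x \<partial>count_space (UNIV :: int set)) = 
       ennreal ((cmod (f x))\<^sup>2)" .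
  qed
  finally show ?thesis ..
qed

text \<open>For \<open>x\<close> in \<open>[0, 1)\<close> this is the periodization of
  \<open>f\<close> times the translated \<open>H c\<close>. The finite range of \<open>j\<close>
  does not depend on \<open>x\<close>, which keeps measurability and integrability elementary; the
  margin 2 covers all such \<open>x\<close>.\<close>

definition fiber :: "real \<Rightarrow> real \<Rightarrow> (real \<Rightarrow> complex) \<Rightarrow> int \<Rightarrow> real \<Rightarrow> complex" where
  "fiber c a f n x = (\<Sum>j\<in>{\<lfloor>of_int n * a - c\<rfloor> - 2..\<lceil>of_int n * a + c\<rceil> + 2}. f (x + of_int j) * H c (x + of_int j - of_int n * a))"

lemma fiber_eq_wdiff:
  assumes "0 < c" "x \<in> {0..<1}"
  shows "fiber c a f n x = wdiff c (\<lambda>j. f (x + of_int j)) (of_int n * a - x)"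
  unfolding fiber_def
proof (rule sum_H_eq_wdiff)
  fix j assume "H c (x + of_int j - of_int n * a) \<noteq> 0"
  then have "- c \<le> x + of_int j - of_int n * a \<and> x + of_int j - of_int n * a < c" by (rule H_support)
  then show "j \<in> {\<lfloor>of_int n * a - c\<rfloor> - 2..\<lceil>of_int n * a + c\<rceil> + 2}" using assms(2) by simp linarith
qed (use assms in auto)

lemma borel_measurable_count_sum:
  fixes g :: "int \<Rightarrow> real \<Rightarrow> ennreal"
  assumes "\<And>n. g n \<in> borel_measurable M"
  shows "(\<lambda>x. \<integral>\<^sup>+n. g n x \<partial>count_space UNIV) \<in> borel_measurable M"
proof (rule sigma_finite_measure.borel_measurable_nn_integral)
  show "sigma_finite_measure (count_space (UNIV :: int set))" by (rule sigma_finite_measure_count_space)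
  have "(\<lambda>p. g (snd p) (fst p)) \<in> borel_measurable (M \<Otimes>\<^sub>M count_space UNIV)"
    by (rule measurable_compose_countable[where f = "\<lambda>n p. g n (fst p)"])
      (rule measurable_compose[OF measurable_fst assms], rule measurable_snd)
  then show "(\<lambda>(x, n). g n x) \<in> borel_measurable (M \<Otimes>\<^sub>M count_space UNIV)"
    by (simp add: case_prod_beta')
qed

lemma fiber_measurable [measurable]:
  assumes [measurable]: "f \<in> borel_measurable borel"
  shows "fiber c a f n \<in> borel_measurable borel"
  unfolding fiber_def by measurable

lemma integrable_fiber_square:
  assumes f: "f \<in> L2"
  shows "integrable unit_interval (\<lambda>x. (cmod (fiber c a f n x))\<^sup>2)"
proof -
  have [measurable]: "f \<in> borel_measurable borel" by (rule L2_measurable[OF f])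
  let ?A = "{\<lfloor>of_int n * a - c\<rfloor> - 2..\<lceil>of_int n * a + c\<rceil> + 2}"
  have int: "integrable unit_interval (\<lambda>x. (cmod (f (x + of_int j)))\<^sup>2)" for j :: int
  proof -
    have "integrable lborel (\<lambda>x. (cmod (f x))\<^sup>2)" using f by (simp add: L2_def)
    then have "integrable lborel (\<lambda>x. (cmod (f (of_int j + 1 * x)))\<^sup>2)" by (rule lborel_integrable_real_affine) simp
    then have "integrable lborel (\<lambda>x. indicator {0..<1} x *\<^sub>R (cmod (f (x + of_int j)))\<^sup>2)"
      by (intro integrable_mult_indicator) (auto simp: add.commute)
    then show ?thesis by (subst integrable_restrict_space) auto
  qed
  show ?thesis
  proof (rule Bochner_Integration.integrable_bound)
    show "integrable unit_interval (\<lambda>x. (\<Sum>j\<in>?A. (cmod (f (x + of_int j)))\<^sup>2) * real (card ?A))"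
      by (intro integrable_mult_left Bochner_Integration.integrable_sum int)
    have "fiber c a f n \<in> borel_measurable unit_interval" by (rule borel_unit) measurable
    then show "(\<lambda>x. (cmod (fiber c a f n x))\<^sup>2) \<in> borel_measurable unit_interval" by measurable
    show "AE x in unit_interval. norm ((cmod (fiber c a f n x))\<^sup>2) \<le> norm ((\<Sum>j\<in>?A. (cmod (f (x + of_int j)))\<^sup>2) * real (card ?A))"
    proof (rule AE_I2)
      fix x
      have "cmod (fiber c a f n x) \<le> (\<Sum>j\<in>?A. cmod (f (x + of_int j)))"
        unfolding fiber_def
        by (rule order_trans[OF norm_sum], rule sum_mono) (simp add: norm_mult mult_left_le cmod_H_le)
      then have "(cmod (fiber c a f n x))\<^sup>2 \<le> (\<Sum>j\<in>?A. cmod (f (x + of_int j)))\<^sup>2" by (intro power_mono) auto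
      also have "\<dots> \<le> (\<Sum>j\<in>?A. (cmod (f (x + of_int j)))\<^sup>2) * real (card ?A)" by (rule sum_squared_le_sum_of_squares)
      finally show "norm ((cmod (fiber c a f n x))\<^sup>2) \<le> norm ((\<Sum>j\<in>?A. (cmod (f (x + of_int j)))\<^sup>2) * real (card ?A))"
        by simp
    qed
  qed
qed

text \<open>The modulations have period 1, so folding the integral over the line into
  \<open>[0, 1)\<close> turns the inner product into a Fourier coefficient. Conjugation makes the
  exponent positive.\<close>

lemma L2_inner_gabor:
  assumes f: "f \<in> L2"
  shows "L2_inner f (gabor (H c) a (m, n)) = fcoeff (fiber c a f n) m"
proof -
  have [measurable]: "f \<in> borel_measurable borel" by (rule L2_measurable[OF f])
  have [measurable]: "(\<lambda>x. cis (2 * pi * of_int m * x)) \<in> borel_measurable borel"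
    by (intro borel_measurable_continuous_onI continuous_intros)
  define k where "k x = f x * H c (x - of_int n * a) * cis (2 * pi * of_int m * x)" for x
  let ?A = "{\<lfloor>of_int n * a - c\<rfloor> - 2..\<lceil>of_int n * a + c\<rceil> + 2}"
  have km[measurable]: "k \<in> borel_measurable borel" unfolding k_def by measurable
  have cnj: "cnj (exp (- 2 * complex_of_real pi * \<i> * of_int m * complex_of_real x)) = cis (2 * pi * of_int m * x)" for x
    by (simp add: exp_cnj cis_conv_exp mult_ac)
  have inner: "L2_inner f (gabor (H c) a (m, n)) = (LINT x|lborel. k x)"
    unfolding L2_inner_def gabor_def prod.case complex_cnj_mult cnj cnj_H k_def by (simp only: mult_ac)
  have ksupp: "k x = 0" if "\<lfloor>x\<rfloor> \<notin> ?A" for x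
  proof -
    have "H c (x - of_int n * a) = 0" 
    proof (rule ccontr)
      assume "H c (x - of_int n * a) \<noteq> 0"
      then have "- c \<le> x - of_int n * a \<and> x - of_int n * a < c" by (rule H_support)
      then have "\<lfloor>x\<rfloor> \<in> ?A" by simp linarith
      then show False using that by simp
    qed
    then show ?thesis by (simp add: k_def)
  qed
  have kint: "integrable lborel (\<lambda>x. indicator {of_int j..<of_int j + 1} x *\<^sub>R k x)" for j :: int
  proof (rule Bochner_Integration.integrable_bound)
    show "integrable lborel (\<lambda>x. indicator {of_int j..<of_int j + 1} x + (cmod (f x))\<^sup>2 :: real)"
      using f by (intro Bochner_Integration.integrable_add integrable_real_indicator) (auto simp: L2_def)
    show "AE x in lborel. norm (indicator {of_int j..<of_int j + 1} x *\<^sub>R k x) \<le> norm (indicator {of_int j..<of_int j + 1} x + (cmod (f x))\<^sup>2 :: real)"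
    proof (rule AE_I2)
      fix x
      have "0 \<le> (cmod (f x) - 1)\<^sup>2" by simp
      then have "2 * cmod (f x) \<le> 1 + (cmod (f x))\<^sup>2" by (simp add: power2_eq_square algebra_simps)
      moreover have "0 \<le> cmod (f x)" by simp
      ultimately have "cmod (f x) \<le> 1 + (cmod (f x))\<^sup>2" by linarith
      moreover have "cmod (k x) \<le> cmod (f x)" 
        unfolding k_def norm_mult norm_cis using mult_left_le[OF cmod_H_le, of "cmod (f x)"] by simp
      ultimately show "norm (indicator {of_int j..<of_int j + 1} x *\<^sub>R k x) \<le> norm (indicator {of_int j..<of_int j + 1} x + (cmod (f x))\<^sup>2 :: real)"
        by (auto simp: indicator_def)
    qed
  qed measurable
  have ksum: "k x = (\<Sum>j\<in>?A. indicator {of_int j..<of_int j + 1} x *\<^sub>R k x)" for x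
  proof -
    have "of_int j \<le> x \<and> x < of_int j + 1 \<longleftrightarrow> j = \<lfloor>x\<rfloor>" for j by linarith
    then have "(\<Sum>j\<in>?A. indicator {of_int j..<of_int j + 1} x *\<^sub>R k x) = (\<Sum>j\<in>?A. if j = \<lfloor>x\<rfloor> then k x else 0)"
      by (intro sum.cong refl) (simp add: indicator_def)
    also have "\<dots> = (if \<lfloor>x\<rfloor> \<in> ?A then k x else 0)" by (subst sum.delta) auto
    finally show ?thesis using ksupp[of x] by (auto split: if_splits)
  qed
  have per: "cis (2 * pi * of_int m * (x + of_int j)) = cis (2 * pi * of_int m * x)" for x and j :: int
  proof -
    have "cis (2 * pi * of_int m * (x + of_int j)) = cis (2 * pi * of_int m * x) * cis (2 * pi * of_int (m * j))"
      unfolding cis_mult by (simp add: algebra_simps)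
    then show ?thesis using cis_multiple_2pi[of "of_int (m * j)"] by simp
  qed
  have part: "(LINT x|lborel. indicator {of_int j..<of_int j + 1} x *\<^sub>R k x) = (LINT x|unit_interval. k (x + of_int j))" for j :: int
  proof -
    have "(LINT x|lborel. indicator {of_int j..<of_int j + 1} x *\<^sub>R k x) = 
      \<bar>1\<bar> *\<^sub>R (LINT x|lborel. indicator {of_int j..<of_int j + 1} (of_int j + 1 * x) *\<^sub>R k (of_int j + 1 * x))"
      by (rule lborel_integral_real_affine) simp
    also have "\<dots> = (LINT x|lborel. indicator {0..<1} x *\<^sub>R k (x + of_int j))"
      by (simp add: indicator_def add.commute)
    also have "\<dots> = (LINT x|unit_interval. k (x + of_int j))" by (subst integral_restrict_space) auto
    finally show ?thesis .
  qed
  have partint: "integrable unit_interval (\<lambda>x. k (x + of_int j))" for j :: int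
  proof -
    have "integrable lborel (\<lambda>x. indicator {of_int j..<of_int j + 1} (of_int j + 1 * x) *\<^sub>R k (of_int j + 1 * x))"
      using kint[of j] by (rule lborel_integrable_real_affine) simp
    then have "integrable lborel (\<lambda>x. indicator {0..<1} x *\<^sub>R k (x + of_int j))" 
      by (simp add: indicator_def add.commute)
    then show ?thesis by (subst integrable_restrict_space) auto
  qed
  have "(LINT x|lborel. k x) = (LINT x|lborel. (\<Sum>j\<in>?A. indicator {of_int j..<of_int j + 1} x *\<^sub>R k x))"
    using ksum by (intro Bochner_Integration.integral_cong) auto
  also have "\<dots> = (\<Sum>j\<in>?A. LINT x|lborel. indicator {of_int j..<of_int j + 1} x *\<^sub>R k x)"
    by (rule Bochner_Integration.integral_sum) (rule kint)
  also have "\<dots> = (LINT x|unit_interval. (\<Sum>j\<in>?A. k (x + of_int j)))"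
    unfolding part by (rule Bochner_Integration.integral_sum[symmetric]) (rule partint)
  also have "(\<lambda>x. \<Sum>j\<in>?A. k (x + of_int j)) = (\<lambda>x. fiber c a f n x * cis (2 * pi * of_int m * x))"
    unfolding fiber_def k_def per sum_distrib_right ..
  finally show ?thesis unfolding inner fcoeff_def .
qed

text \<open>Parseval is applied in \<open>m\<close> for each fixed translate \<open>n\<close>;
  Tonelli then moves the sum over \<open>n\<close> inside the integral.\<close>

lemma gabor_sum_eq:
  assumes f: "f \<in> L2" and c: "0 < c"
  shows "(\<integral>\<^sup>+k. ennreal ((cmod (L2_inner f (gabor (H c) a k)))\<^sup>2) \<partial>count_space UNIV) = 
     (\<integral>\<^sup>+x. l2sum (\<lambda>n. wdiff c (\<lambda>j. f (x + of_int j)) (of_int n * a - x)) \<partial>unit_interval)"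
proof -
  have [measurable]: "f \<in> borel_measurable borel" by (rule L2_measurable[OF f])
  have "(\<integral>\<^sup>+k. ennreal ((cmod (L2_inner f (gabor (H c) a k)))\<^sup>2) \<partial>count_space UNIV) = 
     (\<integral>\<^sup>+n. (\<integral>\<^sup>+m. ennreal ((cmod (L2_inner f (gabor (H c) a (m, n))))\<^sup>2) \<partial>count_space UNIV) \<partial>count_space UNIV)"
    by (rule nn_integral_snd_count_space[symmetric])
  also have "\<dots> = (\<integral>\<^sup>+n. (\<integral>\<^sup>+x. ennreal ((cmod (fiber c a f n x))\<^sup>2) \<partial>unit_interval) \<partial>count_space UNIV)"
  proof (rule nn_integral_cong)
    fix n :: int
    have "(\<integral>\<^sup>+m. ennreal ((cmod (fcoeff (fiber c a f n) m))\<^sup>2) \<partial>count_space UNIV) = 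
        ennreal (LINT x|unit_interval. (cmod (fiber c a f n x))\<^sup>2)"
      by (intro has_sum_imp_nn_sum parseval fiber_measurable integrable_fiber_square f) auto
    also have "\<dots> = (\<integral>\<^sup>+x. ennreal ((cmod (fiber c a f n x))\<^sup>2) \<partial>unit_interval)"
      by (rule nn_integral_eq_integral[symmetric]) (auto intro: integrable_fiber_square f)
    finally show "(\<integral>\<^sup>+m. ennreal ((cmod (L2_inner f (gabor (H c) a (m, n))))\<^sup>2) \<partial>count_space UNIV) = 
       (\<integral>\<^sup>+x. ennreal ((cmod (fiber c a f n x))\<^sup>2) \<partial>unit_interval)"
      unfolding L2_inner_gabor[OF f] .
  qed
  also have "\<dots> = (\<integral>\<^sup>+x. l2sum (\<lambda>n. fiber c a f n x) \<partial>unit_interval)"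
  proof (rule nn_integral_count_space_nn_integral[symmetric])
    fix n :: int
    have "fiber c a f n \<in> borel_measurable unit_interval" by (rule borel_unit) measurable
    then show "(\<lambda>x. ennreal ((cmod (fiber c a f n x))\<^sup>2)) \<in> borel_measurable unit_interval" by measurable
  qed simp
  also have "\<dots> = (\<integral>\<^sup>+x. l2sum (\<lambda>n. wdiff c (\<lambda>j. f (x + of_int j)) (of_int n * a - x)) \<partial>unit_interval)"
    using fiber_eq_wdiff[OF c] by (intro nn_integral_cong) (simp add: space_restrict_space)
  finally show ?thesis .
qed

lemma gabor_in_L2: "gabor (H c) a k \<in> L2"
proof -
  obtain m n where k: "k = (m, n)" by (cases k)
  let ?g = "gabor (H c) a (m, n)"
  have m: "?g \<in> borel_measurable borel"
  proof -
    have [measurable]: "(\<lambda>x. exp (- 2 * complex_of_real pi * \<i> * of_int m * complex_of_real x)) \<in> borel_measurable borel"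
      by (intro borel_measurable_continuous_onI continuous_intros)
    show ?thesis unfolding gabor_def prod.case by measurable
  qed
  have "cmod (exp (- 2 * complex_of_real pi * \<i> * of_int m * complex_of_real x)) = 1" for x
    by (simp add: norm_exp_eq_Re)
  then have sq: "(cmod (?g x))\<^sup>2 = (cmod (H c (x - of_int n * a)))\<^sup>2" for x by (simp add: gabor_def norm_mult)
  have "integrable lborel (\<lambda>x. (cmod (?g x))\<^sup>2)"
  proof (rule Bochner_Integration.integrable_bound)
    show "integrable lborel (indicator {of_int n * a - c..of_int n * a + c} :: real \<Rightarrow> real)"
      by (rule integrable_real_indicator) (auto simp: emeasure_lborel_Icc_eq)
    show "(\<lambda>x. (cmod (?g x))\<^sup>2) \<in> borel_measurable lborel" using m by simp
    show "AE x in lborel. norm ((cmod (?g x))\<^sup>2) \<le> norm (indicator {of_int n * a - c..of_int n * a + c} x :: real)"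
    proof (rule AE_I2)
      fix x
      show "norm ((cmod (?g x))\<^sup>2) \<le> norm (indicator {of_int n * a - c..of_int n * a + c} x :: real)"
        unfolding sq using H_support[of c "x - of_int n * a"] H_cases[of c "x - of_int n * a"]
        by (cases "H c (x - of_int n * a) = 0") (auto simp: indicator_def)
    qed
  qed
  then show ?thesis using m k by (simp add: L2_def)
qed

section \<open>The two directions of the fiber criterion\<close>

text \<open>The sequence bounds are used with offset \<open>- x\<close> on the fiber over
  \<open>x\<close> and integrated over \<open>[0, 1)\<close>; uniformity in the offset makes the
  constants independent of \<open>x\<close>.\<close>

lemma frame_if_null_free:
  assumes a: "0 < a" and c: "0 < c" and nf: "null_free a c"
  shows "is_frame UNIV (gabor (H c) a)"
proof -
  obtain C1 where C1: "C1 > 0" "\<And>t v. l2sum v < \<infinity> \<Longrightarrow> l2sum v \<le> ennreal C1 * l2sum (\<lambda>n. wdiff c v (t + of_int n * a))"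
    using l2_lower_bound[OF a c nf] by blast
  obtain C2 where C2: "C2 > 0" "\<And>t v. l2sum (\<lambda>n. wdiff c v (t + of_int n * a)) \<le> ennreal C2 * l2sum v"
    using l2_upper_bound[OF a c] by blast
  have main: "(\<lambda>k. (cmod (L2_inner f (gabor (H c) a k)))\<^sup>2) summable_on UNIV \<and>
          1 / C1 * (L2_norm f)\<^sup>2 \<le> (\<Sum>\<^sub>\<infinity>k\<in>UNIV. (cmod (L2_inner f (gabor (H c) a k)))\<^sup>2) \<and>
          (\<Sum>\<^sub>\<infinity>k\<in>UNIV. (cmod (L2_inner f (gabor (H c) a k)))\<^sup>2) \<le> C2 * (L2_norm f)\<^sup>2" if f: "f \<in> L2" for f
  proof -
    let ?g = "\<lambda>k. (cmod (L2_inner f (gabor (H c) a k)))\<^sup>2"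
    define S where "S = (\<integral>\<^sup>+k. ennreal (?g k) \<partial>count_space UNIV)"
    define w where "w x = l2sum (\<lambda>n. wdiff c (\<lambda>j. f (x + of_int j)) (of_int n * a - x))" for x
    define u where "u x = l2sum (\<lambda>j. f (x + of_int j))" for x
    have [measurable]: "f \<in> borel_measurable borel" by (rule L2_measurable[OF f])
    have S: "S = (\<integral>\<^sup>+x. w x \<partial>unit_interval)" unfolding S_def w_def by (rule gabor_sum_eq[OF f c])
    have N: "ennreal ((L2_norm f)\<^sup>2) = (\<integral>\<^sup>+x. u x \<partial>unit_interval)" 
      unfolding u_def unit_periodization[symmetric, OF L2_measurable[OF f]] by (rule ennreal_L2_norm[OF f, symmetric])
    have um: "u \<in> borel_measurable unit_interval"
    proof -
      have "(\<lambda>x. ennreal ((cmod (f (x + of_int j)))\<^sup>2)) \<in> borel_measurable unit_interval" for j :: int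
        by (rule borel_unit') measurable
      then show ?thesis unfolding u_def by (rule borel_measurable_count_sum)
    qed
    have up: "w x \<le> ennreal C2 * u x" for x
      using C2(2)[of "\<lambda>j. f (x + of_int j)" "- x"] by (simp add: w_def u_def)
    have "S \<le> (\<integral>\<^sup>+x. ennreal C2 * u x \<partial>unit_interval)" unfolding S by (intro nn_integral_mono up)
    also have "\<dots> = ennreal C2 * ennreal ((L2_norm f)\<^sup>2)" unfolding N by (rule nn_integral_cmult[OF um])
    also have "\<dots> = ennreal (C2 * (L2_norm f)\<^sup>2)" using C2(1) by (simp add: ennreal_mult)
    finally have upper: "S \<le> ennreal (C2 * (L2_norm f)\<^sup>2)" .
    then have "S < \<infinity>" using order.strict_trans1[OF _ ennreal_less_top] by simp
    then have sum: "?g summable_on UNIV" unfolding S_def by (intro nn_sum_finite_summable) auto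
    then have Sinf: "S = ennreal (\<Sum>\<^sub>\<infinity>k\<in>UNIV. ?g k)"
      unfolding S_def by (intro has_sum_imp_nn_sum has_sum_infsum) auto
    \<comment> \<open>The lower bound needs square-summable fibers, and almost every fiber of an
      \<open>L2\<close> function is such.\<close>
    have "AE x in unit_interval. u x \<noteq> \<infinity>"
      using um N by (intro nn_integral_PInf_AE) (auto simp flip: N)
    then have low: "AE x in unit_interval. u x \<le> ennreal C1 * w x"
    proof eventually_elim
      case (elim x)
      then show ?case using C1(2)[of "\<lambda>j. f (x + of_int j)" "- x"] by (simp add: w_def u_def less_top)
    qed
    have "w \<in> borel_measurable unit_interval"
    proof -
      have m: "(\<lambda>x. ennreal ((cmod (fiber c a f n x))\<^sup>2)) \<in> borel_measurable unit_interval" for n :: int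
        by (rule borel_unit') measurable
      have "(\<lambda>x. l2sum (\<lambda>n. fiber c a f n x)) \<in> borel_measurable unit_interval"
        using m by (rule borel_measurable_count_sum)
      then show ?thesis unfolding w_def using fiber_eq_wdiff[OF c]
        by (subst measurable_cong[where g = "\<lambda>x. l2sum (\<lambda>n. fiber c a f n x)"]) (auto simp: space_restrict_space)
    qed
    then have "ennreal ((L2_norm f)\<^sup>2) \<le> ennreal C1 * S"
      unfolding N S by (subst nn_integral_cmult[symmetric]) (auto intro: nn_integral_mono_AE[OF low])
    then have "ennreal ((L2_norm f)\<^sup>2) \<le> ennreal (C1 * (\<Sum>\<^sub>\<infinity>k\<in>UNIV. ?g k))"
      unfolding Sinf using C1(1) by (simp add: ennreal_mult infsum_nonneg)
    then have "(L2_norm f)\<^sup>2 \<le> C1 * (\<Sum>\<^sub>\<infinity>k\<in>UNIV. ?g k)"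
      using C1(1) by (subst (asm) ennreal_le_iff) (auto intro!: mult_nonneg_nonneg infsum_nonneg)
    moreover have "(\<Sum>\<^sub>\<infinity>k\<in>UNIV. ?g k) \<le> C2 * (L2_norm f)\<^sup>2"
      using upper C2(1) unfolding Sinf by (subst (asm) ennreal_le_iff) auto
    ultimately show ?thesis using sum C1(1) by (simp add: field_simps)
  qed
  show ?thesis unfolding is_frame_def
    by (intro conjI ballI countableI_type gabor_in_L2 exI[of _ "1 / C1"] exI[of _ C2]) (use C1(1) C2(1) main in auto)
qed

text \<open>The test function repeats one test vector on all fibers over a short interval of length
  \<open>d\<close>. Tolerance \<open>A / 2\<close> makes the frame sum at most
  \<open>A / 2 * d\<close>, while the norm squared is at least \<open>d\<close>.\<close>

lemma not_frame_if_null_set: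
  assumes a: "0 < a" and c: "0 < c" and ns: "null_set a c J t0 t1"
  shows "\<not> is_frame UNIV (gabor (H c) a)"
proof
  assume "is_frame UNIV (gabor (H c) a)"
  then obtain A B where A: "0 < A" and fr: "\<And>f. f \<in> L2 \<Longrightarrow> (\<lambda>k. (cmod (L2_inner f (gabor (H c) a k)))\<^sup>2) summable_on UNIV \<and>
          A * (L2_norm f)\<^sup>2 \<le> (\<Sum>\<^sub>\<infinity>k\<in>UNIV. (cmod (L2_inner f (gabor (H c) a k)))\<^sup>2)"
    unfolding is_frame_def by blast
  obtain v R where v: "v 0 = 1" "\<And>j. cmod (v j) \<le> 1" "\<And>j. R < \<bar>j\<bar> \<Longrightarrow> v j = 0"
    "\<And>t. t0 < t \<Longrightarrow> t < t1 \<Longrightarrow> l2sum (\<lambda>n. wdiff c v (t + of_int n * a)) \<le> ennreal (A / 2)"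
    by (rule null_set_test_vector[OF a c ns half_gt_zero[OF A]], rule that)
  \<comment> \<open>The fiber over \<open>x\<close> has offset \<open>- x\<close>, with
    \<open>x\<close> in \<open>[0, 1)\<close>. A shift of the sequence by \<open>k\<close> changes
    this to \<open>k - x\<close>, which equals the midpoint \<open>s\<close> at \<open>x0\<close>
    and stays in the admissible interval up to \<open>x0 + d\<close>.\<close>
  define s where "s = (t0 + t1) / 2"
  define k where "k = \<lceil>s\<rceil>"
  define x0 where "x0 = of_int k - s"
  define d where "d = min ((t1 - t0) / 2) (1 - x0)"
  have t01: "t0 < t1" using ns by (simp add: null_set_def)
  have x0: "0 \<le> x0" "x0 < 1" unfolding x0_def k_def by linarith+
  have d: "0 < d" "x0 + d \<le> 1" using t01 x0 by (auto simp: d_def)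
  have dt: "t0 < of_int k - x \<and> of_int k - x < t1" if "x \<in> {x0..<x0 + d}" for x
  proof -
    have "d \<le> (t1 - t0) / 2" unfolding d_def by (rule min.cobounded1)
    then have "2 * d \<le> t1 - t0" "2 * s = t0 + t1" by (simp_all add: s_def)
    then show ?thesis using that t01 by (simp add: x0_def)
  qed
  define f :: "real \<Rightarrow> complex" where "f x = v (\<lfloor>x\<rfloor> + k) * indicator {x0..<x0 + d} (x - of_int \<lfloor>x\<rfloor>)" for x
  have fxj: "f (x + of_int j) = v (j + k) * indicator {x0..<x0 + d} x" if "x \<in> {0..<1}" for x and j :: int
  proof -
    have "\<lfloor>x + of_int j\<rfloor> = j" using that by (intro floor_unique) auto
    then show ?thesis by (simp add: f_def)
  qed
  have fm: "f \<in> borel_measurable borel"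
  proof -
    have [measurable]: "(\<lambda>x::real. v (\<lfloor>x\<rfloor> + k)) \<in> borel_measurable borel" 
      by (rule measurable_compose[of "\<lambda>x. \<lfloor>x\<rfloor>" borel "count_space UNIV"]) auto
    show ?thesis unfolding f_def by measurable
  qed
  have "integrable lborel (\<lambda>x. (cmod (f x))\<^sup>2)"
  proof (rule Bochner_Integration.integrable_bound)
    let ?I = "{of_int (- R - k) .. of_int (R - k + 1)} :: real set"
    show "integrable lborel (indicator ?I :: real \<Rightarrow> real)"
      by (rule integrable_real_indicator) (auto simp: emeasure_lborel_Icc_eq)
    show "(\<lambda>x. (cmod (f x))\<^sup>2) \<in> borel_measurable lborel" using fm by simp
    show "AE x in lborel. norm ((cmod (f x))\<^sup>2) \<le> norm (indicator ?I x :: real)"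
    proof (rule AE_I2)
      fix x
      show "norm ((cmod (f x))\<^sup>2) \<le> norm (indicator ?I x :: real)"
      proof (cases "R < \<bar>\<lfloor>x\<rfloor> + k\<bar>")
        case True
        then show ?thesis using v(3) by (simp add: f_def)
      next
        case False
        then have "x \<in> ?I" by (simp add: abs_le_iff) linarith
        moreover have "cmod (f x) \<le> 1" using v(2) by (simp add: f_def indicator_def)
        ultimately show ?thesis by (simp add: power_le_one)
      qed
    qed
  qed
  then have f: "f \<in> L2" using fm by (simp add: L2_def)
  let ?D = "indicator {x0..<x0 + d} :: real \<Rightarrow> ennreal"
  have D: "(\<integral>\<^sup>+x. C * ?D x \<partial>unit_interval) = C * ennreal d" for C
  proof -
    have "(\<integral>\<^sup>+x. C * ?D x \<partial>unit_interval) = (\<integral>\<^sup>+x. C * ?D x * indicator {0..<1} x \<partial>lborel)"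
      by (rule nn_integral_unit) measurable
    also have "\<dots> = (\<integral>\<^sup>+x. C * ?D x \<partial>lborel)"
      using x0 d by (intro nn_integral_cong) (auto simp: indicator_def)
    also have "\<dots> = C * ennreal d" using d by (subst nn_integral_cmult_indicator) auto
    finally show ?thesis .
  qed
  have low: "ennreal d \<le> ennreal ((L2_norm f)\<^sup>2)"
  proof -
    have "1 * ennreal d = (\<integral>\<^sup>+x. 1 * ?D x \<partial>unit_interval)" by (rule D[symmetric])
    also have "\<dots> \<le> (\<integral>\<^sup>+x. l2sum (\<lambda>j. f (x + of_int j)) \<partial>unit_interval)"
    proof (rule nn_integral_mono)
      fix x assume "x \<in> space unit_interval"
      then have "f (x + of_int (- k)) = indicator {x0..<x0 + d} x" using fxj[of x "- k"] v(1) by (simp add: space_restrict_space)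
      then have "1 * ?D x = ennreal ((cmod (f (x + of_int (- k))))\<^sup>2)" by (simp add: indicator_def)
      also have "\<dots> \<le> l2sum (\<lambda>j. f (x + of_int j))" 
        by (rule nn_integral_ge_point[where p = "\<lambda>j. ennreal ((cmod (f (x + of_int j)))\<^sup>2)"]) simp
      finally show "1 * ?D x \<le> l2sum (\<lambda>j. f (x + of_int j))" .
    qed
    also have "\<dots> = ennreal ((L2_norm f)\<^sup>2)"
      unfolding unit_periodization[symmetric, OF fm] by (rule ennreal_L2_norm[OF f])
    finally show ?thesis by simp
  qed
  have "ennreal (\<Sum>\<^sub>\<infinity>k\<in>UNIV. (cmod (L2_inner f (gabor (H c) a k)))\<^sup>2) = 
      (\<integral>\<^sup>+k. ennreal ((cmod (L2_inner f (gabor (H c) a k)))\<^sup>2) \<partial>count_space UNIV)"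
    using fr[OF f] by (intro has_sum_imp_nn_sum[symmetric] has_sum_infsum) auto
  also have "\<dots> = (\<integral>\<^sup>+x. l2sum (\<lambda>n. wdiff c (\<lambda>j. f (x + of_int j)) (of_int n * a - x)) \<partial>unit_interval)"
    by (rule gabor_sum_eq[OF f c])
  also have "\<dots> \<le> (\<integral>\<^sup>+x. ennreal (A / 2) * ?D x \<partial>unit_interval)"
  proof (rule nn_integral_mono)
    fix x assume "x \<in> space unit_interval"
    then have fx: "f (x + of_int j) = v (j + k) * indicator {x0..<x0 + d} x" for j
      using fxj by (simp add: space_restrict_space)
    show "l2sum (\<lambda>n. wdiff c (\<lambda>j. f (x + of_int j)) (of_int n * a - x)) \<le> ennreal (A / 2) * ?D x"
    proof (cases "x \<in> {x0..<x0 + d}")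
      case True
      then have "wdiff c (\<lambda>j. f (x + of_int j)) (of_int n * a - x) = wdiff c v ((of_int k - x) + of_int n * a)" for n
        unfolding fx using wdiff_shift[of c v k "of_int n * a - x"] by (simp add: algebra_simps)
      then show ?thesis using v(4)[of "of_int k - x"] dt[OF True] True by simp
    next
      case False
      then have "f (x + of_int j) = 0" for j unfolding fx by simp
      then show ?thesis by (simp add: wdiff_def)
    qed
  qed
  also have "\<dots> = ennreal (A / 2 * d)" unfolding D by (rule ennreal_mult[symmetric]) (use A d in auto)
  finally have "(\<Sum>\<^sub>\<infinity>k\<in>UNIV. (cmod (L2_inner f (gabor (H c) a k)))\<^sup>2) \<le> A / 2 * d"
    using A d by (subst (asm) ennreal_le_iff) auto
  moreover have "A * d \<le> A * (L2_norm f)\<^sup>2" using low A d by (subst (asm) ennreal_le_iff) auto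
  ultimately have "A * d \<le> A / 2 * d" using fr[OF f] by linarith
  then show False using A d by simp
qed

lemma not_null_freeE:
  assumes "\<not> null_free a c"
  obtains V t where "\<And>k::int. \<bar>V (k + 1) - V k\<bar> \<le> (1::real)" "V 1 - V 0 = 1"
     "\<And>n::int. V \<lceil>t + of_int n * a + c\<rceil> + V \<lceil>t + of_int n * a - c\<rceil> = 2 * V \<lceil>t + of_int n * a\<rceil>"
  using assms unfolding null_free_def by blast

theorem theorem1p2:
  fixes a c :: real
  assumes "0 < a" and "a \<le> min 1 (2 * c)"
  shows
    "(a \<notin> \<rat> \<longrightarrow>
       (\<not> is_frame UNIV (gabor (H c) a) \<longleftrightarrow> (\<exists>n::nat. n \<ge> 1 \<and> c = real n)))
     \<and>
     (\<forall>p q. simple_fraction a p q \<longrightarrow>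
       (\<not> is_frame UNIV (gabor (H c) a) \<longleftrightarrow>
          (\<exists>n::nat. n \<ge> 1 \<and> \<bar>c - real n\<bar> < real (gcd n p) / (2 * real q)) \<or>
          (\<exists>n\<in>{1..} - (\<lambda>k. q * k) ` {1..}.
             \<bar>c - real n * real p / real q\<bar>
               < real (gcd n q) / (2 * real q) - (real q - real p) / (2 * real q))))"
proof -
  have a: "0 < a" "a \<le> 1" and ac: "a \<le> 2 * c" using assms by auto
  then have c: "0 < c" by linarith
  have part1: "\<not> is_frame UNIV (gabor (H c) a) \<longleftrightarrow> (\<exists>n::nat. n \<ge> 1 \<and> c = real n)" if irr: "a \<notin> \<rat>"
  proof
    assume "\<not> is_frame UNIV (gabor (H c) a)"
    then have "\<not> null_free a c" using frame_if_null_free[OF a(1) c] by blast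
    then show "\<exists>n::nat. n \<ge> 1 \<and> c = real n"
      by (rule not_null_freeE) (rule null_irrational[OF a ac _ _ _ irr])
  next
    assume "\<exists>n::nat. n \<ge> 1 \<and> c = real n"
    then obtain n :: nat where "c = real n" by blast
    then show "\<not> is_frame UNIV (gabor (H c) a)"
      using not_frame_if_null_set[OF a(1) c] null_set_nat[of a n] by simp
  qed
  have part2: "\<not> is_frame UNIV (gabor (H c) a) \<longleftrightarrow>
          (\<exists>n::nat. n \<ge> 1 \<and> \<bar>c - real n\<bar> < real (gcd n p) / (2 * real q)) \<or>
          (\<exists>n\<in>{1..} - (\<lambda>k. q * k) ` {1..}.
             \<bar>c - real n * real p / real q\<bar>
               < real (gcd n q) / (2 * real q) - (real q - real p) / (2 * real q))"
    (is "_ \<longleftrightarrow> ?P \<or> ?Q") if sf: "simple_fraction a p q" for p q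
  proof -
    \<comment> \<open>In the integral case \<open>a = 1\<close>, so \<open>p = q = 1\<close> and the
      same four facts hold.\<close>
    have pq: "a = real p / real q" "coprime p q" "0 < p" "0 < q"
      using sf a(1) by (auto simp: simple_fraction_def split: if_splits)
    then have "p \<le> q" using a(2) by simp
    show ?thesis
    proof
      assume "\<not> is_frame UNIV (gabor (H c) a)"
      then have "\<not> null_free a c" using frame_if_null_free[OF a(1) c] by blast
      then have "?P \<or> (\<exists>n::nat. n \<ge> 1 \<and> \<bar>c - real n * real p / real q\<bar>
               < real (gcd n q) / (2 * real q) - (real q - real p) / (2 * real q))"
        by (rule not_null_freeE) (rule null_rational[OF a ac _ _ _ pq])
      then show "?P \<or> ?Q"
      proof (elim disjE exE conjE)
        fix n :: nat assume n: "n \<ge> 1" and near: "\<bar>c - real n * real p / real q\<bar>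
               < real (gcd n q) / (2 * real q) - (real q - real p) / (2 * real q)"
        show ?thesis
        proof (cases "n \<in> (\<lambda>k. q * k) ` {1..}")
          case True
          \<comment> \<open>If \<open>n = q * k\<close>, then \<open>n * p / q\<close> is the
            integer \<open>k * p\<close> and the bound becomes \<open>p / (2 * q)\<close>; this is
            the first alternative for \<open>k * p\<close>, since
            \<open>gcd (k * p) p = p\<close>.\<close>
          then obtain k where k: "n = q * k" "k \<ge> 1" by auto
          have "\<bar>c - real (k * p)\<bar> < real q / (2 * real q) - (real q - real p) / (2 * real q)"
            using near k pq(4) by (simp add: gcd_nat.absorb2)
          also have "\<dots> = real (gcd (k * p) p) / (2 * real q)"
            by (simp add: gcd_nat.absorb2 diff_divide_distrib)
          finally have "\<bar>c - real (k * p)\<bar> < real (gcd (k * p) p) / (2 * real q)" .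
          moreover have "k * p \<ge> 1" using k(2) pq(3) by simp
          ultimately show ?thesis by blast
        qed (use n near in blast)
      qed blast
    next
      assume "?P \<or> ?Q"
      then obtain J t0 t1 where "null_set a c J t0 t1"
      proof (elim disjE exE bexE conjE)
        fix n :: nat assume "\<bar>c - real n\<bar> < real (gcd n p) / (2 * real q)"
        from null_set_gcd_p[OF pq(3,4) this] show ?thesis using that pq(1) by blast
      next
        fix n assume "n \<in> {1..} - (\<lambda>k. q * k) ` {1..}" and near: "\<bar>c - real n * real p / real q\<bar>
               < real (gcd n q) / (2 * real q) - (real q - real p) / (2 * real q)"
        then have "1 \<le> n" by simp
        from null_set_gcd_q[OF pq(3) \<open>p \<le> q\<close> this near] show ?thesis using that pq(1) by blast
      qed
      then show "\<not> is_frame UNIV (gabor (H c) a)" by (rule not_frame_if_null_set[OF a(1) c])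
    qed
  qed
  show ?thesis using part1 part2 by simp
qed

end
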